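(* Let $M$ be an arbitrary $d\times d$ matrix dilation, $c\in\frac12\mathbb Z^d$ and $n\in\mathbb N$. A general form for all masks $m_0$ which are symmetric with respect to the point $c$ in the sense (b), i.e. $m_0(\xi)=e^{2\pi i(2c,\xi)}\overline{m_0(\xi)}$, and have sum rule of order $n$ (with respect to $M$) is given by $$m_0(\xi)=m_0^*(\xi)+e^{2\pi i(c,\xi)}\sum_{j\in J}\ \sum_{\alpha\in\mathbb Z^d_+,\,[\alpha]=n}\Big(\widetilde A_{\alpha j}(M^*\xi)\,\mathrm{Re}\,\Pi_\alpha(M^*\xi)+\widetilde B_{\alpha j}(M^*\xi)\,\mathrm{Im}\,\Pi_\alpha(M^*\xi)\Big)$$ $$+\sum_{i\in I^1}\ \sum_{\alpha\in\mathbb Z^d_+,\,[\alpha]=n}\Big(T_{\alpha i}(M^*\xi)\Pi_\alpha(M^*\xi)e^{2\pi i(s_i,\xi)}+\overline{T_{\alpha i}(M^*\xi)\Pi_\alpha(M^*\xi)}\,e^{2\pi i(2c-s_i,\xi)}\Big),$$ where, for $\alpha\in\mathbb Z^d_+$, $[\alpha]=n$, $j\in J$, $i\in I^1$: $\widetilde A_{\alpha j}$, $\widetilde B_{\alpha j}$ are arbitrary real trigonometric polynomials of semi-integer degrees associated with $\sigma=M^{-1}(c-s_j)-\lfloor M^{-1}(c-s_j)\rfloor$; $T_{\alpha i}$ are arbitrary trigonometric polynomials; and $m_0^*$ is the mask $$m_0^*(\xi)=\frac1m\sum_{j\in J}\sum_{\beta\in\Delta_n}\lambda'_\beta G^B_{\beta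 j}(M^*\xi)e^{2\pi i(c,\xi)}$$ $$+\frac1m\sum_{i\in I^1}\Bigg[\sum_{\beta\in\Delta_n}\Big(\sum_{\gamma\in\mathbb Z^d_+,\,\gamma\le\beta}\lambda'_\gamma\binom{\beta}{\gamma}(M^{-1}c-M^{-1}s_i)^{\beta-\gamma}\Big)G_{\beta i}(M^*\xi)e^{2\pi i(s_i,\xi)}$$ $$+\sum_{\beta\in\Delta_n}\Big(\sum_{\gamma\in\mathbb Z^d_+,\,\gamma\le\beta}\overline{\lambda'_\gamma}\binom{\beta}{\gamma}(M^{-1}c-M^{-1}s_i)^{\beta-\gamma}\Big)\overline{G_{\beta i}(M^*\xi)}\,e^{2\pi i(2c-s_i,\xi)}\Bigg]$$ for some numbers $\lambda'_\alpha\in\mathbb C$, $\alpha\in\Delta_n$, with $\lambda'_{\mathbf 0}=1$, $\mathrm{Re}\,\lambda'_\alpha=0$ if $[\alpha]$ is odd, and $\mathrm{Im}\,\lambda'_\alpha=0$ if $[\alpha]$ is even. (That is, a trigonometric polynomial is a mask with the two stated properties if and only if it can be written in this form.)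
   Context: Notation: $\mathbb Z^d_+=\{x\in\mathbb Z^d:x\ge\mathbf 0\}$, inequalities and floor $\lfloor\cdot\rfloor$ of vectors are coordinatewise; $[\alpha]=\sum_j\alpha_j$; $\binom{\beta}{\gamma}=\beta!/(\gamma!(\beta-\gamma)!)$ and $a^b=\prod_j a_j^{b_j}$ for multi-indices; $\Delta_n=\{\alpha\in\mathbb Z^d_+:[\alpha]<n\}$; $\Pi_\alpha(\xi)=\prod_{j=1}^d(1-e^{2\pi i\xi_j})^{\alpha_j}$. Functions of $\xi$ are considered for $\xi\in\mathbb R^d$; "real" means real-valued on $\mathbb R^d$. A matrix dilation $M$ is an integer $d\times d$ matrix all of whose eigenvalues are bigger than 1 in modulus; $M^*$ is its conjugate (transpose), $m=|\det M|$. A set of digits $D(M)=\{s_0,\dots,s_{m-1}\}$ contains exactly one representative of each of the $m$ cosets of $\mathbb Z^d/M\mathbb Z^d$. A trigonometric polynomial of semi-integer degrees associated with $\sigma\in\frac12\mathbb Z^d\cap[0,\frac12]^d$ is a finite sum $\sum_{k\in\mathbb Z^d}h_ke^{2\pi i(k+\sigma,\xi)}$, $h_k\in\mathbb C$; a trigonometric polynomial is the case $\sigma=\mathbf 0$. A mask is a trigonometric polynomial $m_0$ with $m_0(\mathbf 0)=1$. A trigonometric polynomial $t$ has sum rule of order $n$ with respect to $M$ if $D^\beta\big(t(M^{*-1}\xi)\big)|_{\xi=s}=0$ for all $s\in D(M^* )\setminus\{\mathbf 0\}$ and all $\beta\in\Delta_n$, where $D(M^* )$ is a set of digits of $M^*$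 containing $\mathbf 0$. Index sets: for each $k\in\{0,\dots,m-1\}$ there is a unique $l\in\{0,\dots,m-1\}$ with $M^{-1}(2c-s_k-s_l)\in\mathbb Z^d$. $J$ is the set of those $k$ for which $l=k$; $I$ is the set of those $k$ for which $l\ne k$, and for $i\in I$ the corresponding $l$ is denoted $i'$ (also in $I$). The digits are chosen so that $s_i+s_{i'}=2c$ for all $i\in I$. $I=I^1\cup I^2$ is a disjoint splitting such that $i\in I^1$ iff $i'\in I^2$. $\Theta_{\beta,n}$ (for $\beta\in\Delta_n$) is the class of trigonometric polynomials $t$ of integer or semi-integer degrees with $D^\alpha t(\mathbf 0)=(2\pi i)^{[\alpha]}\delta_{\alpha\beta}$ for all $\alpha\in\Delta_n$; $\Theta^B_{\beta,n}=\{t\in\Theta_{\beta,n}:t(\xi)=(-1)^{[\beta]}\overline{t(\xi)}\}$. In the formula for $m_0^*$, $G_{\beta i}\in\Theta_{\beta,n}$ ($\beta\in\Delta_n$, $i\in I^1$) are (chosen) trigonometric polynomials and $G^B_{\beta j}\in\Theta^B_{\beta,n}$ ($\beta\in\Delta_n$, $j\in J$) are (chosen) trigonometric polynomials of semi-integer degrees associated with $\sigma=M^{-1}(c-s_j)-\lfloor M^{-1}(c-s_j)\rfloor$. *)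

theory Defs
  imports "HOL-Analysis.Analysis"
begin

definition of_int_vec :: "int^'d \<Rightarrow> 'a::ring_1^'d" where
  "of_int_vec k = (\<chi> j. of_int (k $ j))"

definition of_int_mat :: "int^'d^'e \<Rightarrow> 'a::ring_1^'d^'e" where
  "of_int_mat M = (\<chi> i j. of_int (M $ i $ j))"

definition half_int_lattice :: "(real^'d) set" where
  "half_int_lattice = {x. \<forall>j. 2 * x $ j \<in> \<int>}"

definition floor_vec :: "real^'d \<Rightarrow> int^'d" where
  "floor_vec x = (\<chi> j. \<lfloor>x $ j\<rfloor>)"

text \<open>
  Matrices are integer, so the conjugate matrix $M^*$ is the transpose.  The real matrices
  $M^{-1}$, $M^*$ and $M^{*-1}$ act on real vectors as follows.
\<close>

definition inv_act :: "int^'d^'d \<Rightarrow> real^'d \<Rightarrow> real^'d" where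
  "inv_act M x = matrix_inv (of_int_mat M) *v x"

definition star_act :: "int^'d^'d \<Rightarrow> real^'d \<Rightarrow> real^'d" where
  "star_act M x = transpose (of_int_mat M) *v x"

definition inv_star_act :: "int^'d^'d \<Rightarrow> real^'d \<Rightarrow> real^'d" where
  "inv_star_act M x = matrix_inv (transpose (of_int_mat M)) *v x"

definition is_eigenvalue :: "complex^'d^'d \<Rightarrow> complex \<Rightarrow> bool" where
  "is_eigenvalue A z \<longleftrightarrow> (\<exists>v. v \<noteq> 0 \<and> A *v v = z *s v)"

definition matrix_dilation :: "int^'d^'d \<Rightarrow> bool" where
  "matrix_dilation M \<longleftrightarrow> (\<forall>z. is_eigenvalue (of_int_mat M) z \<longrightarrow> cmod z > 1)"

definition digit_set :: "int^'d^'d \<Rightarrow> (int^'d) set \<Rightarrow> bool" where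
  "digit_set M D \<longleftrightarrow> (\<forall>k. \<exists>!s. s \<in> D \<and> (\<exists>l. k - s = M *v l))"

abbreviation num_digits :: "int^'d^'d \<Rightarrow> nat" where
  "num_digits M \<equiv> nat \<bar>det M\<bar>"

text \<open>Multi-indices have type \<^typ>\<open>nat^'d\<close>; the library order on vectors is coordinatewise.\<close>

definition mi_size :: "nat^'d \<Rightarrow> nat" where
  "mi_size \<alpha> = (\<Sum>j\<in>UNIV. \<alpha> $ j)"

definition mi_fact :: "nat^'d \<Rightarrow> real" where
  "mi_fact \<alpha> = (\<Prod>j\<in>UNIV. fact (\<alpha> $ j))"

definition mi_binom :: "nat^'d \<Rightarrow> nat^'d \<Rightarrow> real" where
  "mi_binom \<beta> \<gamma> = mi_fact \<beta> / (mi_fact \<gamma> * mi_fact (\<beta> - \<gamma>))"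

definition mi_pow :: "real^'d \<Rightarrow> nat^'d \<Rightarrow> real" where
  "mi_pow a \<beta> = (\<Prod>j\<in>UNIV. (a $ j) ^ (\<beta> $ j))"

definition Delta :: "nat \<Rightarrow> (nat^'d) set" where
  "Delta n = {\<alpha>. mi_size \<alpha> < n}"

definition partial :: "'d \<Rightarrow> (real^'d \<Rightarrow> complex) \<Rightarrow> real^'d \<Rightarrow> complex" where
  "partial j f x = vector_derivative (\<lambda>t. f (x + t *\<^sub>R axis j 1)) (at 0)"

text \<open>
  The coordinate type carries no order, so \<open>D\<^sup>\<alpha>\<close> takes the partial derivatives along an
  arbitrary fixed enumeration of the coordinates.  It is applied to smooth functions only,
  for which the order of differentiation is immaterial.
\<close>

definition coords :: "'d::finite list" where
  "coords = (SOME xs. distinct xs \<and> set xs = UNIV)"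

lemma coords: "distinct (coords :: 'd::finite list)" "set (coords :: 'd list) = UNIV"
proof -
  have "\<exists>xs :: 'd list. distinct xs \<and> set xs = UNIV"
    using finite_distinct_list[of "UNIV :: 'd set"] by auto
  then have "distinct (coords :: 'd list) \<and> set (coords :: 'd list) = UNIV"
    unfolding coords_def by (rule someI_ex)
  then show "distinct (coords :: 'd list)" "set (coords :: 'd list) = UNIV" by auto
qed

definition mi_deriv :: "nat^'d \<Rightarrow> (real^'d \<Rightarrow> complex) \<Rightarrow> real^'d \<Rightarrow> complex" where
  "mi_deriv \<alpha> f = foldr (\<lambda>j. partial j ^^ (\<alpha> $ j)) coords f"

lemma finite_mi_le: "finite {\<gamma> :: nat^'d. \<gamma> \<le> \<beta>}"
proof -
  have "{\<gamma> :: nat^'d. \<gamma> \<le> \<beta>} \<subseteq> vec_lambda ` (Pi\<^sub>E UNIV (\<lambda>j. {..\<beta> $ j}))"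
  proof
    fix \<gamma> :: "nat^'d" assume "\<gamma> \<in> {\<gamma>. \<gamma> \<le> \<beta>}"
    then show "\<gamma> \<in> vec_lambda ` (Pi\<^sub>E UNIV (\<lambda>j. {..\<beta> $ j}))"
      by (intro image_eqI[of _ _ "vec_nth \<gamma>"]) (auto simp: less_eq_vec_def)
  qed
  then show ?thesis by (rule finite_subset) (intro finite_imageI finite_PiE, auto)
qed

lemma finite_mi_size_le: "finite {\<alpha> :: nat^'d. mi_size \<alpha> \<le> n}"
proof (rule finite_subset[OF _ finite_mi_le[of "\<chi> j. n"]], safe)
  fix \<alpha> :: "nat^'d" assume "mi_size \<alpha> \<le> n"
  moreover have "\<alpha> $ j \<le> mi_size \<alpha>" for j
    unfolding mi_size_def by (rule member_le_sum) auto
  ultimately show "\<alpha> \<le> (\<chi> j. n)" by (auto simp: less_eq_vec_def intro: le_trans)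
qed

lemma finite_Delta: "finite (Delta n :: (nat^'d) set)"
  by (rule finite_subset[OF _ finite_mi_size_le[of n]]) (auto simp: Delta_def)

definition expi :: "real^'d \<Rightarrow> real^'d \<Rightarrow> complex" where
  "expi a \<xi> = exp (2 * of_real pi * \<i> * of_real (a \<bullet> \<xi>))"

definition semi_trig_poly :: "real^'d \<Rightarrow> (real^'d \<Rightarrow> complex) \<Rightarrow> bool" where
  "semi_trig_poly \<sigma> t \<longleftrightarrow>
     \<sigma> \<in> half_int_lattice \<and> (\<forall>j. 0 \<le> \<sigma> $ j \<and> \<sigma> $ j \<le> 1/2) \<and>
     (\<exists>(K :: (int^'d) set) h. finite K \<and>
        (\<forall>\<xi>. t \<xi> = (\<Sum>k\<in>K. h k * expi (of_int_vec k + \<sigma>) \<xi>)))"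

definition trig_poly :: "(real^'d \<Rightarrow> complex) \<Rightarrow> bool" where
  "trig_poly t \<longleftrightarrow> semi_trig_poly 0 t"

definition is_mask :: "(real^'d \<Rightarrow> complex) \<Rightarrow> bool" where
  "is_mask t \<longleftrightarrow> trig_poly t \<and> t 0 = 1"

definition symmetric_wrt :: "real^'d \<Rightarrow> (real^'d \<Rightarrow> complex) \<Rightarrow> bool" where
  "symmetric_wrt c t \<longleftrightarrow> (\<forall>\<xi>. t \<xi> = expi (2 *\<^sub>R c) \<xi> * cnj (t \<xi>))"

definition sum_rule ::
  "int^'d^'d \<Rightarrow> (int^'d) set \<Rightarrow> nat \<Rightarrow> (real^'d \<Rightarrow> complex) \<Rightarrow> bool" where
  "sum_rule M Dstar n t \<longleftrightarrow>
     (\<forall>s \<in> Dstar - {0}. \<forall>\<beta> \<in> Delta n.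
        mi_deriv \<beta> (\<lambda>\<xi>. t (inv_star_act M \<xi>)) (of_int_vec s) = 0)"

definition Pi_mi :: "nat^'d \<Rightarrow> real^'d \<Rightarrow> complex" where
  "Pi_mi \<alpha> \<xi> = (\<Prod>j\<in>UNIV. (1 - exp (2 * of_real pi * \<i> * of_real (\<xi> $ j))) ^ (\<alpha> $ j))"

definition Theta :: "nat^'d \<Rightarrow> nat \<Rightarrow> (real^'d \<Rightarrow> complex) set" where
  "Theta \<beta> n = {t. (\<exists>\<sigma>. semi_trig_poly \<sigma> t) \<and>
     (\<forall>\<alpha> \<in> Delta n. mi_deriv \<alpha> t 0 =
        (2 * of_real pi * \<i>) ^ mi_size \<alpha> * (if \<alpha> = \<beta> then 1 else 0))}"

definition ThetaB :: "nat^'d \<Rightarrow> nat \<Rightarrow> (real^'d \<Rightarrow> complex) set" where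
  "ThetaB \<beta> n = {t \<in> Theta \<beta> n. \<forall>\<xi>. t \<xi> = (-1) ^ mi_size \<beta> * cnj (t \<xi>)}"

definition partner :: "int^'d^'d \<Rightarrow> real^'d \<Rightarrow> (nat \<Rightarrow> int^'d) \<Rightarrow> nat \<Rightarrow> nat" where
  "partner M c s k = (THE l. l < num_digits M \<and>
     inv_act M (2 *\<^sub>R c - of_int_vec (s k) - of_int_vec (s l)) \<in> range of_int_vec)"

definition J_set :: "int^'d^'d \<Rightarrow> real^'d \<Rightarrow> (nat \<Rightarrow> int^'d) \<Rightarrow> nat set" where
  "J_set M c s = {k. k < num_digits M \<and> partner M c s k = k}"

definition I_set :: "int^'d^'d \<Rightarrow> real^'d \<Rightarrow> (nat \<Rightarrow> int^'d) \<Rightarrow> nat set" where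
  "I_set M c s = {k. k < num_digits M \<and> partner M c s k \<noteq> k}"

definition digit_sigma :: "int^'d^'d \<Rightarrow> real^'d \<Rightarrow> (nat \<Rightarrow> int^'d) \<Rightarrow> nat \<Rightarrow> real^'d" where
  "digit_sigma M c s j =
     inv_act M (c - of_int_vec (s j)) - of_int_vec (floor_vec (inv_act M (c - of_int_vec (s j))))"

definition m0_star ::
  "int^'d^'d \<Rightarrow> real^'d \<Rightarrow> nat \<Rightarrow> (nat \<Rightarrow> int^'d) \<Rightarrow> nat set
   \<Rightarrow> (nat^'d \<Rightarrow> nat \<Rightarrow> real^'d \<Rightarrow> complex) \<Rightarrow> (nat^'d \<Rightarrow> nat \<Rightarrow> real^'d \<Rightarrow> complex)
   \<Rightarrow> (nat^'d \<Rightarrow> complex) \<Rightarrow> real^'d \<Rightarrow> complex" where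
  "m0_star M c n s I1 G GB lam \<xi> =
     1 / of_nat (num_digits M) *
       (\<Sum>j\<in>J_set M c s. \<Sum>\<beta>\<in>Delta n. lam \<beta> * GB \<beta> j (star_act M \<xi>) * expi c \<xi>)
   + 1 / of_nat (num_digits M) *
       (\<Sum>i\<in>I1.
          (\<Sum>\<beta>\<in>Delta n.
             (\<Sum>\<gamma>\<in>{\<gamma>. \<gamma> \<le> \<beta>}. lam \<gamma> * of_real (mi_binom \<beta> \<gamma> *
                mi_pow (inv_act M c - inv_act M (of_int_vec (s i))) (\<beta> - \<gamma>)))
             * G \<beta> i (star_act M \<xi>) * expi (of_int_vec (s i)) \<xi>)
        + (\<Sum>\<beta>\<in>Delta n.
             (\<Sum>\<gamma>\<in>{\<gamma>. \<gamma> \<le> \<beta>}. cnj (lam \<gamma>) * of_real (mi_binom \<beta> \<gamma> *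
                mi_pow (inv_act M c - inv_act M (of_int_vec (s i))) (\<beta> - \<gamma>)))
             * cnj (G \<beta> i (star_act M \<xi>)) * expi (2 *\<^sub>R c - of_int_vec (s i)) \<xi>))"

end

theory Submission
  imports Defs
begin

text \<open>
  The idea is to split a mask along the cosets of \<open>\<int>\<^sup>d/M\<int>\<^sup>d\<close> and to do Fourier analysis on this finite
  group.  Grouping the frequencies of \<open>m\<^sub>0\<close> by their residue modulo \<open>M\<int>\<^sup>d\<close> gives
  \<open>m\<^sub>0(\<xi>) = expi c \<xi> \<cdot> \<Sum>\<^sub>k H\<^sub>k(M\<^sup>*\<xi>)\<close>, where the frequencies of \<open>H\<^sub>k\<close> lie in \<open>M\<^sup>-\<^sup>1(s\<^sub>k - c) + \<int>\<^sup>d\<close>.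
  Integer translations act on \<open>H\<^sub>k\<close> by a character of the group that depends on \<open>k\<close>, so the components can
  be recovered from the translates of their sum by the digits of \<open>M\<^sup>*\<close> (\<open>polyphase_inversion\<close>).  In
  particular they are unique, and both properties of the mask can be read off from them
  (\<open>symmetric_sum_rule_mask_iff\<close>).  Symmetry about \<open>c\<close> means that \<open>\<Sum>\<^sub>k H\<^sub>k\<close> is real, that is, the
  component of the partner of \<open>k\<close> is the conjugate of \<open>H\<^sub>k\<close>.  The sum rule of order \<open>n\<close> means that the
  nontrivial Fourier coefficients of the family \<open>(H\<^sub>k)\<close> vanish to order \<open>n\<close> at the origin, that is, all
  \<open>H\<^sub>k\<close> have the same derivatives of order less than \<open>n\<close> at \<open>0\<close> (\<open>sum_rule_iff\<close>).  Up to powers of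
  \<open>2\<pi>i\<close> and the factor \<open>1/m\<close>, these common derivatives are the numbers \<open>\<lambda>'\<^sub>\<alpha>\<close>; they are real before
  the normalization, which is the parity condition on the \<open>\<lambda>'\<^sub>\<alpha>\<close>.

  It remains to describe the functions with given derivatives at \<open>0\<close>.  The functions from the \<open>\<Theta>\<close> classes
  supply one solution, and the difference of two solutions vanishes to order \<open>n\<close>.  Trigonometric polynomials
  with this property are exactly the \<open>\<Sum> T\<^sub>\<alpha> \<Pi>\<^sub>\<alpha>\<close> over \<open>[\<alpha>] = n\<close>: a Laurent polynomial that vanishes to order
  \<open>n\<close> at \<open>(1, \<dots>, 1)\<close> belongs to the \<open>n\<close>-th power of the ideal of this point (\<open>flat_imp_in_Pi_ideal\<close>).

  For a pair of partners \<open>i \<noteq> i'\<close> one component may be chosen freely and determines the other one.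
  Multiplication of \<open>H\<^sub>i\<close> by \<open>expi (M\<^sup>-\<^sup>1(c - s\<^sub>i))\<close> makes its degrees integral and changes its
  derivatives according to the Leibniz rule, which produces the sums over \<open>\<gamma> \<le> \<beta>\<close> in \<open>m\<^sub>0\<^sup>*\<close>
  (\<open>free_phase_iff\<close>).  For a digit that is its own partner the component is real of semi-integer degrees, and
  taking real parts of \<open>\<Sum> U\<^sub>\<alpha> \<Pi>\<^sub>\<alpha>\<close> produces the terms with \<open>Re \<Pi>\<^sub>\<alpha>\<close> and \<open>Im \<Pi>\<^sub>\<alpha>\<close>
  (\<open>self_phase_iff\<close>).
\<close>

section \<open>Exponential sums and their derivatives\<close>

text \<open>
  The frequencies are arbitrary real vectors.  This covers at once trigonometric polynomials of
  integer and semi-integer degrees and the functions \<open>expi a\<close> with \<open>a \<in> M\<^sup>-\<^sup>1\<int>\<^sup>d\<close> that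
  occur when \<open>\<xi>\<close> is replaced by \<open>M\<^sup>*\<^sup>-\<^sup>1\<xi>\<close>.
\<close>

definition exp_sum :: "(real^'d) set \<Rightarrow> (real^'d \<Rightarrow> complex) \<Rightarrow> bool" where
  "exp_sum S f \<longleftrightarrow> (\<exists>X h. finite X \<and> X \<subseteq> S \<and> f = (\<lambda>\<xi>. \<Sum>a\<in>X. h a * expi a \<xi>))"

lemma exp_sumE:
  assumes "exp_sum S f"
  obtains X h where "finite X" "X \<subseteq> S" "f = (\<lambda>\<xi>. \<Sum>a\<in>X. h a * expi a \<xi>)"
  using assms unfolding exp_sum_def by blast

lemma expi_0 [simp]: "expi 0 \<xi> = 1" "expi a 0 = 1"
  by (simp_all add: expi_def)

lemma expi_add: "expi (a + b) \<xi> = expi a \<xi> * expi b \<xi>"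
  by (simp add: expi_def inner_add_left ring_distribs exp_add)

lemma expi_add_right: "expi a (\<xi> + \<eta>) = expi a \<xi> * expi a \<eta>"
  by (simp add: expi_def inner_add_right ring_distribs exp_add)

lemma expi_minus_self [simp]: "expi (- a) \<xi> * expi a \<xi> = 1" "expi a \<xi> * expi (- a) \<xi> = 1"
  by (simp_all add: expi_add[symmetric])

lemma cnj_expi: "cnj (expi a \<xi>) = expi (- a) \<xi>"
  by (simp add: expi_def exp_cnj)

text \<open>
  Sums over arbitrary index types are what sums and products of exponential sums naturally
  produce; distinct indices may carry the same frequency, so coefficients are collected along the
  fibres of \<open>a\<close>.
\<close>

lemma exp_sum_finite_index:
  assumes "finite I" "\<And>i. i \<in> I \<Longrightarrow> a i \<in> S"
  shows "exp_sum S (\<lambda>\<xi>. \<Sum>i\<in>I. h i * expi (a i) \<xi>)"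
  unfolding exp_sum_def
proof (intro exI conjI ext)
  show "finite (a ` I)" "a ` I \<subseteq> S" using assms by auto
  show "(\<Sum>i\<in>I. h i * expi (a i) \<xi>) =
        (\<Sum>b\<in>a ` I. (\<Sum>i\<in>{i\<in>I. a i = b}. h i) * expi b \<xi>)" for \<xi>
    by (subst sum.image_gen[OF assms(1), of _ a]) (auto simp: sum_distrib_right intro!: sum.cong)
qed

lemma exp_sum_mono: "exp_sum S f \<Longrightarrow> S \<subseteq> T \<Longrightarrow> exp_sum T f"
  unfolding exp_sum_def by blast

lemma exp_sum_zero: "exp_sum S (\<lambda>\<xi>. 0)"
  using exp_sum_finite_index[of "{}" _ S] by simp

lemma exp_sum_expi: "a \<in> S \<Longrightarrow> exp_sum S (expi a)"
  using exp_sum_finite_index[of "{a}" "\<lambda>x. x" S "\<lambda>_. 1"] by simp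

lemma exp_sum_add:
  assumes "exp_sum S f" "exp_sum S g"
  shows "exp_sum S (\<lambda>\<xi>. f \<xi> + g \<xi>)"
proof -
  obtain X h where X: "finite X" "X \<subseteq> S" "f = (\<lambda>\<xi>. \<Sum>a\<in>X. h a * expi a \<xi>)"
    using exp_sumE[OF assms(1)] .
  obtain Y k where Y: "finite Y" "Y \<subseteq> S" "g = (\<lambda>\<xi>. \<Sum>a\<in>Y. k a * expi a \<xi>)"
    using exp_sumE[OF assms(2)] .
  have "f \<xi> + g \<xi> = (\<Sum>i\<in>X <+> Y. case_sum h k i * expi (case_sum id id i) \<xi>)" for \<xi>
    using X Y by (simp add: sum.Plus)
  moreover have "exp_sum S (\<lambda>\<xi>. \<Sum>i\<in>X <+> Y. case_sum h k i * expi (case_sum id id i) \<xi>)"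
    using X Y by (intro exp_sum_finite_index) auto
  ultimately show ?thesis by simp
qed

lemma exp_sum_mult:
  assumes "exp_sum S f" "exp_sum T g" "\<And>a b. a \<in> S \<Longrightarrow> b \<in> T \<Longrightarrow> a + b \<in> U"
  shows "exp_sum U (\<lambda>\<xi>. f \<xi> * g \<xi>)"
proof -
  obtain X h where X: "finite X" "X \<subseteq> S" "f = (\<lambda>\<xi>. \<Sum>a\<in>X. h a * expi a \<xi>)"
    using exp_sumE[OF assms(1)] .
  obtain Y k where Y: "finite Y" "Y \<subseteq> T" "g = (\<lambda>\<xi>. \<Sum>a\<in>Y. k a * expi a \<xi>)"
    using exp_sumE[OF assms(2)] .
  have "f \<xi> * g \<xi> = (\<Sum>i\<in>X \<times> Y. (h (fst i) * k (snd i)) * expi (fst i + snd i) \<xi>)" for \<xi>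
    using X Y by (simp add: sum_product sum.cartesian_product case_prod_beta expi_add mult_ac)
  moreover have "exp_sum U (\<lambda>\<xi>. \<Sum>i\<in>X \<times> Y. (h (fst i) * k (snd i)) * expi (fst i + snd i) \<xi>)"
    using X(1,2) Y(1,2) by (intro exp_sum_finite_index) (auto intro!: assms(3))
  ultimately show ?thesis by simp
qed

lemma exp_sum_cmult: "exp_sum S f \<Longrightarrow> exp_sum S (\<lambda>\<xi>. z * f \<xi>)"
  unfolding exp_sum_def
  by (elim exE conjE, rule_tac x=X in exI, rule_tac x="\<lambda>a. z * h a" in exI)
     (auto simp: sum_distrib_left mult_ac)

lemma exp_sum_sum:
  assumes "\<And>i. i \<in> I \<Longrightarrow> exp_sum S (f i)"
  shows "exp_sum S (\<lambda>\<xi>. \<Sum>i\<in>I. f i \<xi>)"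
  using assms by (induction I rule: infinite_finite_induct) (auto intro: exp_sum_zero exp_sum_add)

lemma exp_sum_diff: "exp_sum S f \<Longrightarrow> exp_sum S g \<Longrightarrow> exp_sum S (\<lambda>\<xi>. f \<xi> - g \<xi>)"
  using exp_sum_add[OF _ exp_sum_cmult[of S g "-1"]] by simp

lemma exp_sum_cnj:
  assumes "exp_sum S f" "\<And>a. a \<in> S \<Longrightarrow> - a \<in> T"
  shows "exp_sum T (\<lambda>\<xi>. cnj (f \<xi>))"
proof -
  obtain X h where X: "finite X" "X \<subseteq> S" "f = (\<lambda>\<xi>. \<Sum>a\<in>X. h a * expi a \<xi>)"
    using exp_sumE[OF assms(1)] .
  show ?thesis unfolding X(3) cnj_sum complex_cnj_mult cnj_expi
    using X assms by (intro exp_sum_finite_index) auto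
qed

lemma exp_sum_UNIV: "exp_sum S f \<Longrightarrow> exp_sum UNIV f"
  by (erule exp_sum_mono) simp

lemma exp_sum_translate: "exp_sum S f \<Longrightarrow> exp_sum S (\<lambda>\<xi>. f (\<xi> + s))"
  unfolding exp_sum_def
  by (elim exE conjE, rule_tac x=X in exI, rule_tac x="\<lambda>a. h a * expi a s" in exI)
     (auto simp: expi_add_right mult_ac)

lemma partial_exp_sum:
  fixes a :: "'i \<Rightarrow> real^'d"
  shows "partial j (\<lambda>\<xi>. \<Sum>i\<in>I. h i * expi (a i) \<xi>) =
     (\<lambda>\<xi>. \<Sum>i\<in>I. (2 * of_real pi * \<i> * of_real (a i $ j)) * h i * expi (a i) \<xi>)"
proof
  fix \<xi> :: "real^'d"
  have "((\<lambda>t. expi b (\<xi> + t *\<^sub>R axis j 1)) has_vector_derivative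
          2 * of_real pi * \<i> * of_real (b $ j) * expi b \<xi>) (at 0)" for b
  proof -
    have "((\<lambda>t. exp (2 * of_real pi * \<i> * of_real (b \<bullet> \<xi> + t * b $ j))) has_vector_derivative
       2 * of_real pi * \<i> * of_real (b $ j) * exp (2 * of_real pi * \<i> * of_real (b \<bullet> \<xi> + 0 * b $ j)))
       (at 0)"
      by (rule field_vector_diff_chain_at[of _ _ _ exp, unfolded o_def])
         (auto intro!: derivative_eq_intros)
    then show ?thesis
      by (simp add: expi_def inner_add_right inner_axis)
  qed
  then have "((\<lambda>t. \<Sum>i\<in>I. h i * expi (a i) (\<xi> + t *\<^sub>R axis j 1)) has_vector_derivative
          (\<Sum>i\<in>I. h i * (2 * of_real pi * \<i> * of_real (a i $ j) * expi (a i) \<xi>))) (at 0)"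
    by (intro has_vector_derivative_sum has_vector_derivative_mult_right)
  then show "partial j (\<lambda>\<xi>. \<Sum>i\<in>I. h i * expi (a i) \<xi>) \<xi> =
     (\<Sum>i\<in>I. (2 * of_real pi * \<i> * of_real (a i $ j)) * h i * expi (a i) \<xi>)"
    unfolding partial_def by (subst vector_derivative_at) (auto simp: mult_ac)
qed

text \<open>
  Exponentials are common eigenfunctions of the partial derivatives.  All facts below about
  \<open>mi_deriv\<close> (linearity, Leibniz rule, translation, conjugation) reduce to this formula, which
  also removes the dependence on the enumeration of the coordinates.
\<close>

lemma mi_deriv_exp_sum:
  "mi_deriv \<alpha> (\<lambda>\<xi>. \<Sum>i\<in>I. h i * expi (a i) \<xi>) =
     (\<lambda>\<xi>. \<Sum>i\<in>I. (2 * of_real pi * \<i>) ^ mi_size \<alpha> * of_real (mi_pow (a i) \<alpha>) * h i * expi (a i) \<xi>)"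
proof -
  have iter: "(partial j ^^ k) (\<lambda>\<xi>. \<Sum>i\<in>I. g i * expi (a i) \<xi>) =
     (\<lambda>\<xi>. \<Sum>i\<in>I. (2 * of_real pi * \<i> * of_real (a i $ j)) ^ k * g i * expi (a i) \<xi>)" for j k g
  proof (induction k)
    case (Suc k)
    then show ?case
      by (simp only: funpow.simps o_def Suc.IH partial_exp_sum) (simp add: mult_ac)
  qed simp
  have fold: "foldr (\<lambda>j. partial j ^^ (\<alpha> $ j)) xs (\<lambda>\<xi>. \<Sum>i\<in>I. h i * expi (a i) \<xi>) =
     (\<lambda>\<xi>. \<Sum>i\<in>I. (\<Prod>j\<in>set xs. (2 * of_real pi * \<i> * of_real (a i $ j)) ^ (\<alpha> $ j)) * h i * expi (a i) \<xi>)"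
    if "distinct xs" for xs
    using that
  proof (induction xs)
    case (Cons j xs)
    then have "foldr (\<lambda>j. partial j ^^ (\<alpha> $ j)) (j # xs) (\<lambda>\<xi>. \<Sum>i\<in>I. h i * expi (a i) \<xi>) =
      (\<lambda>\<xi>. \<Sum>i\<in>I. (2 * of_real pi * \<i> * of_real (a i $ j)) ^ (\<alpha> $ j) *
        ((\<Prod>j\<in>set xs. (2 * of_real pi * \<i> * of_real (a i $ j)) ^ (\<alpha> $ j)) * h i) * expi (a i) \<xi>)"
      by (simp only: foldr.simps o_def distinct.simps iter)
    with Cons.prems show ?case by (simp add: mult.assoc)
  qed simp
  show ?thesis
    unfolding mi_deriv_def fold[OF coords(1)] coords(2)
    by (simp add: mi_size_def mi_pow_def power_mult_distrib prod.distrib power_sum mult_ac)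
qed

lemma mi_deriv_translate:
  assumes "exp_sum S f"
  shows "mi_deriv \<alpha> (\<lambda>\<xi>. f (\<xi> + s)) \<xi> = mi_deriv \<alpha> f (\<xi> + s)"
proof -
  obtain X h where X: "finite X" "X \<subseteq> S" "f = (\<lambda>\<xi>. \<Sum>a\<in>X. h a * expi a \<xi>)"
    using exp_sumE[OF assms(1)] .
  have "(\<lambda>\<xi>. f (\<xi> + s)) = (\<lambda>\<xi>. \<Sum>a\<in>X. (h a * expi a s) * expi a \<xi>)"
    by (simp add: X expi_add_right mult_ac)
  then show ?thesis
    by (simp only: mi_deriv_exp_sum X expi_add_right) (simp add: mult_ac)
qed

lemma mi_deriv_add:
  assumes "exp_sum S f" "exp_sum T g"
  shows "mi_deriv \<alpha> (\<lambda>\<xi>. f \<xi> + g \<xi>) \<xi> = mi_deriv \<alpha> f \<xi> + mi_deriv \<alpha> g \<xi>"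
proof -
  obtain X h where X: "finite X" "X \<subseteq> S" "f = (\<lambda>\<xi>. \<Sum>a\<in>X. h a * expi a \<xi>)"
    using exp_sumE[OF assms(1)] .
  obtain Y k where Y: "finite Y" "Y \<subseteq> T" "g = (\<lambda>\<xi>. \<Sum>a\<in>Y. k a * expi a \<xi>)"
    using exp_sumE[OF assms(2)] .
  have eq: "(\<lambda>\<xi>. f \<xi> + g \<xi>) = (\<lambda>\<xi>. \<Sum>i\<in>X <+> Y. case_sum h k i * expi (case_sum id id i) \<xi>)"
    using X Y by (simp add: sum.Plus)
  show ?thesis
    unfolding eq unfolding X(3) Y(3) mi_deriv_exp_sum using X(1) Y(1) by (simp add: sum.Plus)
qed

lemma mi_deriv_cmult:
  assumes "exp_sum S f"
  shows "mi_deriv \<alpha> (\<lambda>\<xi>. z * f \<xi>) \<xi> = z * mi_deriv \<alpha> f \<xi>"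
proof -
  obtain X h where X: "finite X" "X \<subseteq> S" "f = (\<lambda>\<xi>. \<Sum>a\<in>X. h a * expi a \<xi>)"
    using exp_sumE[OF assms(1)] .
  have "(\<lambda>\<xi>. z * f \<xi>) = (\<lambda>\<xi>. \<Sum>a\<in>X. (z * h a) * expi a \<xi>)"
    by (simp add: X sum_distrib_left mult_ac)
  then show ?thesis
    by (simp only: mi_deriv_exp_sum X sum_distrib_left) (simp add: mult_ac)
qed

lemma mi_deriv_zero: "mi_deriv \<alpha> (\<lambda>\<xi>. 0) \<xi> = 0"
  using mi_deriv_cmult[OF exp_sum_zero, of \<alpha> 0] by simp

lemma mi_deriv_sum:
  assumes "\<And>i. i \<in> I \<Longrightarrow> exp_sum S (f i)"
  shows "mi_deriv \<alpha> (\<lambda>\<xi>. \<Sum>i\<in>I. f i \<xi>) \<xi> = (\<Sum>i\<in>I. mi_deriv \<alpha> (f i) \<xi>)"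
  using assms
proof (induction I rule: infinite_finite_induct)
  case (insert i I)
  have "mi_deriv \<alpha> (\<lambda>\<xi>. f i \<xi> + (\<Sum>i\<in>I. f i \<xi>)) \<xi> =
        mi_deriv \<alpha> (f i) \<xi> + mi_deriv \<alpha> (\<lambda>\<xi>. \<Sum>i\<in>I. f i \<xi>) \<xi>"
    by (rule mi_deriv_add[of S _ S]) (auto intro!: exp_sum_sum insert.prems)
  also have "mi_deriv \<alpha> (\<lambda>\<xi>. \<Sum>i\<in>I. f i \<xi>) \<xi> = (\<Sum>i\<in>I. mi_deriv \<alpha> (f i) \<xi>)"
    by (rule insert.IH) (auto intro: insert.prems)
  finally show ?case using insert.hyps by simp
qed (auto simp: mi_deriv_zero)

lemma cnj_two_pi_i_power: "cnj ((2 * of_real pi * \<i>) ^ k) = (2 * of_real pi * \<i>) ^ k * (-1) ^ k"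
  by (simp flip: power_mult_distrib)

lemma mi_deriv_cnj:
  fixes f :: "real^'d \<Rightarrow> complex"
  assumes "exp_sum S f"
  shows "mi_deriv \<alpha> (\<lambda>\<xi>. cnj (f \<xi>)) \<xi> = cnj (mi_deriv \<alpha> f \<xi>)"
proof -
  obtain X h where X: "finite X" "X \<subseteq> S" "f = (\<lambda>\<xi>. \<Sum>a\<in>X. h a * expi a \<xi>)"
    using exp_sumE[OF assms(1)] .
  have neg: "mi_pow (- a) \<alpha> = (-1) ^ mi_size \<alpha> * mi_pow a \<alpha>" for a :: "real^'d"
    by (simp add: mi_pow_def mi_size_def power_sum prod.distrib[symmetric] power_minus[of "_ $ _"])
  show ?thesis
    unfolding X(3) cnj_sum complex_cnj_mult cnj_expi mi_deriv_exp_sum cnj_two_pi_i_power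
    by (intro sum.cong refl) (simp add: neg)
qed

lemma mi_binom_prod:
  assumes "\<gamma> \<le> \<beta>"
  shows "mi_binom \<beta> \<gamma> = (\<Prod>j\<in>UNIV. real ((\<beta> $ j) choose (\<gamma> $ j)))"
  using assms unfolding mi_binom_def mi_fact_def prod.distrib[symmetric] prod_dividef[symmetric]
  by (intro prod.cong) (auto simp: less_eq_vec_def binomial_fact)

text \<open>
  The multi-index binomial theorem: expand the product over the coordinates of the
  one-dimensional binomial expansions.  For exponentials it is the Leibniz rule.
\<close>

lemma mi_pow_add:
  "mi_pow (a + b) \<beta> = (\<Sum>\<gamma>\<in>{\<gamma>. \<gamma> \<le> \<beta>}. mi_binom \<beta> \<gamma> * mi_pow a \<gamma> * mi_pow b (\<beta> - \<gamma>))"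
proof -
  have "mi_pow (a + b) \<beta> =
     (\<Prod>j\<in>UNIV. \<Sum>k\<le>\<beta> $ j. real (\<beta> $ j choose k) * (a $ j) ^ k * (b $ j) ^ (\<beta> $ j - k))"
    by (simp add: mi_pow_def binomial_ring)
  also have "\<dots> = (\<Sum>g\<in>Pi\<^sub>E UNIV (\<lambda>j. {..\<beta> $ j}).
      \<Prod>j\<in>UNIV. real (\<beta> $ j choose g j) * (a $ j) ^ g j * (b $ j) ^ (\<beta> $ j - g j))"
    by (rule prod_sum_PiE) auto
  also have "\<dots> = (\<Sum>\<gamma>\<in>{\<gamma>. \<gamma> \<le> \<beta>}. mi_binom \<beta> \<gamma> * mi_pow a \<gamma> * mi_pow b (\<beta> - \<gamma>))"
  proof (rule sum.reindex_bij_witness[of _ vec_nth vec_lambda])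
    fix g assume "g \<in> Pi\<^sub>E UNIV (\<lambda>j. {..\<beta> $ j})"
    then have "vec_lambda g \<le> \<beta>" by (auto simp: less_eq_vec_def)
    then show "vec_lambda g \<in> {\<gamma>. \<gamma> \<le> \<beta>}"
      "mi_binom \<beta> (vec_lambda g) * mi_pow a (vec_lambda g) * mi_pow b (\<beta> - vec_lambda g) =
       (\<Prod>j\<in>UNIV. real (\<beta> $ j choose g j) * (a $ j) ^ g j * (b $ j) ^ (\<beta> $ j - g j))"
      by (simp_all add: mi_binom_prod mi_pow_def prod.distrib)
  qed (auto simp: less_eq_vec_def)
  finally show ?thesis .
qed

lemma mi_size_add: "mi_size (\<alpha> + \<beta>) = mi_size \<alpha> + mi_size \<beta>"
  by (simp add: mi_size_def sum.distrib)

lemma mi_le_add_diff: "\<gamma> \<le> \<beta> \<Longrightarrow> \<gamma> + (\<beta> - \<gamma>) = (\<beta> :: nat^'d)"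
  by (simp add: less_eq_vec_def vec_eq_iff)

lemma mi_size_diff: "\<gamma> \<le> \<beta> \<Longrightarrow> mi_size \<beta> = mi_size \<gamma> + mi_size (\<beta> - \<gamma>)"
  by (metis mi_le_add_diff mi_size_add)

lemma mi_deriv_mult:
  assumes "exp_sum S f" "exp_sum T g"
  shows "mi_deriv \<beta> (\<lambda>\<xi>. f \<xi> * g \<xi>) 0 =
    (\<Sum>\<gamma>\<in>{\<gamma>. \<gamma> \<le> \<beta>}. of_real (mi_binom \<beta> \<gamma>) * mi_deriv \<gamma> f 0 * mi_deriv (\<beta> - \<gamma>) g 0)"
proof -
  obtain X h where X: "finite X" "X \<subseteq> S" "f = (\<lambda>\<xi>. \<Sum>a\<in>X. h a * expi a \<xi>)"
    using exp_sumE[OF assms(1)] .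
  obtain Y k where Y: "finite Y" "Y \<subseteq> T" "g = (\<lambda>\<xi>. \<Sum>a\<in>Y. k a * expi a \<xi>)"
    using exp_sumE[OF assms(2)] .
  let ?w = "2 * of_real pi * \<i> :: complex"
  have eq: "(\<lambda>\<xi>. f \<xi> * g \<xi>) = (\<lambda>\<xi>. \<Sum>i\<in>X \<times> Y. (h (fst i) * k (snd i)) * expi (fst i + snd i) \<xi>)"
    using X Y by (simp add: sum_product sum.cartesian_product case_prod_beta expi_add mult_ac)
  have "mi_deriv \<beta> (\<lambda>\<xi>. f \<xi> * g \<xi>) 0 =
     (\<Sum>(a, b)\<in>X \<times> Y. \<Sum>\<gamma>\<in>{\<gamma>. \<gamma> \<le> \<beta>}.
        ?w ^ mi_size \<beta> * of_real (mi_binom \<beta> \<gamma> * mi_pow a \<gamma> * mi_pow b (\<beta> - \<gamma>)) * (h a * k b))"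
    unfolding eq mi_deriv_exp_sum mi_pow_add
    by (simp add: case_prod_beta sum_distrib_left sum_distrib_right)
  also have "\<dots> = (\<Sum>\<gamma>\<in>{\<gamma>. \<gamma> \<le> \<beta>}. \<Sum>(a, b)\<in>X \<times> Y.
        ?w ^ mi_size \<beta> * of_real (mi_binom \<beta> \<gamma> * mi_pow a \<gamma> * mi_pow b (\<beta> - \<gamma>)) * (h a * k b))"
    unfolding case_prod_beta by (rule sum.swap)
  also have "\<dots> = (\<Sum>\<gamma>\<in>{\<gamma>. \<gamma> \<le> \<beta>}. of_real (mi_binom \<beta> \<gamma>) *
       ((\<Sum>a\<in>X. ?w ^ mi_size \<gamma> * of_real (mi_pow a \<gamma>) * h a) *
        (\<Sum>b\<in>Y. ?w ^ mi_size (\<beta> - \<gamma>) * of_real (mi_pow b (\<beta> - \<gamma>)) * k b)))"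
  proof (intro sum.cong refl)
    fix \<gamma> assume "\<gamma> \<in> {\<gamma>. \<gamma> \<le> \<beta>}"
    then have "mi_size \<beta> = mi_size \<gamma> + mi_size (\<beta> - \<gamma>)" by (simp add: mi_size_diff)
    then show "(\<Sum>(a, b)\<in>X \<times> Y.
        ?w ^ mi_size \<beta> * of_real (mi_binom \<beta> \<gamma> * mi_pow a \<gamma> * mi_pow b (\<beta> - \<gamma>)) * (h a * k b)) =
      of_real (mi_binom \<beta> \<gamma>) *
       ((\<Sum>a\<in>X. ?w ^ mi_size \<gamma> * of_real (mi_pow a \<gamma>) * h a) *
        (\<Sum>b\<in>Y. ?w ^ mi_size (\<beta> - \<gamma>) * of_real (mi_pow b (\<beta> - \<gamma>)) * k b))"
      unfolding sum_product unfolding sum.cartesian_product unfolding sum_distrib_left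
      by (intro sum.cong refl) (auto simp: power_add)
  qed
  finally show ?thesis
    by (simp add: X Y mi_deriv_exp_sum mult.assoc)
qed

lemma mi_deriv_expi: "mi_deriv \<alpha> (expi a) \<xi> = (2 * of_real pi * \<i>) ^ mi_size \<alpha> * of_real (mi_pow a \<alpha>) * expi a \<xi>"
  using mi_deriv_exp_sum[of \<alpha> "\<lambda>_. 1" "\<lambda>_. a" "{()}"] by simp

lemma mi_size_0 [simp]: "mi_size 0 = 0"
  by (simp add: mi_size_def)

lemma mi_deriv_0: "mi_deriv 0 f = f"
proof -
  have "foldr (\<lambda>j::'a. partial j ^^ (0 $ j)) xs f = f" for xs by (induction xs) auto
  then show ?thesis by (simp add: mi_deriv_def)
qed

section \<open>Functions vanishing to a given order at the origin\<close>

text \<open>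
  The sum rule and the agreement of two Taylor expansions are statements of this form.  Flat
  functions absorb products with arbitrary exponential sums, so Taylor expansions can be compared
  modulo flat functions without computing them.
\<close>

definition flat :: "nat \<Rightarrow> (real^'d \<Rightarrow> complex) \<Rightarrow> bool" where
  "flat n f \<longleftrightarrow> (\<forall>\<alpha>\<in>Delta n. mi_deriv \<alpha> f 0 = 0)"

lemma flat_add: "exp_sum S f \<Longrightarrow> exp_sum T g \<Longrightarrow> flat n f \<Longrightarrow> flat n g \<Longrightarrow> flat n (\<lambda>\<xi>. f \<xi> + g \<xi>)"
  unfolding flat_def by (simp add: mi_deriv_add)

lemma flat_cmult: "exp_sum S f \<Longrightarrow> flat n f \<Longrightarrow> flat n (\<lambda>\<xi>. z * f \<xi>)"
  unfolding flat_def by (simp add: mi_deriv_cmult)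

lemma flat_sum:
  "(\<And>i. i \<in> I \<Longrightarrow> exp_sum S (f i)) \<Longrightarrow> (\<And>i. i \<in> I \<Longrightarrow> flat n (f i)) \<Longrightarrow> flat n (\<lambda>\<xi>. \<Sum>i\<in>I. f i \<xi>)"
  unfolding flat_def by (subst mi_deriv_sum[of I S f]) auto

lemma flat_cnj: "exp_sum S f \<Longrightarrow> flat n f \<Longrightarrow> flat n (\<lambda>\<xi>. cnj (f \<xi>))"
  unfolding flat_def by (simp add: mi_deriv_cnj)

lemma mi_deriv_diff:
  assumes "exp_sum S f" "exp_sum T g"
  shows "mi_deriv \<alpha> (\<lambda>\<xi>. f \<xi> - g \<xi>) \<xi> = mi_deriv \<alpha> f \<xi> - mi_deriv \<alpha> g \<xi>"
  using mi_deriv_add[OF assms(1) exp_sum_cmult[OF assms(2), of "-1"], of \<alpha> \<xi>]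
  by (simp add: mi_deriv_cmult[OF assms(2), of \<alpha> "-1", simplified])

lemma flat_diff_iff:
  "exp_sum S f \<Longrightarrow> exp_sum T g \<Longrightarrow>
    flat n (\<lambda>\<xi>. f \<xi> - g \<xi>) \<longleftrightarrow> (\<forall>\<alpha>\<in>Delta n. mi_deriv \<alpha> f 0 = mi_deriv \<alpha> g 0)"
  unfolding flat_def by (simp add: mi_deriv_diff)

lemma flat_0: "flat 0 f"
  by (simp add: flat_def Delta_def)

text \<open>
  In each term of the Leibniz formula for an order less than \<open>a + b\<close>, either \<open>f\<close> is
  differentiated less than \<open>a\<close> times or \<open>g\<close> less than \<open>b\<close> times.
\<close>

lemma flat_mult:
  assumes "exp_sum S f" "exp_sum T g" "flat a f" "flat b g"
  shows "flat (a + b) (\<lambda>\<xi>. f \<xi> * g \<xi>)"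
  unfolding flat_def mi_deriv_mult[OF assms(1,2)]
proof (intro ballI sum.neutral)
  fix \<beta> \<gamma> :: "nat^'a"
  assume "\<beta> \<in> Delta (a + b)" "\<gamma> \<in> {\<gamma>. \<gamma> \<le> \<beta>}"
  then have "\<gamma> \<in> Delta a \<or> \<beta> - \<gamma> \<in> Delta b"
    using mi_size_diff[of \<gamma> \<beta>] by (auto simp: Delta_def)
  then show "of_real (mi_binom \<beta> \<gamma>) * mi_deriv \<gamma> f 0 * mi_deriv (\<beta> - \<gamma>) g 0 = 0"
    using assms(3,4) by (auto simp: flat_def)
qed

lemma flat_mult_right: "exp_sum S f \<Longrightarrow> exp_sum T g \<Longrightarrow> flat n g \<Longrightarrow> flat n (\<lambda>\<xi>. f \<xi> * g \<xi>)"
  using flat_mult[of S f T g 0 n] flat_0[of f] by simp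

lemma flat_1_iff: "flat 1 f \<longleftrightarrow> f 0 = 0"
proof -
  have "Delta 1 = {0 :: nat^'a}"
    by (auto simp: Delta_def mi_size_def vec_eq_iff)
  then show ?thesis by (simp add: flat_def mi_deriv_0)
qed

section \<open>Frequencies in a coset of the integer lattice\<close>

definition coset :: "real^'d \<Rightarrow> (real^'d) set" where
  "coset a = {of_int_vec k + a | k. True}"

lemma of_int_vec_add: "of_int_vec (k + l) = of_int_vec k + (of_int_vec l :: real^'d)"
  by (simp add: of_int_vec_def vec_eq_iff)

lemma of_int_vec_minus: "of_int_vec (- k) = - (of_int_vec k :: real^'d)"
  by (simp add: of_int_vec_def vec_eq_iff)

lemma of_int_vec_diff: "of_int_vec (k - l) = of_int_vec k - (of_int_vec l :: real^'d)"
  by (simp add: of_int_vec_def vec_eq_iff)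

lemma of_int_vec_0 [simp]: "of_int_vec 0 = (0 :: real^'d)"
  by (simp add: of_int_vec_def vec_eq_iff)

lemma coset_self: "a \<in> coset a"
  unfolding coset_def by (auto intro!: exI[of _ 0])

lemma coset_add: "x \<in> coset a \<Longrightarrow> y \<in> coset b \<Longrightarrow> x + y \<in> coset (a + b)"
  unfolding coset_def by clarsimp (metis (no_types, lifting) of_int_vec_add add.assoc add.left_commute)

lemma coset_minus: "x \<in> coset a \<Longrightarrow> - x \<in> coset (- a)"
  unfolding coset_def by clarsimp (metis of_int_vec_minus diff_conv_add_uminus uminus_add_conv_diff minus_add)

lemma coset_eqI: "a - b \<in> range of_int_vec \<Longrightarrow> coset a = coset b"
proof -
  have *: "coset x \<subseteq> coset y" if xy: "x - y \<in> range of_int_vec" for x y :: "real^'a"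
  proof
    fix z assume "z \<in> coset x"
    then obtain k l where "z = of_int_vec k + x" "x - y = of_int_vec l"
      using xy by (auto simp: coset_def)
    then have "z = of_int_vec (k + l) + y" by (simp add: of_int_vec_add algebra_simps)
    then show "z \<in> coset y" by (auto simp: coset_def)
  qed
  assume ab: "a - b \<in> range of_int_vec"
  then obtain l where "a - b = of_int_vec l" by auto
  then have "b - a = of_int_vec (- l)" by (simp add: of_int_vec_minus) (metis minus_diff_eq)
  with ab show "coset a = coset b" by (intro equalityI *) auto
qed

text \<open>
  Only the coset of \<open>\<sigma>\<close> modulo \<open>\<int>\<^sup>d\<close> matters for the shape of the sum; the normalization of
  \<open>\<sigma>\<close> is a separate condition.
\<close>

lemma semi_trig_poly_iff:
  "semi_trig_poly \<sigma> t \<longleftrightarrow>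
    \<sigma> \<in> half_int_lattice \<and> (\<forall>j. 0 \<le> \<sigma> $ j \<and> \<sigma> $ j \<le> 1/2) \<and> exp_sum (coset \<sigma>) t"
proof -
  have "(\<exists>(K :: (int^'a) set) h. finite K \<and> (\<forall>\<xi>. t \<xi> = (\<Sum>k\<in>K. h k * expi (of_int_vec k + \<sigma>) \<xi>)))
     \<longleftrightarrow> exp_sum (coset \<sigma>) t" (is "?L \<longleftrightarrow> _")
  proof
    assume ?L
    then obtain K h where K: "finite K" "t = (\<lambda>\<xi>. \<Sum>k\<in>K. h k * expi (of_int_vec k + \<sigma>) \<xi>)"
      by (auto simp: fun_eq_iff)
    show "exp_sum (coset \<sigma>) t"
      unfolding K by (rule exp_sum_finite_index) (auto simp: K coset_def)
  next
    assume "exp_sum (coset \<sigma>) t"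
    then obtain X h where X: "finite X" "X \<subseteq> coset \<sigma>" "t = (\<lambda>\<xi>. \<Sum>a\<in>X. h a * expi a \<xi>)"
      by (rule exp_sumE)
    have inj: "inj_on (\<lambda>k :: int^'a. of_int_vec k + \<sigma>) UNIV"
      by (auto simp: inj_on_def of_int_vec_def vec_eq_iff)
    define K where "K = (\<lambda>k. of_int_vec k + \<sigma>) -` X"
    have "X = (\<lambda>k. of_int_vec k + \<sigma>) ` K" using X(2) by (auto simp: K_def coset_def)
    moreover have "finite K" unfolding K_def using finite_vimageI[OF X(1) inj] .
    ultimately have "finite K \<and> (\<forall>\<xi>. t \<xi> = (\<Sum>k\<in>K. h (of_int_vec k + \<sigma>) * expi (of_int_vec k + \<sigma>) \<xi>))"
      unfolding X(3) by (auto simp: sum.reindex inj_on_subset[OF inj])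
    then show ?L by (intro exI)
  qed
  then show ?thesis unfolding semi_trig_poly_def by simp
qed

lemma trig_poly_iff: "trig_poly t \<longleftrightarrow> exp_sum (coset 0) t"
  by (simp add: trig_poly_def semi_trig_poly_iff half_int_lattice_def)

lemma exp_sum_coset_mult:
  "exp_sum (coset a) f \<Longrightarrow> exp_sum (coset b) g \<Longrightarrow> exp_sum (coset (a + b)) (\<lambda>\<xi>. f \<xi> * g \<xi>)"
  by (erule exp_sum_mult) (auto intro: coset_add)

lemma exp_sum_coset_cnj: "exp_sum (coset a) f \<Longrightarrow> exp_sum (coset (- a)) (\<lambda>\<xi>. cnj (f \<xi>))"
  by (erule exp_sum_cnj) (rule coset_minus)

lemma exp_sum_coset_expi: "exp_sum (coset a) (expi a)"
  by (rule exp_sum_expi) (rule coset_self)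

lemma exp_sum_coset0_mult: "exp_sum (coset 0) f \<Longrightarrow> exp_sum (coset 0) g \<Longrightarrow> exp_sum (coset 0) (\<lambda>\<xi>. f \<xi> * g \<xi>)"
  using exp_sum_coset_mult[of 0 f 0 g] by simp

lemma exp_sum_const: "exp_sum (coset 0) (\<lambda>\<xi>. z)"
  using exp_sum_cmult[OF exp_sum_coset_expi[of 0], of z] by simp

section \<open>Trigonometric polynomials that vanish to order n\<close>

\<comment> \<open>keeps the unit multi-index in the form \<open>axis j 1\<close>\<close>
declare One_nat_def [simp del]

lemma of_int_vec_axis: "of_int_vec (axis j 1) = (axis j 1 :: real^'d)"
  by (simp add: of_int_vec_def axis_def vec_eq_iff)

lemma exp_sum_axis: "exp_sum (coset 0) (expi (axis j 1))"
  by (rule exp_sum_expi) (auto simp: coset_def of_int_vec_axis[symmetric])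

lemma exp_sum_one_minus: "exp_sum (coset 0) (\<lambda>\<xi>. 1 - expi (axis j 1) \<xi>)"
  by (intro exp_sum_diff exp_sum_const exp_sum_axis)

text \<open>
  In the variables \<open>z\<^sub>j = expi (axis j 1)\<close> trigonometric polynomials are Laurent polynomials, and
  this is the \<open>n\<close>-th power of the ideal generated by the \<open>1 - z\<^sub>j\<close>, that is, of the maximal ideal
  of the point \<open>(1, \<dots>, 1)\<close>.
\<close>

definition in_Pi_ideal :: "nat \<Rightarrow> (real^'d \<Rightarrow> complex) \<Rightarrow> bool" where
  "in_Pi_ideal n f \<longleftrightarrow> (\<exists>T. (\<forall>\<alpha>. exp_sum (coset 0) (T \<alpha>)) \<and>
     f = (\<lambda>\<xi>. \<Sum>\<alpha>\<in>{\<alpha>. mi_size \<alpha> = n}. T \<alpha> \<xi> * Pi_mi \<alpha> \<xi>))"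

lemma finite_mi_size: "finite {\<alpha> :: nat^'d. mi_size \<alpha> = n}"
  by (rule finite_subset[OF _ finite_mi_size_le[of n]]) auto

lemma Pi_mi_eq: "Pi_mi \<alpha> \<xi> = (\<Prod>j\<in>UNIV. (1 - expi (axis j 1) \<xi>) ^ (\<alpha> $ j))"
  by (simp add: Pi_mi_def expi_def inner_axis' )

lemma Pi_mi_0: "Pi_mi 0 \<xi> = 1"
  by (simp add: Pi_mi_def)

lemma Pi_mi_add_axis: "Pi_mi (\<alpha> + axis j 1) \<xi> = (1 - expi (axis j 1) \<xi>) * Pi_mi \<alpha> \<xi>"
proof -
  have "(\<Prod>i\<in>UNIV. (1 - expi (axis i 1) \<xi>) ^ (axis j 1 $ i)) = 1 - expi (axis j 1) \<xi>"
    by (subst prod.remove[of _ j]) (auto simp: axis_def intro!: prod.neutral)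
  then show ?thesis
    by (simp add: Pi_mi_eq power_add prod.distrib mult.commute)
qed

lemma mi_size_axis: "mi_size (axis j 1) = 1"
  by (simp add: mi_size_def axis_def)

lemma mi_size_SucE:
  assumes "mi_size \<beta> = Suc n"
  obtains j \<alpha> where "\<beta> = \<alpha> + axis j 1" "mi_size \<alpha> = n"
proof -
  obtain j where j: "\<beta> $ j > 0"
    using assms unfolding mi_size_def by (metis bot_nat_0.not_eq_extremum sum.neutral nat.distinct(1))
  have "\<beta> = (\<beta> - axis j 1) + axis j 1" using j by (auto simp: vec_eq_iff axis_def)
  moreover from this have "mi_size (\<beta> - axis j 1) = n"
    using assms mi_size_add[of "\<beta> - axis j 1" "axis j 1"] by (simp add: mi_size_axis)
  ultimately show ?thesis by (rule that)
qed

lemma Pi_mi_exp_sum_flat: "exp_sum (coset 0) (Pi_mi \<beta>) \<and> flat (mi_size \<beta>) (Pi_mi \<beta>)"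
proof (induction "mi_size \<beta>" arbitrary: \<beta>)
  case 0
  then have "\<beta> = 0" by (auto simp: mi_size_def vec_eq_iff)
  then show ?case using exp_sum_const[of 1] by (simp add: Pi_mi_0[abs_def] flat_0)
next
  case (Suc n)
  then obtain j \<alpha> where a: "\<beta> = \<alpha> + axis j 1" "mi_size \<alpha> = n" by (metis mi_size_SucE)
  have eq: "Pi_mi \<beta> = (\<lambda>\<xi>. (1 - expi (axis j 1) \<xi>) * Pi_mi \<alpha> \<xi>)"
    by (simp add: a Pi_mi_add_axis fun_eq_iff)
  have IH: "exp_sum (coset 0) (Pi_mi \<alpha>)" "flat n (Pi_mi \<alpha>)" using Suc.hyps(1)[of \<alpha>] a by auto
  have "flat 1 (\<lambda>\<xi>. 1 - expi (axis j 1) \<xi>)" by (simp add: flat_1_iff)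
  from flat_mult[OF exp_sum_one_minus IH(1) this IH(2)] show ?case
    using exp_sum_coset0_mult[OF exp_sum_one_minus[of j] IH(1)]
    by (simp add: eq plus_1_eq_Suc flip: Suc.hyps(2))
qed

lemmas Pi_mi_exp_sum = Pi_mi_exp_sum_flat[THEN conjunct1]
lemmas Pi_mi_flat = Pi_mi_exp_sum_flat[THEN conjunct2]

lemma mi_binom_axis: "\<alpha> $ j > 0 \<Longrightarrow> mi_binom \<alpha> (axis j 1) = real (\<alpha> $ j)"
proof -
  assume "\<alpha> $ j > 0"
  then have "axis j 1 \<le> \<alpha>" by (auto simp: less_eq_vec_def axis_def)
  then have "mi_binom \<alpha> (axis j 1) = (\<Prod>i\<in>UNIV. real ((\<alpha> $ i) choose (axis j 1 $ i)))"
    by (rule mi_binom_prod)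
  also have "\<dots> = real (\<alpha> $ j)"
    by (subst prod.remove[of _ j]) (auto simp: axis_def One_nat_def intro!: prod.neutral)
  finally show ?thesis .
qed

lemma mi_deriv_one_minus:
  assumes "mi_size \<gamma> = 1"
  shows "mi_deriv \<gamma> (\<lambda>\<xi>. 1 - expi (axis j 1) \<xi>) 0 = (if \<gamma> = axis j 1 then - 2 * of_real pi * \<i> else 0)"
proof -
  obtain i \<alpha> where "\<gamma> = \<alpha> + axis i 1" "mi_size \<alpha> = 0" using assms by (metis One_nat_def mi_size_SucE)
  then have g: "\<gamma> = axis i 1" by (auto simp: mi_size_def vec_eq_iff)
  have zero: "(mi_pow 0 \<gamma> :: real) = 0"
    unfolding mi_pow_def g by (rule prod_zero) (auto intro!: exI[of _ i])
  have pow: "mi_pow (axis j 1) \<gamma> = (if i = j then 1 else 0)"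
    unfolding mi_pow_def g by (subst prod.remove[of _ i]) (auto simp: axis_def intro!: prod.neutral)
  have one: "mi_deriv \<gamma> (\<lambda>\<xi>. 1) 0 = 0"
    using mi_deriv_expi[of \<gamma> 0 0] zero by (simp add: expi_0[abs_def])
  have "axis i (1::nat) = axis j 1 \<longleftrightarrow> i = j" by (auto simp: axis_eq_axis)
  then show ?thesis
    by (simp add: mi_deriv_diff[OF exp_sum_const exp_sum_axis] one[unfolded g] pow[unfolded g] mi_deriv_expi mi_size_axis g)
qed

text \<open>
  In the Leibniz formula for \<open>1 - z\<^sub>j\<close> times a function flat of order \<open>k\<close>, a derivative of total
  order \<open>k + 1\<close> leaves one term: no derivative on the first factor gives its value \<open>0\<close>, and two
  or more leave fewer than \<open>k\<close> for the second.
\<close>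

lemma mi_deriv_one_minus_mult:
  assumes f: "exp_sum S f" "flat k f" and a: "mi_size \<alpha> = Suc k"
  shows "mi_deriv \<alpha> (\<lambda>\<xi>. (1 - expi (axis j 1) \<xi>) * f \<xi>) 0 =
    - 2 * of_real pi * \<i> * of_nat (\<alpha> $ j) * mi_deriv (\<alpha> - axis j 1) f 0"
proof -
  let ?u = "\<lambda>\<xi>. 1 - expi (axis j 1) \<xi> :: complex"
  let ?t = "\<lambda>\<gamma>. of_real (mi_binom \<alpha> \<gamma>) * mi_deriv \<gamma> ?u 0 * mi_deriv (\<alpha> - \<gamma>) f 0"
  have t0: "?t \<gamma> = 0" if "\<gamma> \<le> \<alpha>" "\<gamma> \<noteq> axis j 1" for \<gamma>
  proof -
    consider "mi_size \<gamma> = 0" | "mi_size \<gamma> = 1" | "mi_size \<gamma> > 1" by linarith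
    then show ?thesis
    proof cases
      case 1
      then have "\<gamma> = 0" by (auto simp: mi_size_def vec_eq_iff)
      then show ?thesis by (simp add: mi_deriv_0)
    next
      case 2
      then show ?thesis using that by (simp add: mi_deriv_one_minus)
    next
      case 3
      then have "\<alpha> - \<gamma> \<in> Delta k" using mi_size_diff[OF that(1)] a by (simp add: Delta_def)
      then show ?thesis using f(2) by (simp add: flat_def)
    qed
  qed
  have "mi_deriv \<alpha> (\<lambda>\<xi>. ?u \<xi> * f \<xi>) 0 = (\<Sum>\<gamma>\<in>{\<gamma>. \<gamma> \<le> \<alpha>}. ?t \<gamma>)"
    by (rule mi_deriv_mult[OF exp_sum_one_minus f(1)])
  also have "\<dots> = (\<Sum>\<gamma>\<in>{\<gamma>. \<gamma> \<le> \<alpha>}. if \<gamma> = axis j 1 then ?t (axis j 1) else 0)"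
    by (intro sum.cong refl) (use t0 in auto)
  also have "\<dots> = (if axis j 1 \<le> \<alpha> then ?t (axis j 1) else 0)"
    by (simp add: finite_mi_le)
  also have "axis j 1 \<le> \<alpha> \<longleftrightarrow> \<alpha> $ j > 0"
    by (auto simp: less_eq_vec_def axis_def)
  finally show ?thesis
    by (simp add: mi_deriv_one_minus mi_size_axis mi_binom_axis)
qed

text \<open>
  The lowest-order Taylor coefficients of the \<open>\<Pi>\<^sub>\<beta>\<close> of one size are independent: up to a nonzero
  factor, \<open>\<Pi>\<^sub>\<beta>\<close> starts with the monomial \<open>\<xi>\<^sup>\<beta>\<close>.  The induction splits off one factor \<open>1 - z\<^sub>j\<close>.
\<close>

lemma mi_deriv_Pi_mi:
  "\<exists>z. z \<noteq> 0 \<and> (\<forall>\<alpha>. mi_size \<alpha> = mi_size \<beta> \<longrightarrow> mi_deriv \<alpha> (Pi_mi \<beta>) 0 = (if \<alpha> = \<beta> then z else 0))"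
proof (induction "mi_size \<beta>" arbitrary: \<beta>)
  case 0
  then have "\<beta> = 0" by (auto simp: mi_size_def vec_eq_iff)
  moreover have "\<alpha> = 0" if "mi_size \<alpha> = 0" for \<alpha> :: "nat^'a"
    using that by (auto simp: mi_size_def vec_eq_iff)
  ultimately show ?case using 0 by (intro exI[of _ 1]) (auto simp: mi_deriv_0 Pi_mi_0 dest!: \<open>\<And>\<alpha>. mi_size \<alpha> = 0 \<Longrightarrow> \<alpha> = 0\<close>)
next
  case (Suc n)
  then obtain j \<beta>' where b: "\<beta> = \<beta>' + axis j 1" "mi_size \<beta>' = n" by (metis mi_size_SucE)
  obtain z where z: "z \<noteq> 0" "\<And>\<alpha>. mi_size \<alpha> = n \<Longrightarrow> mi_deriv \<alpha> (Pi_mi \<beta>') 0 = (if \<alpha> = \<beta>' then z else 0)"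
    using Suc.hyps(1)[of \<beta>'] b by auto
  have eq: "Pi_mi \<beta> = (\<lambda>\<xi>. (1 - expi (axis j 1) \<xi>) * Pi_mi \<beta>' \<xi>)"
    by (simp add: b Pi_mi_add_axis fun_eq_iff)
  have flat: "flat n (Pi_mi \<beta>')" using Pi_mi_flat[of \<beta>'] b by simp
  have "mi_deriv \<alpha> (Pi_mi \<beta>) 0 = (if \<alpha> = \<beta> then - 2 * of_real pi * \<i> * of_nat (\<beta> $ j) * z else 0)"
    if a: "mi_size \<alpha> = Suc n" for \<alpha>
  proof (cases "\<alpha> $ j = 0")
    case True
    then have "\<alpha> \<noteq> \<beta>" by (auto simp: b)
    with True show ?thesis
      by (simp add: eq mi_deriv_one_minus_mult[OF Pi_mi_exp_sum flat a])
  next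
    case False
    then have a2: "\<alpha> = (\<alpha> - axis j 1) + axis j 1" by (auto simp: vec_eq_iff axis_def)
    then have "mi_size (\<alpha> - axis j 1) = n"
      using a mi_size_add[of "\<alpha> - axis j 1" "axis j 1"] by (simp add: mi_size_axis)
    moreover have "\<alpha> - axis j 1 = \<beta>' \<longleftrightarrow> \<alpha> = \<beta>" using a2 b by auto
    ultimately show ?thesis
      by (simp add: eq mi_deriv_one_minus_mult[OF Pi_mi_exp_sum flat a] z)
  qed
  moreover have "\<beta> $ j \<noteq> 0" by (simp add: b)
  ultimately show ?case using z(1) Suc.hyps(2)
    by (intro exI[of _ "- 2 * of_real pi * \<i> * of_nat (\<beta> $ j) * z"]) auto
qed

lemma in_Pi_ideal_add: "in_Pi_ideal n f \<Longrightarrow> in_Pi_ideal n g \<Longrightarrow> in_Pi_ideal n (\<lambda>\<xi>. f \<xi> + g \<xi>)"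
  unfolding in_Pi_ideal_def
  by (elim exE conjE, rename_tac T U, rule_tac x="\<lambda>\<alpha> \<xi>. T \<alpha> \<xi> + U \<alpha> \<xi>" in exI)
     (auto simp: exp_sum_add sum.distrib ring_distribs)

lemma in_Pi_ideal_mult: "exp_sum (coset 0) u \<Longrightarrow> in_Pi_ideal n f \<Longrightarrow> in_Pi_ideal n (\<lambda>\<xi>. u \<xi> * f \<xi>)"
  unfolding in_Pi_ideal_def
  by (elim exE conjE, rename_tac T, rule_tac x="\<lambda>\<alpha> \<xi>. u \<xi> * T \<alpha> \<xi>" in exI)
     (auto simp: exp_sum_coset0_mult sum_distrib_left mult.assoc)

lemma in_Pi_ideal_zero: "in_Pi_ideal n (\<lambda>\<xi>. 0)"
  unfolding in_Pi_ideal_def by (rule exI[of _ "\<lambda>_ _. 0"]) (simp add: exp_sum_zero)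

lemma in_Pi_ideal_sum: "(\<And>i. i \<in> I \<Longrightarrow> in_Pi_ideal n (f i)) \<Longrightarrow> in_Pi_ideal n (\<lambda>\<xi>. \<Sum>i\<in>I. f i \<xi>)"
  by (induction I rule: infinite_finite_induct) (auto intro: in_Pi_ideal_zero in_Pi_ideal_add)

lemma in_Pi_ideal_Pi_mi: "in_Pi_ideal (mi_size \<alpha>) (Pi_mi \<alpha>)"
  unfolding in_Pi_ideal_def
  by (rule exI[of _ "\<lambda>\<beta> \<xi>. if \<beta> = \<alpha> then 1 else 0"])
     (auto simp: exp_sum_const if_distrib[of "\<lambda>x. x * _"] finite_mi_size cong: if_cong)

text \<open>
  The frequencies \<open>k\<close> for which \<open>z\<^sup>k - 1\<close> lies in the ideal form a subgroup, because
  \<open>z\<^sup>k\<^sup>+\<^sup>l - 1 = z\<^sup>k (z\<^sup>l - 1) + (z\<^sup>k - 1)\<close>; it contains the unit vectors.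
\<close>

lemma in_Pi_ideal_expi_minus_1: "in_Pi_ideal 1 (\<lambda>\<xi>. expi (of_int_vec k) \<xi> - 1)"
proof -
  let ?P = "\<lambda>k. in_Pi_ideal 1 (\<lambda>\<xi>. expi (of_int_vec k) \<xi> - 1)"
  have es: "exp_sum (coset 0) (expi (of_int_vec k))" for k :: "int^'a"
    by (rule exp_sum_expi) (auto simp: coset_def)
  have add: "?P (k + l)" if "?P k" "?P l" for k l :: "int^'a"
  proof -
    have "(\<lambda>\<xi>. expi (of_int_vec (k + l)) \<xi> - 1) = (\<lambda>\<xi>. expi (of_int_vec k) \<xi> *
        (expi (of_int_vec l) \<xi> - 1) + (expi (of_int_vec k) \<xi> - 1))"
      by (simp add: of_int_vec_add expi_add algebra_simps)
    with in_Pi_ideal_add[OF in_Pi_ideal_mult[OF es that(2)] that(1)] show ?thesis by simp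
  qed
  have neg: "?P (- k)" if "?P k" for k :: "int^'a"
    using in_Pi_ideal_mult[OF exp_sum_cmult[OF es, of "-1" "-k"] that]
    by (simp add: of_int_vec_minus right_diff_distrib)
  have zero: "?P 0" using in_Pi_ideal_zero by simp
  have ax: "?P (axis j 1)" for j :: 'a
  proof -
    have "Pi_mi (axis j 1) = (\<lambda>\<xi>. 1 - expi (axis j 1) \<xi>)"
      using Pi_mi_add_axis[of 0 j] by (simp add: Pi_mi_0 fun_eq_iff)
    then have "in_Pi_ideal 1 (\<lambda>\<xi>. 1 - expi (axis j 1) \<xi>)"
      using in_Pi_ideal_Pi_mi[of "axis j 1"] by (simp add: mi_size_axis)
    from in_Pi_ideal_mult[OF exp_sum_const[of "-1"] this] show ?thesis
      by (simp add: of_int_vec_axis)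
  qed
  have axn: "?P (int i *s axis j 1)" for i and j :: 'a
  proof (induction i)
    case (Suc i)
    have "int (Suc i) *s axis j 1 = int i *s axis j 1 + (axis j 1 :: int^'a)"
      by (simp add: vec_eq_iff algebra_simps)
    with add[OF Suc.IH ax[of j]] show ?case by (simp only:)
  qed (simp add: in_Pi_ideal_zero vector_smult_lzero)
  have axi: "?P (i *s axis j 1)" for i and j :: 'a
  proof (cases "i \<ge> 0")
    case True
    with axn[of "nat i" j] show ?thesis by simp
  next
    case False
    have "i *s axis j 1 = - (int (nat (- i)) *s (axis j 1 :: int^'a))"
      using False by (simp add: vec_eq_iff)
    with neg[OF axn[of "nat (-i)" j]] show ?thesis by simp
  qed
  have "?P (\<Sum>j\<in>F. k $ j *s axis j 1)" for F
    by (induction F rule: infinite_finite_induct) (auto simp: in_Pi_ideal_zero intro: add axi )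
  from this[of UNIV] show ?thesis by (simp add: basis_expansion)
qed

lemma in_Pi_ideal_1:
  assumes "exp_sum (coset 0) f" "f 0 = 0"
  shows "in_Pi_ideal 1 f"
proof -
  obtain X h where X: "finite X" "X \<subseteq> coset 0" "f = (\<lambda>\<xi>. \<Sum>a\<in>X. h a * expi a \<xi>)"
    using exp_sumE[OF assms(1)] .
  have "f \<xi> = (\<Sum>a\<in>X. h a * (expi a \<xi> - 1))" for \<xi>
    using assms(2) by (simp add: X algebra_simps sum_subtractf)
  moreover have "in_Pi_ideal 1 (\<lambda>\<xi>. \<Sum>a\<in>X. h a * (expi a \<xi> - 1))"
    using X(2) by (intro in_Pi_ideal_sum in_Pi_ideal_mult exp_sum_const)
      (auto simp: coset_def intro: in_Pi_ideal_expi_minus_1)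
  ultimately show ?thesis by presburger
qed

text \<open>
  A Laurent polynomial that vanishes to order \<open>n\<close> at \<open>(1, \<dots>, 1)\<close> lies in the \<open>n\<close>-th power of the
  maximal ideal.  In the induction step write \<open>f = \<Sum> T\<^sub>\<alpha> \<Pi>\<^sub>\<alpha>\<close> with \<open>[\<alpha>] = n\<close>; the derivatives of order
  \<open>n\<close> of \<open>f\<close> at \<open>0\<close> are the values \<open>T\<^sub>\<alpha>(0)\<close> up to nonzero factors, so these vanish and each \<open>T\<^sub>\<alpha>\<close>
  contributes one more factor \<open>1 - z\<^sub>j\<close>.
\<close>

lemma flat_imp_in_Pi_ideal:
  assumes "exp_sum (coset 0) f" "flat n f"
  shows "in_Pi_ideal n f"
  using assms
proof (induction n)
  case 0
  have "{\<alpha> :: nat^'a. mi_size \<alpha> = 0} = {0}" by (auto simp: mi_size_def vec_eq_iff)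
  with 0 show ?case unfolding in_Pi_ideal_def
    by (intro exI[of _ "\<lambda>_. f"]) (simp add: Pi_mi_0)
next
  case (Suc n)
  then have "flat n f" by (auto simp: flat_def Delta_def)
  with Suc obtain T where T: "\<And>\<alpha>. exp_sum (coset 0) (T \<alpha>)"
    and f: "f = (\<lambda>\<xi>. \<Sum>\<alpha>\<in>{\<alpha>. mi_size \<alpha> = n}. T \<alpha> \<xi> * Pi_mi \<alpha> \<xi>)"
    by (auto simp: in_Pi_ideal_def)
  have es: "exp_sum (coset 0) (\<lambda>\<xi>. T \<alpha> \<xi> * Pi_mi \<alpha> \<xi>)" for \<alpha>
    by (intro exp_sum_coset0_mult T Pi_mi_exp_sum)
  (* Differentiating f to order alpha isolates the value of T alpha at 0. *)
  have T0: "T \<alpha> 0 = 0" if a: "mi_size \<alpha> = n" for \<alpha>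
  proof -
    obtain z where z: "z \<noteq> 0" "\<And>\<beta>. mi_size \<beta> = n \<Longrightarrow> mi_deriv \<beta> (Pi_mi \<alpha>) 0 = (if \<beta> = \<alpha> then z else 0)"
      using mi_deriv_Pi_mi[of \<alpha>] a by auto
    have prod: "mi_deriv \<alpha> (\<lambda>\<xi>. T \<beta> \<xi> * Pi_mi \<beta> \<xi>) 0 = T \<beta> 0 * mi_deriv \<alpha> (Pi_mi \<beta>) 0"
      if b: "mi_size \<beta> = n" for \<beta>
    proof -
      (* T \<beta> may be replaced by its value at 0: the error is flat of order n + 1. *)
      have "flat (Suc n) (\<lambda>\<xi>. (T \<beta> \<xi> - T \<beta> 0) * Pi_mi \<beta> \<xi>)"
        using flat_mult[OF exp_sum_diff[OF T exp_sum_const] Pi_mi_exp_sum, of 1 \<beta> "T \<beta> 0" n \<beta>]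
          Pi_mi_flat[of \<beta>] b by (simp add: flat_1_iff plus_1_eq_Suc)
      then have "mi_deriv \<alpha> (\<lambda>\<xi>. (T \<beta> \<xi> - T \<beta> 0) * Pi_mi \<beta> \<xi>) 0 = 0"
        using a by (simp add: flat_def Delta_def)
      moreover have "(\<lambda>\<xi>. (T \<beta> \<xi> - T \<beta> 0) * Pi_mi \<beta> \<xi>) =
          (\<lambda>\<xi>. T \<beta> \<xi> * Pi_mi \<beta> \<xi> - T \<beta> 0 * Pi_mi \<beta> \<xi>)"
        by (simp add: algebra_simps)
      ultimately show ?thesis
        by (simp add: mi_deriv_diff[OF es exp_sum_cmult[OF Pi_mi_exp_sum]] mi_deriv_cmult[OF Pi_mi_exp_sum])
    qed
    have "0 = mi_deriv \<alpha> f 0" using Suc.prems(2) a by (simp add: flat_def Delta_def)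
    also have "\<dots> = (\<Sum>\<beta>\<in>{\<beta>. mi_size \<beta> = n}. T \<beta> 0 * mi_deriv \<alpha> (Pi_mi \<beta>) 0)"
      unfolding f by (subst mi_deriv_sum[OF es]) (simp add: prod)
    also have "\<dots> = (\<Sum>\<beta>\<in>{\<beta>. mi_size \<beta> = n}. if \<beta> = \<alpha> then T \<alpha> 0 * z else 0)"
    proof (intro sum.cong refl)
      fix \<beta> assume "\<beta> \<in> {\<beta> :: nat^'a. mi_size \<beta> = n}"
      then show "T \<beta> 0 * mi_deriv \<alpha> (Pi_mi \<beta>) 0 = (if \<beta> = \<alpha> then T \<alpha> 0 * z else 0)"
        using mi_deriv_Pi_mi[of \<beta>] z a by auto
    qed
    also have "\<dots> = T \<alpha> 0 * z" using a by (simp add: finite_mi_size)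
    finally show ?thesis using z by simp
  qed
  have "in_Pi_ideal (Suc n) (\<lambda>\<xi>. T \<alpha> \<xi> * Pi_mi \<alpha> \<xi>)" if a: "mi_size \<alpha> = n" for \<alpha>
  proof -
    obtain U where U: "\<And>\<beta>. exp_sum (coset 0) (U \<beta>)"
      "T \<alpha> = (\<lambda>\<xi>. \<Sum>\<beta>\<in>{\<beta>. mi_size \<beta> = 1}. U \<beta> \<xi> * Pi_mi \<beta> \<xi>)"
      using in_Pi_ideal_1[OF T T0[OF a]] unfolding in_Pi_ideal_def by auto
    have "in_Pi_ideal (Suc n) (\<lambda>\<xi>. Pi_mi \<beta> \<xi> * Pi_mi \<alpha> \<xi>)" if b: "mi_size \<beta> = 1" for \<beta>
    proof -
      have "Pi_mi (\<beta> + \<alpha>) = (\<lambda>\<xi>. Pi_mi \<beta> \<xi> * Pi_mi \<alpha> \<xi>)"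
        by (simp add: Pi_mi_def power_add prod.distrib fun_eq_iff)
      with in_Pi_ideal_Pi_mi[of "\<beta> + \<alpha>"] show ?thesis
        using a b by (simp add: mi_size_add plus_1_eq_Suc)
    qed
    then have "in_Pi_ideal (Suc n) (\<lambda>\<xi>. \<Sum>\<beta>\<in>{\<beta>. mi_size \<beta> = 1}. U \<beta> \<xi> * (Pi_mi \<beta> \<xi> * Pi_mi \<alpha> \<xi>))"
      by (intro in_Pi_ideal_sum in_Pi_ideal_mult[OF U(1)]) auto
    then show ?thesis by (simp add: U(2) sum_distrib_right mult.assoc)
  qed
  then show ?case unfolding f by (intro in_Pi_ideal_sum) auto
qed

section \<open>Dilations, digits and characters of the quotient group\<close>

lemma of_int_mat_transpose: "of_int_mat (transpose M) = transpose (of_int_mat M)"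
  by (simp add: of_int_mat_def transpose_def vec_eq_iff)

lemma of_int_vec_mult: "of_int_mat M *v of_int_vec l = (of_int_vec (M *v l) :: real^'d)"
  by (simp add: of_int_mat_def of_int_vec_def matrix_vector_mult_def vec_eq_iff)

text \<open>
  A real kernel vector would be a complex eigenvector for the eigenvalue \<open>0\<close>.
\<close>

lemma matrix_dilation_invertible:
  fixes M :: "int^'d^'d"
  assumes "matrix_dilation M"
  shows "invertible (of_int_mat M :: real^'d^'d)"
proof -
  have "x = 0" if "(of_int_mat M :: real^'d^'d) *v x = 0" for x
  proof (rule ccontr)
    assume "x \<noteq> 0"
    define v :: "complex^'d" where "v = (\<chi> j. of_real (x $ j))"
    have "v \<noteq> 0" using \<open>x \<noteq> 0\<close> by (auto simp: v_def vec_eq_iff)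
    moreover have "of_int_mat M *v v = 0"
    proof (simp add: vec_eq_iff, rule allI)
      fix i
      have "(of_int_mat M *v v) $ i = of_real ((of_int_mat M *v x) $ i)"
        by (simp add: v_def of_int_mat_def matrix_vector_mult_def)
      then show "(of_int_mat M *v v) $ i = 0" using that by simp
    qed
    ultimately have "is_eigenvalue (of_int_mat M) 0"
      unfolding is_eigenvalue_def by (intro exI[of _ v]) simp
    then show False using assms by (auto simp: matrix_dilation_def)
  qed
  then show ?thesis
    using matrix_left_invertible_ker[of "of_int_mat M :: real^'d^'d"]
    by (auto simp: invertible_left_inverse)
qed

lemma inv_act_add: "inv_act M (x + y) = inv_act M x + inv_act M y"
  and inv_act_diff: "inv_act M (x - y) = inv_act M x - inv_act M y"
  unfolding inv_act_def
  using matrix_vector_mul_linear[of "matrix_inv (of_int_mat M)"]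
  by (auto simp: linear_add linear_diff)

lemma inv_star_act_eq: "inv_star_act M = inv_act (transpose M)"
  by (simp add: inv_star_act_def[abs_def] inv_act_def[abs_def] of_int_mat_transpose fun_eq_iff)

lemma invertible_transpose: "invertible (of_int_mat M :: real^'d^'d) \<Longrightarrow> invertible (of_int_mat (transpose M) :: real^'d^'d)"
  by (simp add: of_int_mat_transpose invertible_det_nz det_transpose)

lemma matrix_inv_mult:
  assumes "invertible A"
  shows "A ** matrix_inv A = mat 1" "matrix_inv A ** A = mat 1"
  using someI_ex[OF assms[unfolded invertible_def]] by (simp_all add: matrix_inv_def)

lemma act_inv_act: "invertible (of_int_mat M :: real^'d^'d) \<Longrightarrow> of_int_mat M *v inv_act M x = (x :: real^'d)"
  by (simp add: inv_act_def matrix_vector_mul_assoc matrix_inv_mult)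

lemma inv_act_act: "invertible (of_int_mat M :: real^'d^'d) \<Longrightarrow> inv_act M (of_int_mat M *v x) = (x :: real^'d)"
  by (simp add: inv_act_def matrix_vector_mul_assoc matrix_inv_mult)

lemma star_act_inv_star_act:
  "invertible (of_int_mat M :: real^'d^'d) \<Longrightarrow> star_act M (inv_star_act M x) = (x :: real^'d)"
  using act_inv_act[OF invertible_transpose, of M x]
  by (simp add: star_act_def inv_star_act_eq of_int_mat_transpose)

lemma inner_star_act: "a \<bullet> star_act M x = (of_int_mat M *v a) \<bullet> x"
  by (metis star_act_def dot_lmul_matrix transpose_matrix_vector transpose_transpose)

lemma expi_inv_act_star_act:
  "invertible (of_int_mat M :: real^'d^'d) \<Longrightarrow> expi (inv_act M a) (star_act M \<xi>) = expi a (\<xi> :: real^'d)"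
  by (simp add: expi_def inner_star_act act_inv_act)

lemma expi_commute: "expi a b = expi b a"
  by (simp add: expi_def inner_commute)

text \<open>
  The pairing \<open>(k, s) \<mapsto> expi (M\<^sup>-\<^sup>1k) s\<close> identifies \<open>\<int>\<^sup>d/M\<^sup>*\<int>\<^sup>d\<close> with the characters of
  \<open>\<int>\<^sup>d/M\<int>\<^sup>d\<close>; this symmetry lets the digits of \<open>M\<close> and of \<open>M\<^sup>*\<close> exchange roles.
\<close>

lemma expi_inv_act_commute:
  assumes "invertible (of_int_mat M :: real^'d^'d)"
  shows "expi (inv_act M a) b = expi (inv_act (transpose M) b) (a :: real^'d)"
  using expi_inv_act_star_act[OF assms, of a "inv_star_act M b"]
  by (simp only: star_act_inv_star_act[OF assms]) (simp add: expi_commute[of a] inv_star_act_eq)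

lemma inv_act_integer_iff:
  assumes "invertible (of_int_mat M :: real^'d^'d)"
  shows "inv_act M (of_int_vec k :: real^'d) \<in> range of_int_vec \<longleftrightarrow> (\<exists>l. k = M *v l)"
proof
  assume "inv_act M (of_int_vec k :: real^'d) \<in> range of_int_vec"
  then obtain l where "inv_act M (of_int_vec k :: real^'d) = of_int_vec l" by auto
  then have "(of_int_vec k :: real^'d) = of_int_vec (M *v l)"
    using act_inv_act[OF assms, of "of_int_vec k"] by (simp add: of_int_vec_mult)
  then have "k = M *v l" by (simp add: of_int_vec_def vec_eq_iff)
  then show "\<exists>l. k = M *v l" ..
next
  assume "\<exists>l. k = M *v l"
  then show "inv_act M (of_int_vec k :: real^'d) \<in> range of_int_vec"
    using inv_act_act[OF assms] by (auto simp: of_int_vec_mult[symmetric])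
qed

lemma expi_integer: "expi (of_int_vec k) (of_int_vec l) = 1"
proof -
  have "(of_int_vec k :: real^'a) \<bullet> of_int_vec l = of_int (\<Sum>j\<in>UNIV. k $ j * l $ j)"
    by (simp add: of_int_vec_def inner_vec_def)
  then show ?thesis
    unfolding expi_def exp_eq_1
    by (simp del: of_int_sum)
qed

lemma expi_nontrivial:
  assumes "x \<notin> range of_int_vec"
  obtains e where "expi x (of_int_vec e) \<noteq> 1"
proof -
  obtain j where j: "x $ j \<notin> \<int>"
  proof (rule ccontr)
    assume "\<not> thesis"
    with that have "\<forall>j. x $ j \<in> \<int>" by blast
    then have "x = of_int_vec (\<chi> j. \<lfloor>x $ j\<rfloor>)" by (simp add: of_int_vec_def vec_eq_iff)
    with assms show False by blast
  qed
  have "expi x (of_int_vec (axis j 1)) \<noteq> 1"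
  proof
    assume "expi x (of_int_vec (axis j 1)) = 1"
    then obtain n :: int where "2 * pi * x $ j = of_int (2 * n) * pi"
      unfolding expi_def exp_eq_1 by (auto simp: of_int_vec_axis inner_axis)
    then have "x $ j = of_int n" by simp
    with j show False by simp
  qed
  then show ?thesis by (rule that)
qed

lemma digit_setE:
  assumes "digit_set M D"
  obtains s where "s \<in> D" "\<exists>l. k - s = M *v l"
  using assms unfolding digit_set_def by blast

lemma digit_set_unique:
  assumes "digit_set M D" "s \<in> D" "t \<in> D" "\<exists>l. s - t = M *v l"
  shows "s = t"
proof -
  have "\<exists>l. s - s = M *v l" by (rule exI[of _ 0]) simp
  then show ?thesis using assms unfolding digit_set_def by blast
qed

lemma lattice_diff: "\<exists>l. a = M *v l \<Longrightarrow> \<exists>l. b = M *v l \<Longrightarrow> \<exists>l. a - b = M *v (l :: int^'d)"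
  by (metis matrix_vector_mult_diff_distrib)

text \<open>
  Orthogonality of characters.  A translation by \<open>e\<close> permutes the digits modulo the lattice and
  multiplies the sum by the value of the character at \<open>e\<close>; a nontrivial character has an \<open>e\<close> for
  which this value is not \<open>1\<close>.
\<close>

lemma char_sum:
  fixes M :: "int^'d^'d"
  assumes inv: "invertible (of_int_mat M :: real^'d^'d)" and D: "digit_set M D" "finite D"
  shows "(\<Sum>k\<in>D. expi (inv_act M (of_int_vec k)) (of_int_vec s)) =
    (if inv_act (transpose M) (of_int_vec s :: real^'d) \<in> range of_int_vec then of_nat (card D) else 0)"
proof (cases "inv_act (transpose M) (of_int_vec s :: real^'d) \<in> range of_int_vec")
  case True
  then have "expi (inv_act M (of_int_vec k)) (of_int_vec s) = 1" for k
    by (auto simp: expi_inv_act_commute[OF inv] expi_integer)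
  with True show ?thesis by simp
next
  case False
  then obtain e where e: "expi (inv_act (transpose M) (of_int_vec s)) (of_int_vec e) \<noteq> 1"
    by (rule expi_nontrivial)
  define ch where "ch k = expi (inv_act M (of_int_vec k)) (of_int_vec s :: real^'d)" for k
  have ch_e: "ch e \<noteq> 1" using e by (simp add: ch_def expi_inv_act_commute[OF inv])
  have ch_add: "ch (k + l) = ch k * ch l" for k l
    by (simp add: ch_def of_int_vec_add inv_act_add expi_add)
  have ch_M: "ch (M *v l) = 1" for l
    by (simp add: ch_def of_int_vec_mult[symmetric] inv_act_act[OF inv] expi_integer)
  define p where "p k = (SOME t. t \<in> D \<and> (\<exists>l. (k + e) - t = M *v l))" for k
  have p: "p k \<in> D \<and> (\<exists>l. (k + e) - p k = M *v l)" for k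
  proof -
    have "\<exists>t. t \<in> D \<and> (\<exists>l. (k + e) - t = M *v l)"
      by (rule digit_setE[OF D(1), of "k + e"]) blast
    then show ?thesis unfolding p_def by (rule someI_ex)
  qed
  have "inj_on p D"
  proof (rule inj_onI)
    fix k k' assume k: "k \<in> D" "k' \<in> D" "p k = p k'"
    have "\<exists>l. (k + e - p k) - (k' + e - p k') = M *v l"
      using p[of k] p[of k'] by (blast intro: lattice_diff)
    then have "\<exists>l. k - k' = M *v l" using k(3) by (simp add: algebra_simps)
    with k show "k = k'" using digit_set_unique[OF D(1)] by blast
  qed
  moreover from this have "p ` D = D" using p by (intro endo_inj_surj[OF D(2)]) auto
  ultimately have bij: "bij_betw p D D" by (simp add: bij_betw_def)
  have ch_p: "ch (p k) = ch k * ch e" for k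
  proof -
    obtain l where "(k + e) - p k = M *v l" using p[of k] by auto
    then have "k + e = p k + M *v l" by (simp add: algebra_simps)
    then show ?thesis by (metis ch_add ch_M mult.right_neutral)
  qed
  have "(\<Sum>k\<in>D. ch k) = (\<Sum>k\<in>D. ch (p k))"
    using sum.reindex_bij_betw[OF bij, of ch] by simp
  also have "\<dots> = (\<Sum>k\<in>D. ch k) * ch e" by (simp add: ch_p sum_distrib_right)
  finally have "(\<Sum>k\<in>D. ch k) = 0" using ch_e by simp
  with False show ?thesis by (simp add: ch_def)
qed

lemma det_of_int_mat: "det (of_int_mat A :: real^'d^'d) = of_int (det A)"
  by (simp add: det_def of_int_mat_def)

text \<open>
  By Cramer's rule \<open>det M\<close> times \<open>M\<^sup>-\<^sup>1k\<close> is an integer vector.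
\<close>

lemma det_mult_in_lattice:
  assumes inv: "invertible (of_int_mat M :: real^'d^'d)"
  shows "\<exists>l. det M *s k = M *v (l :: int^'d)"
proof -
  let ?A = "of_int_mat M :: real^'d^'d"
  have nz: "det ?A \<noteq> 0" using inv by (simp add: invertible_det_nz)
  define l where "l = (\<chi> j. det (\<chi> i h. if h = j then k $ i else M $ i $ h))"
  have "?A *v inv_act M (of_int_vec k) = of_int_vec k" by (rule act_inv_act[OF inv])
  then have "inv_act M (of_int_vec k) =
    (\<chi> j. det (\<chi> i h. if h = j then of_int_vec k $ i else ?A $ i $ h) / det ?A)"
    by (subst (asm) cramer[OF nz])
  moreover have "(\<chi> i h. if h = j then of_int_vec k $ i else ?A $ i $ h) =
     (of_int_mat (\<chi> i h. if h = j then k $ i else M $ i $ h) :: real^'d^'d)" for j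
    by (simp add: of_int_mat_def of_int_vec_def vec_eq_iff)
  ultimately have "inv_act M (of_int_vec k) = (1 / det ?A) *\<^sub>R (of_int_vec l :: real^'d)"
    by (simp add: l_def of_int_vec_def det_of_int_mat vec_eq_iff)
  then have "of_int_vec l = det ?A *\<^sub>R inv_act M (of_int_vec k)" using nz by simp
  then have "?A *v of_int_vec l = det ?A *\<^sub>R of_int_vec k"
    by (simp add: matrix_vector_mult_scaleR act_inv_act[OF inv])
  then have "(of_int_vec (M *v l) :: real^'d) = of_int_vec (det M *s k)"
    by (simp add: of_int_vec_mult det_of_int_mat) (simp add: of_int_vec_def vec_eq_iff)
  then have "M *v l = det M *s k" by (simp add: of_int_vec_def vec_eq_iff flip: of_int_mult)
  then have "det M *s k = M *v l" ..
  then show ?thesis ..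
qed

text \<open>
  Digits that agree modulo \<open>det M\<close> are congruent modulo \<open>M\<int>\<^sup>d\<close>, hence equal.
\<close>

lemma finite_digit_set:
  assumes inv: "invertible (of_int_mat M :: real^'d^'d)" and D: "digit_set M (D :: (int^'d) set)"
  shows "finite D"
proof -
  let ?N = "\<bar>det M\<bar>"
  have N: "?N > 0" using inv by (simp add: invertible_det_nz det_of_int_mat)
  let ?r = "\<lambda>k :: int^'d. \<lambda>j. k $ j mod ?N"
  have "inj_on ?r D"
  proof (rule inj_onI)
    fix k k' assume k: "k \<in> D" "k' \<in> D" "?r k = ?r k'"
    have "det M dvd (k - k') $ j" for j
      using k(3) by (simp add: fun_eq_iff mod_eq_dvd_iff)
    then have "k - k' = det M *s (\<chi> j. (k - k') $ j div det M)" by (simp add: vec_eq_iff)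
    then have "\<exists>l. k - k' = M *v l" by (metis det_mult_in_lattice[OF inv])
    then show "k = k'" using digit_set_unique[OF D] k by blast
  qed
  moreover have "?r ` D \<subseteq> Pi\<^sub>E UNIV (\<lambda>_. {0..<?N})" using N by auto
  then have "finite (?r ` D)" by (rule finite_subset) (intro finite_PiE, auto)
  ultimately show ?thesis by (rule finite_imageD[rotated])
qed

section \<open>Polyphase decomposition\<close>

text \<open>
  A function whose frequencies lie in one coset is an eigenfunction of the integer translations.
  This is what separates the polyphase components from one another.
\<close>

lemma exp_sum_coset_shift:
  assumes "exp_sum (coset a) f"
  shows "f (\<xi> + of_int_vec s) = expi a (of_int_vec s) * f \<xi>"
proof -
  obtain X h where X: "finite X" "X \<subseteq> coset a" "f = (\<lambda>\<xi>. \<Sum>b\<in>X. h b * expi b \<xi>)"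
    using exp_sumE[OF assms] .
  have "expi b (of_int_vec s) = expi a (of_int_vec s)" if "b \<in> X" for b
    using X(2) that by (auto simp: coset_def expi_add expi_integer)
  then show ?thesis unfolding X(3) sum_distrib_left
    by (intro sum.cong refl) (simp add: expi_add_right)
qed

text \<open>
  Group the frequencies of \<open>t\<close> by their residue modulo \<open>M\<int>\<^sup>d\<close>.  The factor \<open>expi b\<close> recentres
  the components; with \<open>b = M\<^sup>-\<^sup>1c\<close> the symmetry about \<open>c\<close> becomes a symmetry about \<open>0\<close>.
\<close>

lemma polyphase_exists:
  fixes M :: "int^'d^'d"
  assumes inv: "invertible (of_int_mat M :: real^'d^'d)"
    and K: "finite K" "inj_on s K" "digit_set M (s ` K)"
    and t: "exp_sum (coset 0) t"
  shows "\<exists>H. (\<forall>k\<in>K. exp_sum (coset (inv_act M (of_int_vec (s k)) - b)) (H k)) \<and>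
    (\<forall>\<xi>. t \<xi> = expi b (star_act M \<xi>) * (\<Sum>k\<in>K. H k (star_act M \<xi>)))"
proof -
  obtain X h where X: "finite X" "X \<subseteq> coset 0" "t = (\<lambda>\<xi>. \<Sum>a\<in>X. h a * expi a \<xi>)"
    using exp_sumE[OF t] .
  let ?R = "\<lambda>k a. inv_act M (a - of_int_vec (s k)) \<in> range of_int_vec"
  define H where "H k = (\<lambda>\<eta>. \<Sum>a | a \<in> X \<and> ?R k a. h a * expi (inv_act M a - b) \<eta>)" for k
  have one: "\<exists>!k. k \<in> K \<and> ?R k a" if "a \<in> X" for a
  proof -
    have "a \<in> coset 0" using X(2) that by blast
    then obtain v where v: "a = of_int_vec v" by (auto simp: coset_def)
    have R: "?R k a \<longleftrightarrow> (\<exists>l. v - s k = M *v l)" for k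
      by (simp add: v inv_act_integer_iff[OF inv] flip: of_int_vec_diff)
    show ?thesis unfolding R using K(2,3) unfolding digit_set_def inj_on_def by (metis (no_types, lifting) image_iff)
  qed
  (* The frequencies of H k differ from that of the digit by integer vectors. *)
  have "exp_sum (coset (inv_act M (of_int_vec (s k)) - b)) (H k)" for k
    unfolding H_def
  proof (rule exp_sum_finite_index)
    fix a assume "a \<in> {a \<in> X. ?R k a}"
    then have "(inv_act M a - b) - (inv_act M (of_int_vec (s k)) - b) \<in> range of_int_vec"
      by (simp add: inv_act_diff)
    from coset_eqI[OF this] show "inv_act M a - b \<in> coset (inv_act M (of_int_vec (s k)) - b)"
      using coset_self[of "inv_act M a - b"] by simp
  qed (use X in auto)
  moreover have "t \<xi> = expi b (star_act M \<xi>) * (\<Sum>k\<in>K. H k (star_act M \<xi>))" for \<xi>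
  proof -
    have "(\<Sum>k\<in>K. H k (star_act M \<xi>)) =
        (\<Sum>a\<in>X. \<Sum>k | k \<in> K \<and> ?R k a. h a * expi (inv_act M a - b) (star_act M \<xi>))"
      unfolding H_def by (rule sum.swap_restrict[OF K(1) X(1)])
    also have "\<dots> = (\<Sum>a\<in>X. h a * expi (inv_act M a - b) (star_act M \<xi>))"
    proof (intro sum.cong refl)
      fix a assume "a \<in> X"
      from one[OF this] obtain k where "{k. k \<in> K \<and> ?R k a} = {k}" by blast
      then show "(\<Sum>k | k \<in> K \<and> ?R k a. h a * expi (inv_act M a - b) (star_act M \<xi>)) =
         h a * expi (inv_act M a - b) (star_act M \<xi>)" by simp
    qed
    also have "expi b (star_act M \<xi>) * \<dots> = t \<xi>"
      unfolding X(3) sum_distrib_left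
    proof (intro sum.cong refl)
      fix a
      have "expi b (star_act M \<xi>) * expi (inv_act M a - b) (star_act M \<xi>) = expi a \<xi>"
        using expi_add[of b "inv_act M a - b" "star_act M \<xi>"] by (simp add: expi_inv_act_star_act[OF inv])
      then show "expi b (star_act M \<xi>) * (h a * expi (inv_act M a - b) (star_act M \<xi>)) = h a * expi a \<xi>"
        by (simp add: mult.left_commute)
    qed
    finally show ?thesis by simp
  qed
  ultimately show ?thesis by blast
qed

text \<open>
  Fourier inversion on the quotient group: an integer translation multiplies the component of
  \<open>s k\<close> by a character, so averaging the translates of the sum over the digits of \<open>M\<^sup>*\<close> against
  the conjugate character of \<open>s l\<close> leaves only the component of \<open>s l\<close>.
\<close>

lemma polyphase_inversion:
  fixes M :: "int^'d^'d"
  assumes inv: "invertible (of_int_mat M :: real^'d^'d)"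
    and K: "finite K" "inj_on s K" "digit_set M (s ` K)"
    and E: "digit_set (transpose M) E"
    and H: "\<And>k. k \<in> K \<Longrightarrow> exp_sum (coset (inv_act M (of_int_vec (s k)) - b)) (H k)"
    and l: "l \<in> K"
  shows "of_nat (card E) * H l \<eta> =
    (\<Sum>e\<in>E. expi (b - inv_act M (of_int_vec (s l))) (of_int_vec e) * (\<Sum>k\<in>K. H k (\<eta> + of_int_vec e)))"
proof -
  note inv' = invertible_transpose[OF inv]
  have fin: "finite E" by (rule finite_digit_set[OF inv' E])
  have ch: "(\<Sum>e\<in>E. expi (inv_act M (of_int_vec (s k - s l))) (of_int_vec e :: real^'d)) =
      (if k = l then of_nat (card E) else 0)" if k: "k \<in> K" for k
  proof -
    have "(\<exists>u. s k - s l = M *v u) \<longleftrightarrow> k = l"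
      using digit_set_unique[OF K(3), of "s k" "s l"] k l inj_onD[OF K(2), of k l]
      by (auto intro: exI[of _ 0])
    with char_sum[OF inv' E fin, of "s k - s l"] show ?thesis
      by (simp add: inv_act_integer_iff[OF inv] expi_inv_act_commute[OF inv] transpose_transpose)
  qed
  have "(\<Sum>e\<in>E. expi (b - inv_act M (of_int_vec (s l))) (of_int_vec e) * (\<Sum>k\<in>K. H k (\<eta> + of_int_vec e))) =
     (\<Sum>e\<in>E. \<Sum>k\<in>K. expi (inv_act M (of_int_vec (s k - s l))) (of_int_vec e) * H k \<eta>)"
    unfolding sum_distrib_left
  proof (intro sum.cong refl)
    fix e k assume k: "k \<in> K"
    have "(b - inv_act M (of_int_vec (s l))) + (inv_act M (of_int_vec (s k)) - b) =
      inv_act M (of_int_vec (s k - s l))" by (simp add: of_int_vec_diff inv_act_diff)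
    then show "expi (b - inv_act M (of_int_vec (s l))) (of_int_vec e) * H k (\<eta> + of_int_vec e) =
       expi (inv_act M (of_int_vec (s k - s l))) (of_int_vec e) * H k \<eta>"
      by (simp add: exp_sum_coset_shift[OF H[OF k]] flip: mult.assoc expi_add)
  qed
  also have "\<dots> = (\<Sum>k\<in>K. (\<Sum>e\<in>E. expi (inv_act M (of_int_vec (s k - s l))) (of_int_vec e)) * H k \<eta>)"
    by (subst sum.swap) (simp add: sum_distrib_right)
  also have "\<dots> = (\<Sum>k\<in>K. if k = l then of_nat (card E) * H l \<eta> else 0)"
    by (intro sum.cong refl) (auto simp: ch)
  also have "\<dots> = of_nat (card E) * H l \<eta>" using K(1) l by simp
  finally show ?thesis by simp
qed

lemma polyphase_unique:
  fixes M :: "int^'d^'d"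
  assumes inv: "invertible (of_int_mat M :: real^'d^'d)"
    and K: "finite K" "inj_on s K" "digit_set M (s ` K)"
    and E: "digit_set (transpose M) E"
    and H: "\<And>k. k \<in> K \<Longrightarrow> exp_sum (coset (inv_act M (of_int_vec (s k)) - b)) (H k)"
    and H': "\<And>k. k \<in> K \<Longrightarrow> exp_sum (coset (inv_act M (of_int_vec (s k)) - b)) (H' k)"
    and eq: "\<And>\<eta>. (\<Sum>k\<in>K. H k \<eta>) = (\<Sum>k\<in>K. H' k \<eta>)"
    and l: "l \<in> K"
  shows "H l = H' l"
proof
  fix \<eta>
  have "finite E" by (rule finite_digit_set[OF invertible_transpose[OF inv] E])
  moreover have "E \<noteq> {}" using digit_setE[OF E] by blast
  ultimately have "card E \<noteq> 0" by simp
  moreover have "(of_nat (card E) :: complex) * H l \<eta> = of_nat (card E) * H' l \<eta>"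
    using polyphase_inversion[OF inv K E H l, of \<eta>] polyphase_inversion[OF inv K E H' l, of \<eta>]
    by (simp only: eq)
  ultimately show "H l \<eta> = H' l \<eta>" by simp
qed

lemma flat_expi_mult_iff:
  assumes f: "exp_sum S f" and "z \<noteq> 0"
  shows "flat n (\<lambda>\<eta>. z * expi b \<eta> * f \<eta>) \<longleftrightarrow> flat n f"
proof
  have ez: "exp_sum UNIV (\<lambda>\<eta>. z * expi b \<eta>)" by (intro exp_sum_cmult exp_sum_expi) simp
  show "flat n (\<lambda>\<eta>. z * expi b \<eta> * f \<eta>)" if "flat n f"
    by (rule flat_mult_right[OF ez f that])
  have ez': "exp_sum UNIV (\<lambda>\<eta>. (1 / z) * expi (- b) \<eta>)" by (intro exp_sum_cmult exp_sum_expi) simp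
  have ez'': "exp_sum UNIV (\<lambda>\<eta>. z * expi b \<eta> * f \<eta>)" by (rule exp_sum_mult[OF ez f]) simp
  assume "flat n (\<lambda>\<eta>. z * expi b \<eta> * f \<eta>)"
  from flat_mult_right[OF ez' ez'' this]
  have "flat n (\<lambda>\<eta>. (expi (- b) \<eta> * expi b \<eta>) * f \<eta>)" using \<open>z \<noteq> 0\<close> by (simp add: mult_ac)
  then show "flat n f" by simp
qed

text \<open>
  The sum rule says that the translates of \<open>\<Sum> H\<^sub>k\<close> by the nonzero digits of \<open>M\<^sup>*\<close> are flat.  These
  translates are the nontrivial Fourier coefficients of the family \<open>(H\<^sub>k)\<close> with respect to \<open>k\<close>, so
  they are flat exactly when the family is constant up to flat functions.
\<close>

lemma sum_rule_iff:
  fixes M :: "int^'d^'d"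
  assumes inv: "invertible (of_int_mat M :: real^'d^'d)"
    and K: "finite K" "inj_on s K" "digit_set M (s ` K)"
    and E: "digit_set (transpose M) E" "0 \<in> E"
    and H: "\<And>k. k \<in> K \<Longrightarrow> exp_sum (coset (inv_act M (of_int_vec (s k)) - b)) (H k)"
    and t: "\<And>\<xi>. t \<xi> = expi b (star_act M \<xi>) * (\<Sum>k\<in>K. H k (star_act M \<xi>))"
  shows "sum_rule M E n t \<longleftrightarrow> (\<forall>k\<in>K. \<forall>l\<in>K. flat n (\<lambda>\<eta>. H k \<eta> - H l \<eta>))"
proof -
  note inv' = invertible_transpose[OF inv]
  have fin: "finite E" by (rule finite_digit_set[OF inv' E(1)])
  define g where "g = (\<lambda>\<eta>. \<Sum>k\<in>K. H k \<eta>)"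
  define a where "a k = inv_act M (of_int_vec (s k)) - b" for k
  have HU: "exp_sum UNIV (H k)" if "k \<in> K" for k using H[OF that] by (rule exp_sum_UNIV)
  have gU: "exp_sum UNIV g" unfolding g_def by (intro exp_sum_sum HU)
  have g_shift: "g (\<eta> + of_int_vec e) = (\<Sum>k\<in>K. expi (a k) (of_int_vec e) * H k \<eta>)" for e \<eta>
    unfolding g_def a_def by (intro sum.cong refl exp_sum_coset_shift H)
  have u: "(\<lambda>\<xi>. t (inv_star_act M \<xi>)) = (\<lambda>\<xi>. expi b \<xi> * g \<xi>)"
    by (simp add: t g_def star_act_inv_star_act[OF inv])
  have uU: "exp_sum UNIV (\<lambda>\<xi>. expi b \<xi> * g \<xi>)"
    by (rule exp_sum_mult[OF exp_sum_expi[of b UNIV] gU]) auto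
  have rule: "sum_rule M E n t \<longleftrightarrow> (\<forall>e\<in>E - {0}. flat n (\<lambda>\<eta>. g (\<eta> + of_int_vec e)))"
    unfolding sum_rule_def u
  proof (intro ball_cong refl)
    fix e
    have nz: "expi b (of_int_vec e) \<noteq> 0" by (simp add: expi_def)
    have "(\<forall>\<beta>\<in>Delta n. mi_deriv \<beta> (\<lambda>\<xi>. expi b \<xi> * g \<xi>) (of_int_vec e) = 0) \<longleftrightarrow>
       flat n (\<lambda>\<eta>. expi b (\<eta> + of_int_vec e) * g (\<eta> + of_int_vec e))"
      unfolding flat_def by (simp add: mi_deriv_translate[OF uU])
    also have "\<dots> \<longleftrightarrow> flat n (\<lambda>\<eta>. expi b (of_int_vec e) * expi b \<eta> * g (\<eta> + of_int_vec e))"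
      by (simp add: expi_add_right mult_ac)
    also have "\<dots> \<longleftrightarrow> flat n (\<lambda>\<eta>. g (\<eta> + of_int_vec e))"
      by (rule flat_expi_mult_iff[OF exp_sum_translate[OF gU] nz])
    finally show "(\<forall>\<beta>\<in>Delta n. mi_deriv \<beta> (\<lambda>\<xi>. expi b \<xi> * g \<xi>) (of_int_vec e) = 0) \<longleftrightarrow>
       flat n (\<lambda>\<eta>. g (\<eta> + of_int_vec e))" .
  qed
  show ?thesis unfolding rule
  proof (intro iffI ballI)
    fix k l assume fl: "\<forall>e\<in>E - {0}. flat n (\<lambda>\<eta>. g (\<eta> + of_int_vec e))" and k: "k \<in> K" and l: "l \<in> K"
    have card: "card E \<noteq> 0" using fin E(2) by auto
    have in_k: "of_nat (card E) * H j \<eta> = (\<Sum>e\<in>E. expi (- a j) (of_int_vec e) * g (\<eta> + of_int_vec e))"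
      if "j \<in> K" for j \<eta>
      using polyphase_inversion[OF inv K E(1) H that, of \<eta>] by (simp add: a_def g_def)
    (* Write the difference of two components by Fourier inversion.  The translate by e = 0 is the
       only one about which the sum rule says nothing, and its coefficient is zero. *)
    let ?d = "\<lambda>e. expi (- a k) (of_int_vec e) - expi (- a l) (of_int_vec e)"
    have "of_nat (card E) * (H k \<eta> - H l \<eta>) = (\<Sum>e\<in>E. ?d e * g (\<eta> + of_int_vec e))" for \<eta>
      by (simp add: right_diff_distrib left_diff_distrib in_k k l sum_subtractf)
    then have "(\<lambda>\<eta>. H k \<eta> - H l \<eta>) =
        (\<lambda>\<eta>. 1 / of_nat (card E) * (\<Sum>e\<in>E. ?d e * g (\<eta> + of_int_vec e)))"
      using card by (simp add: fun_eq_iff field_simps)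
    moreover have es: "exp_sum UNIV (\<lambda>\<eta>. ?d e * g (\<eta> + of_int_vec e))" for e
      by (intro exp_sum_cmult exp_sum_translate gU)
    have fe: "flat n (\<lambda>\<eta>. ?d e * g (\<eta> + of_int_vec e))" if "e \<in> E" for e
    proof (cases "e = 0")
      case True
      then show ?thesis by (simp add: flat_def mi_deriv_zero)
    next
      case False
      with that fl show ?thesis
        by (intro flat_cmult[OF exp_sum_translate[OF gU]]) auto
    qed
    have "flat n (\<lambda>\<eta>. 1 / of_nat (card E) * (\<Sum>e\<in>E. ?d e * g (\<eta> + of_int_vec e)))"
      by (rule flat_cmult[OF exp_sum_sum[OF es] flat_sum[OF es fe]])
    ultimately show "flat n (\<lambda>\<eta>. H k \<eta> - H l \<eta>)" by simp
  next
    fix e assume fl: "\<forall>k\<in>K. \<forall>l\<in>K. flat n (\<lambda>\<eta>. H k \<eta> - H l \<eta>)" and e: "e \<in> E - {0}"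
    obtain l where l: "l \<in> K" using digit_setE[OF K(3)] by blast
    have "\<not> (\<exists>u. e = transpose M *v u)"
      using digit_set_unique[OF E(1), of e 0] E(2) e by auto
    then have "inv_act (transpose M) (of_int_vec e :: real^'d) \<notin> range of_int_vec"
      by (simp add: inv_act_integer_iff[OF inv'])
    then have "(\<Sum>v\<in>s ` K. expi (inv_act M (of_int_vec v)) (of_int_vec e :: real^'d)) = 0"
      using char_sum[OF inv K(3), of e] K(1) by simp
    then have "(\<Sum>k\<in>K. expi (inv_act M (of_int_vec (s k))) (of_int_vec e :: real^'d)) = 0"
      by (simp add: sum.reindex[OF K(2)])
    then have zero: "(\<Sum>k\<in>K. expi (a k) (of_int_vec e)) = 0"
    proof -
      have "expi (a k) (of_int_vec e) = expi (inv_act M (of_int_vec (s k))) (of_int_vec e) * expi (- b) (of_int_vec e)" for k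
        using expi_add[of "inv_act M (of_int_vec (s k))" "- b"] by (simp add: a_def)
      then show ?thesis
        using \<open>(\<Sum>k\<in>K. expi (inv_act M (of_int_vec (s k))) (of_int_vec e :: real^'d)) = 0\<close>
        by (simp flip: sum_distrib_right)
    qed
    (* The translate by e is a combination of the H k whose coefficients sum to zero, so a fixed H l
       may be subtracted from every H k. *)
    have "(\<lambda>\<eta>. g (\<eta> + of_int_vec e)) = (\<lambda>\<eta>. \<Sum>k\<in>K. expi (a k) (of_int_vec e) * (H k \<eta> - H l \<eta>))"
      using zero by (simp add: g_shift right_diff_distrib sum_subtractf flip: sum_distrib_right)
    moreover have "flat n (\<lambda>\<eta>. \<Sum>k\<in>K. expi (a k) (of_int_vec e) * (H k \<eta> - H l \<eta>))"
      using fl l by (intro flat_sum[of _ UNIV] flat_cmult[of UNIV] exp_sum_cmult exp_sum_diff HU) auto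
    ultimately show "flat n (\<lambda>\<eta>. g (\<eta> + of_int_vec e))" by simp
  qed
qed

section \<open>Jets at the origin\<close>

text \<open>
  If \<open>l\<close> are the normalized Taylor data of \<open>f\<close> at \<open>0\<close>, these are the data of \<open>f\<close> times \<open>expi y\<close>.
  They are the coefficients in front of the \<open>G\<^sub>\<beta>\<^sub>i\<close> in the mask \<open>m\<^sub>0\<^sup>*\<close>, for
  \<open>y = M\<^sup>-\<^sup>1c - M\<^sup>-\<^sup>1s\<^sub>i\<close>.
\<close>

definition taylor_shift :: "(nat^'d \<Rightarrow> complex) \<Rightarrow> real^'d \<Rightarrow> nat^'d \<Rightarrow> complex" where
  "taylor_shift l y \<beta> = (\<Sum>\<gamma>\<in>{\<gamma>. \<gamma> \<le> \<beta>}. l \<gamma> * of_real (mi_binom \<beta> \<gamma> * mi_pow y (\<beta> - \<gamma>)))"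

text \<open>
  Derivatives are normalized by powers of \<open>2\<pi>i\<close>, so that the jet of \<open>expi a\<close> consists of the
  real monomials of \<open>a\<close> and the classes \<open>\<Theta>\<^sub>\<beta>\<^sub>,\<^sub>n\<close> have the unit jets.
\<close>

definition has_jet :: "nat \<Rightarrow> (nat^'d \<Rightarrow> complex) \<Rightarrow> (real^'d \<Rightarrow> complex) \<Rightarrow> bool" where
  "has_jet n l f \<longleftrightarrow> (\<forall>\<beta>\<in>Delta n. mi_deriv \<beta> f 0 = (2 * of_real pi * \<i>) ^ mi_size \<beta> * l \<beta>)"

lemma flat_diff_has_jet:
  "exp_sum S f \<Longrightarrow> exp_sum T g \<Longrightarrow> has_jet n l g \<Longrightarrow> flat n (\<lambda>\<xi>. f \<xi> - g \<xi>) \<longleftrightarrow> has_jet n l f"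
  by (auto simp: flat_diff_iff has_jet_def)

lemma has_jet_combination:
  assumes "\<And>\<beta>. \<beta> \<in> Delta n \<Longrightarrow> exp_sum S (G \<beta>)" "\<And>\<beta>. \<beta> \<in> Delta n \<Longrightarrow> G \<beta> \<in> Theta \<beta> n"
  shows "has_jet n (\<lambda>\<beta>. z * l \<beta>) (\<lambda>\<xi>. z * (\<Sum>\<beta>\<in>Delta n. l \<beta> * G \<beta> \<xi>))"
  unfolding has_jet_def
proof
  fix \<alpha> :: "nat^'a" assume a: "\<alpha> \<in> Delta n"
  have es: "exp_sum S (\<lambda>\<xi>. l \<beta> * G \<beta> \<xi>)" if "\<beta> \<in> Delta n" for \<beta>
    using assms(1)[OF that] by (rule exp_sum_cmult)
  have "mi_deriv \<alpha> (\<lambda>\<xi>. z * (\<Sum>\<beta>\<in>Delta n. l \<beta> * G \<beta> \<xi>)) 0 =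
      z * (\<Sum>\<beta>\<in>Delta n. mi_deriv \<alpha> (\<lambda>\<xi>. l \<beta> * G \<beta> \<xi>) 0)"
    by (simp add: mi_deriv_cmult[OF exp_sum_sum[OF es]] mi_deriv_sum[OF es])
  also have "(\<Sum>\<beta>\<in>Delta n. mi_deriv \<alpha> (\<lambda>\<xi>. l \<beta> * G \<beta> \<xi>) 0) =
      (\<Sum>\<beta>\<in>Delta n. if \<beta> = \<alpha> then (2 * of_real pi * \<i>) ^ mi_size \<alpha> * l \<alpha> else 0)"
  proof (intro sum.cong refl)
    fix \<beta> :: "nat^'a" assume "\<beta> \<in> Delta n"
    then show "mi_deriv \<alpha> (\<lambda>\<xi>. l \<beta> * G \<beta> \<xi>) 0 =
        (if \<beta> = \<alpha> then (2 * of_real pi * \<i>) ^ mi_size \<alpha> * l \<alpha> else 0)"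
      using assms(2)[of \<beta>] a by (simp add: mi_deriv_cmult[OF assms(1)] Theta_def)
  qed
  also have "\<dots> = (2 * of_real pi * \<i>) ^ mi_size \<alpha> * l \<alpha>"
    using a by (simp add: finite_Delta)
  finally show "mi_deriv \<alpha> (\<lambda>\<xi>. z * (\<Sum>\<beta>\<in>Delta n. l \<beta> * G \<beta> \<xi>)) 0 =
      (2 * of_real pi * \<i>) ^ mi_size \<alpha> * (z * l \<alpha>)"
    by (simp add: mult_ac)
qed

lemma has_jet_expi_mult:
  assumes f: "exp_sum S f" and l: "has_jet n l f"
  shows "has_jet n (taylor_shift l y) (\<lambda>\<xi>. f \<xi> * expi y \<xi>)"
  unfolding has_jet_def
proof
  fix \<beta> :: "nat^'a" assume b: "\<beta> \<in> Delta n"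
  let ?w = "2 * of_real pi * \<i> :: complex"
  have "mi_deriv \<beta> (\<lambda>\<xi>. f \<xi> * expi y \<xi>) 0 =
     (\<Sum>\<gamma>\<in>{\<gamma>. \<gamma> \<le> \<beta>}. of_real (mi_binom \<beta> \<gamma>) * mi_deriv \<gamma> f 0 * mi_deriv (\<beta> - \<gamma>) (expi y) 0)"
    by (rule mi_deriv_mult[OF f exp_sum_expi[OF UNIV_I]])
  also have "\<dots> = (\<Sum>\<gamma>\<in>{\<gamma>. \<gamma> \<le> \<beta>}. ?w ^ mi_size \<beta> * (l \<gamma> * of_real (mi_binom \<beta> \<gamma> * mi_pow y (\<beta> - \<gamma>))))"
  proof (intro sum.cong refl)
    fix \<gamma> assume "\<gamma> \<in> {\<gamma>. \<gamma> \<le> \<beta>}"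
    then have sz: "mi_size \<beta> = mi_size \<gamma> + mi_size (\<beta> - \<gamma>)" by (simp add: mi_size_diff)
    then have "\<gamma> \<in> Delta n" using b by (simp add: Delta_def)
    with l have "mi_deriv \<gamma> f 0 = ?w ^ mi_size \<gamma> * l \<gamma>" by (simp add: has_jet_def)
    then show "of_real (mi_binom \<beta> \<gamma>) * mi_deriv \<gamma> f 0 * mi_deriv (\<beta> - \<gamma>) (expi y) 0 =
       ?w ^ mi_size \<beta> * (l \<gamma> * of_real (mi_binom \<beta> \<gamma> * mi_pow y (\<beta> - \<gamma>)))"
      by (simp add: mi_deriv_expi sz power_add)
  qed
  finally show "mi_deriv \<beta> (\<lambda>\<xi>. f \<xi> * expi y \<xi>) 0 = ?w ^ mi_size \<beta> * taylor_shift l y \<beta>"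
    by (simp add: taylor_shift_def sum_distrib_left)
qed

lemma taylor_shift_cmult: "taylor_shift (\<lambda>\<beta>. z * l \<beta>) y \<beta> = z * taylor_shift l y \<beta>"
  by (simp add: taylor_shift_def sum_distrib_left mult.assoc)

lemma has_jet_cnj:
  assumes "exp_sum S f" "has_jet n l f"
  shows "has_jet n (\<lambda>\<beta>. (-1) ^ mi_size \<beta> * cnj (l \<beta>)) (\<lambda>\<xi>. cnj (f \<xi>))"
proof -
  show ?thesis
    using assms(2) unfolding has_jet_def
    by (simp add: mi_deriv_cnj[OF assms(1)] cnj_two_pi_i_power del: complex_cnj_power)
qed

lemma cnj_eq_sign_iff:
  "cnj z = (-1) ^ k * z \<longleftrightarrow> (odd k \<longrightarrow> Re z = 0) \<and> (even k \<longrightarrow> Im z = 0)"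
  by (cases "even k") (auto simp: complex_eq_iff)

section \<open>Components with a prescribed jet\<close>

text \<open>
  The two shapes of the components of a mask.  Both consist of a combination of functions from the
  \<open>\<Theta>\<close> classes that realizes the required jet, plus a general remainder that vanishes to order \<open>n\<close>.  The first is for
  digits \<open>s\<^sub>i\<close> with \<open>i' \<noteq> i\<close>, the second for digits that are their own partners, where the
  component is real.
\<close>

definition free_phase where
  "free_phase n z l G T = (\<lambda>\<eta> :: real^'d. z * (\<Sum>\<beta>\<in>Delta n. l \<beta> * G \<beta> \<eta>) +
     (\<Sum>\<alpha>\<in>{\<alpha>. mi_size \<alpha> = n}. T \<alpha> \<eta> * Pi_mi \<alpha> \<eta>))"

definition self_phase where
  "self_phase n z l G A B = (\<lambda>\<eta> :: real^'d. z * (\<Sum>\<beta>\<in>Delta n. l \<beta> * G \<beta> \<eta>) +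
     (\<Sum>\<alpha>\<in>{\<alpha>. mi_size \<alpha> = n}. A \<alpha> \<eta> * of_real (Re (Pi_mi \<alpha> \<eta>)) + B \<alpha> \<eta> * of_real (Im (Pi_mi \<alpha> \<eta>))))"

text \<open>
  The combination \<open>g\<close> of the \<open>G\<^sub>\<beta>\<close> has the required jet, and the difference to any other function
  with this jet is flat, hence of the form \<open>\<Sum> T\<^sub>\<alpha> \<Pi>\<^sub>\<alpha>\<close>.
\<close>

lemma free_phase_iff:
  assumes G: "\<And>\<beta>. \<beta> \<in> Delta n \<Longrightarrow> exp_sum (coset 0) (G \<beta>)" "\<And>\<beta>. \<beta> \<in> Delta n \<Longrightarrow> G \<beta> \<in> Theta \<beta> n"
  shows "exp_sum (coset 0) f \<and> has_jet n (\<lambda>\<beta>. z * l \<beta>) f \<longleftrightarrow>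
    (\<exists>T. (\<forall>\<alpha>. mi_size \<alpha> = n \<longrightarrow> exp_sum (coset 0) (T \<alpha>)) \<and> f = free_phase n z l G T)"
proof -
  define g where "g = (\<lambda>\<eta>. z * (\<Sum>\<beta>\<in>Delta n. l \<beta> * G \<beta> \<eta>))"
  have g: "exp_sum (coset 0) g" unfolding g_def by (intro exp_sum_cmult exp_sum_sum G)
  have gj: "has_jet n (\<lambda>\<beta>. z * l \<beta>) g" unfolding g_def by (rule has_jet_combination[OF G])
  show ?thesis
  proof (intro iffI; elim exE conjE)
    assume f: "exp_sum (coset 0) f" "has_jet n (\<lambda>\<beta>. z * l \<beta>) f"
    then have "flat n (\<lambda>\<eta>. f \<eta> - g \<eta>)" using flat_diff_has_jet[OF f(1) g gj] by simp
    from flat_imp_in_Pi_ideal[OF exp_sum_diff[OF f(1) g] this]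
    obtain T where "\<forall>\<alpha>. exp_sum (coset 0) (T \<alpha>)"
      "(\<lambda>\<eta>. f \<eta> - g \<eta>) = (\<lambda>\<eta>. \<Sum>\<alpha>\<in>{\<alpha>. mi_size \<alpha> = n}. T \<alpha> \<eta> * Pi_mi \<alpha> \<eta>)"
      unfolding in_Pi_ideal_def by blast
    then show "\<exists>T. (\<forall>\<alpha>. mi_size \<alpha> = n \<longrightarrow> exp_sum (coset 0) (T \<alpha>)) \<and> f = free_phase n z l G T"
      by (intro exI[of _ T]) (auto simp: free_phase_def g_def fun_eq_iff algebra_simps)
  next
    fix T assume T: "\<forall>\<alpha>. mi_size \<alpha> = n \<longrightarrow> exp_sum (coset 0) (T \<alpha>)" and f: "f = free_phase n z l G T"
    let ?r = "\<lambda>\<eta>. \<Sum>\<alpha>\<in>{\<alpha>. mi_size \<alpha> = n}. T \<alpha> \<eta> * Pi_mi \<alpha> \<eta>"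
    have fr: "f = (\<lambda>\<eta>. g \<eta> + ?r \<eta>)" by (simp add: f free_phase_def g_def)
    have es: "exp_sum (coset 0) (\<lambda>\<eta>. T \<alpha> \<eta> * Pi_mi \<alpha> \<eta>)" if "\<alpha> \<in> {\<alpha>. mi_size \<alpha> = n}" for \<alpha>
      using that T by (intro exp_sum_coset0_mult Pi_mi_exp_sum) auto
    have fl: "flat n (\<lambda>\<eta>. T \<alpha> \<eta> * Pi_mi \<alpha> \<eta>)" if "\<alpha> \<in> {\<alpha>. mi_size \<alpha> = n}" for \<alpha>
      using that T Pi_mi_flat[of \<alpha>] by (intro flat_mult_right[OF _ Pi_mi_exp_sum]) auto
    have r: "exp_sum (coset 0) ?r" by (rule exp_sum_sum[OF es])
    have rf: "flat n ?r" by (rule flat_sum[OF es fl])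
    have "exp_sum (coset 0) f" unfolding fr by (rule exp_sum_add[OF g r])
    moreover have "flat n (\<lambda>\<eta>. f \<eta> - g \<eta>)" using rf by (simp add: fr)
    ultimately show "exp_sum (coset 0) f \<and> has_jet n (\<lambda>\<beta>. z * l \<beta>) f"
      using flat_diff_has_jet[OF _ g gj] by blast
  qed
qed

lemma exp_sum_coset_Re_Im:
  assumes U: "exp_sum (coset \<sigma>) U" and \<sigma>: "coset (- \<sigma>) = coset \<sigma>"
  shows "exp_sum (coset \<sigma>) (\<lambda>\<eta>. of_real (Re (U \<eta>)))" "exp_sum (coset \<sigma>) (\<lambda>\<eta>. of_real (Im (U \<eta>)))"
proof -
  have c: "exp_sum (coset \<sigma>) (\<lambda>\<eta>. cnj (U \<eta>))" using exp_sum_coset_cnj[OF U] \<sigma> by simp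
  have "(\<lambda>\<eta>. of_real (Re (U \<eta>))) = (\<lambda>\<eta>. (1/2) * (U \<eta> + cnj (U \<eta>)))"
    by (simp add: complex_add_cnj)
  then show "exp_sum (coset \<sigma>) (\<lambda>\<eta>. of_real (Re (U \<eta>)))"
    using exp_sum_cmult[OF exp_sum_add[OF U c], of "1/2"] by simp
  have eq: "(\<lambda>\<eta>. of_real (Im (U \<eta>))) = (\<lambda>\<eta>. (1/(2*\<i>)) * (U \<eta> - cnj (U \<eta>)))"
    by (simp add: fun_eq_iff complex_eq_iff)
  show "exp_sum (coset \<sigma>) (\<lambda>\<eta>. of_real (Im (U \<eta>)))"
    unfolding eq by (rule exp_sum_cmult[OF exp_sum_diff[OF U c]])
qed

lemma flat_Re_Im:
  assumes U: "exp_sum S U" and fl: "flat n U"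
  shows "flat n (\<lambda>\<eta>. of_real (Re (U \<eta>)))" "flat n (\<lambda>\<eta>. of_real (Im (U \<eta>)))"
proof -
  have UU: "exp_sum UNIV U" using U by (rule exp_sum_UNIV)
  have c: "exp_sum UNIV (\<lambda>\<eta>. cnj (U \<eta>))" by (rule exp_sum_cnj[OF UU]) simp
  have fc: "flat n (\<lambda>\<eta>. cnj (U \<eta>))" by (rule flat_cnj[OF U fl])
  have "(\<lambda>\<eta>. of_real (Re (U \<eta>))) = (\<lambda>\<eta>. (1/2) * (U \<eta> + cnj (U \<eta>)))"
    by (simp add: complex_add_cnj)
  then show "flat n (\<lambda>\<eta>. of_real (Re (U \<eta>)))"
    using flat_cmult[OF exp_sum_add[OF UU c] flat_add[OF UU c fl fc], of "1/2"] by simp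
  have eq: "(\<lambda>\<eta>. of_real (Im (U \<eta>))) = (\<lambda>\<eta>. (1/(2*\<i>)) * (U \<eta> + (-1) * cnj (U \<eta>)))"
    by (simp add: fun_eq_iff complex_eq_iff)
  show "flat n (\<lambda>\<eta>. of_real (Im (U \<eta>)))"
    unfolding eq
    by (rule flat_cmult[OF exp_sum_add[OF UU exp_sum_cmult[OF c]]
          flat_add[OF UU exp_sum_cmult[OF c] fl flat_cmult[OF c fc]]])
qed

text \<open>
  As before the remainder \<open>f - g\<close> is \<open>\<Sum> U\<^sub>\<alpha> \<Pi>\<^sub>\<alpha>\<close>, now with \<open>U\<^sub>\<alpha>\<close> of semi-integer degrees.  It is also
  real, so it equals its real part \<open>\<Sum> (Re U\<^sub>\<alpha> Re \<Pi>\<^sub>\<alpha> - Im U\<^sub>\<alpha> Im \<Pi>\<^sub>\<alpha>)\<close>.  The assumption on \<open>\<sigma>\<close>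
  makes the coset of \<open>\<sigma>\<close> closed under conjugation, so that \<open>Re U\<^sub>\<alpha>\<close> and \<open>Im U\<^sub>\<alpha>\<close> have frequencies in
  it again.
\<close>

lemma self_phase_iff:
  fixes f :: "real^'d \<Rightarrow> complex"
  assumes G: "\<And>\<beta>. \<beta> \<in> Delta n \<Longrightarrow> exp_sum (coset \<sigma>) (G \<beta>)" "\<And>\<beta>. \<beta> \<in> Delta n \<Longrightarrow> G \<beta> \<in> ThetaB \<beta> n"
    and l: "\<And>\<beta>. \<beta> \<in> Delta n \<Longrightarrow> cnj (l \<beta>) = (-1) ^ mi_size \<beta> * l \<beta>"
    and z: "z \<in> \<real>" and \<sigma>: "coset (- \<sigma>) = coset \<sigma>"
  shows "exp_sum (coset \<sigma>) f \<and> (\<forall>\<eta>. f \<eta> \<in> \<real>) \<and> has_jet n (\<lambda>\<beta>. z * l \<beta>) f \<longleftrightarrow>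
    (\<exists>A B. (\<forall>\<alpha>. mi_size \<alpha> = n \<longrightarrow> exp_sum (coset \<sigma>) (A \<alpha>) \<and> (\<forall>\<eta>. A \<alpha> \<eta> \<in> \<real>) \<and>
       exp_sum (coset \<sigma>) (B \<alpha>) \<and> (\<forall>\<eta>. B \<alpha> \<eta> \<in> \<real>)) \<and> f = self_phase n z l G A B)"
proof -
  define g where "g = (\<lambda>\<eta>. z * (\<Sum>\<beta>\<in>Delta n. l \<beta> * G \<beta> \<eta>))"
  have g: "exp_sum (coset \<sigma>) g" unfolding g_def by (intro exp_sum_cmult exp_sum_sum G)
  have gj: "has_jet n (\<lambda>\<beta>. z * l \<beta>) g" unfolding g_def
    using G by (intro has_jet_combination) (auto simp: ThetaB_def)
  have g_real: "g \<eta> \<in> \<real>" for \<eta>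
  proof -
    have "l \<beta> * G \<beta> \<eta> \<in> \<real>" if b: "\<beta> \<in> Delta n" for \<beta>
    proof -
      have "G \<beta> \<eta> = (-1) ^ mi_size \<beta> * cnj (G \<beta> \<eta>)" using G(2)[OF b] by (simp add: ThetaB_def)
      then have "l \<beta> * G \<beta> \<eta> = cnj (l \<beta>) * cnj (G \<beta> \<eta>)"
        by (simp add: l[OF b] mult_ac)
      then have "cnj (l \<beta> * G \<beta> \<eta>) = l \<beta> * G \<beta> \<eta>" by simp
      then show ?thesis by (simp add: Reals_cnj_iff)
    qed
    then show ?thesis unfolding g_def using z by (auto intro!: sum_in_Reals Reals_mult)
  qed
  show ?thesis
  proof (intro iffI; elim exE conjE)
    assume f: "exp_sum (coset \<sigma>) f" "has_jet n (\<lambda>\<beta>. z * l \<beta>) f" and f_real: "\<forall>\<eta>. f \<eta> \<in> \<real>"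
    have d: "exp_sum (coset \<sigma>) (\<lambda>\<eta>. f \<eta> - g \<eta>)" by (rule exp_sum_diff[OF f(1) g])
    have "flat n (\<lambda>\<eta>. f \<eta> - g \<eta>)" using flat_diff_has_jet[OF f(1) g gj] f(2) by simp
    then have "flat n (\<lambda>\<eta>. expi (- \<sigma>) \<eta> * (f \<eta> - g \<eta>))"
      by (rule flat_mult_right[OF exp_sum_coset_expi d])
    moreover have "exp_sum (coset 0) (\<lambda>\<eta>. expi (- \<sigma>) \<eta> * (f \<eta> - g \<eta>))"
      using exp_sum_coset_mult[OF exp_sum_coset_expi[of "- \<sigma>"] d] by simp
    ultimately have "in_Pi_ideal n (\<lambda>\<eta>. expi (- \<sigma>) \<eta> * (f \<eta> - g \<eta>))" by (intro flat_imp_in_Pi_ideal)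
    then obtain T where T: "\<And>\<alpha>. exp_sum (coset 0) (T \<alpha>)"
      and eq: "(\<lambda>\<eta>. expi (- \<sigma>) \<eta> * (f \<eta> - g \<eta>)) = (\<lambda>\<eta>. \<Sum>\<alpha>\<in>{\<alpha>. mi_size \<alpha> = n}. T \<alpha> \<eta> * Pi_mi \<alpha> \<eta>)"
      unfolding in_Pi_ideal_def by blast
    (* The factor expi (-\<sigma>) made the degrees integral; it is now undone. *)
    define U where "U \<alpha> = (\<lambda>\<eta>. expi \<sigma> \<eta> * T \<alpha> \<eta>)" for \<alpha>
    have U: "exp_sum (coset \<sigma>) (U \<alpha>)" for \<alpha>
      using exp_sum_coset_mult[OF exp_sum_coset_expi[of \<sigma>] T] by (simp add: U_def)
    have fg: "f \<eta> - g \<eta> = (\<Sum>\<alpha>\<in>{\<alpha>. mi_size \<alpha> = n}. U \<alpha> \<eta> * Pi_mi \<alpha> \<eta>)" for \<eta>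
    proof -
      have "f \<eta> - g \<eta> = expi \<sigma> \<eta> * (expi (- \<sigma>) \<eta> * (f \<eta> - g \<eta>))" by (simp flip: mult.assoc)
      also have "\<dots> = expi \<sigma> \<eta> * (\<Sum>\<alpha>\<in>{\<alpha>. mi_size \<alpha> = n}. T \<alpha> \<eta> * Pi_mi \<alpha> \<eta>)"
        using fun_cong[OF eq, of \<eta>] by simp
      finally show ?thesis by (simp add: U_def sum_distrib_left mult.assoc)
    qed
    have "f = self_phase n z l G (\<lambda>\<alpha> \<eta>. of_real (Re (U \<alpha> \<eta>))) (\<lambda>\<alpha> \<eta>. (-1) * of_real (Im (U \<alpha> \<eta>)))"
    proof
      fix \<eta>
      have "f \<eta> - g \<eta> \<in> \<real>" using f_real g_real by (intro Reals_diff) auto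
      then have "f \<eta> - g \<eta> = of_real (Re (f \<eta> - g \<eta>))" by (rule of_real_Re[symmetric])
      also have "\<dots> = (\<Sum>\<alpha>\<in>{\<alpha>. mi_size \<alpha> = n}. of_real (Re (U \<alpha> \<eta>)) * of_real (Re (Pi_mi \<alpha> \<eta>)) +
           (-1) * of_real (Im (U \<alpha> \<eta>)) * of_real (Im (Pi_mi \<alpha> \<eta>)))"
        unfolding fg Re_sum of_real_sum by (intro sum.cong refl) simp
      finally show "f \<eta> = self_phase n z l G (\<lambda>\<alpha> \<eta>. of_real (Re (U \<alpha> \<eta>))) (\<lambda>\<alpha> \<eta>. (-1) * of_real (Im (U \<alpha> \<eta>))) \<eta>"
        unfolding self_phase_def g_def by (simp only: diff_eq_eq add.commute)
    qed
    moreover have "exp_sum (coset \<sigma>) (\<lambda>\<eta>. of_real (Re (U \<alpha> \<eta>)))"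
      "exp_sum (coset \<sigma>) (\<lambda>\<eta>. (-1) * of_real (Im (U \<alpha> \<eta>)))" for \<alpha>
      by (rule exp_sum_coset_Re_Im[OF U \<sigma>], rule exp_sum_cmult[OF exp_sum_coset_Re_Im(2)[OF U \<sigma>]])
    ultimately show "\<exists>A B. (\<forall>\<alpha>. mi_size \<alpha> = n \<longrightarrow> exp_sum (coset \<sigma>) (A \<alpha>) \<and> (\<forall>\<eta>. A \<alpha> \<eta> \<in> \<real>) \<and>
       exp_sum (coset \<sigma>) (B \<alpha>) \<and> (\<forall>\<eta>. B \<alpha> \<eta> \<in> \<real>)) \<and> f = self_phase n z l G A B"
      by (intro exI[of _ "\<lambda>\<alpha> \<eta>. of_real (Re (U \<alpha> \<eta>))"] exI[of _ "\<lambda>\<alpha> \<eta>. (-1) * of_real (Im (U \<alpha> \<eta>))"]) auto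
  next
    fix A B :: "nat^'d \<Rightarrow> real^'d \<Rightarrow> complex"
    assume AB: "\<forall>\<alpha>. mi_size \<alpha> = n \<longrightarrow> exp_sum (coset \<sigma>) (A \<alpha>) \<and> (\<forall>\<eta>. A \<alpha> \<eta> \<in> \<real>) \<and>
       exp_sum (coset \<sigma>) (B \<alpha>) \<and> (\<forall>\<eta>. B \<alpha> \<eta> \<in> \<real>)" and f: "f = self_phase n z l G A B"
    let ?t = "\<lambda>\<alpha> \<eta>. A \<alpha> \<eta> * of_real (Re (Pi_mi \<alpha> \<eta>)) + B \<alpha> \<eta> * of_real (Im (Pi_mi \<alpha> \<eta>))"
    let ?r = "\<lambda>\<eta>. \<Sum>\<alpha>\<in>{\<alpha>. mi_size \<alpha> = n}. ?t \<alpha> \<eta>"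
    have fr: "f = (\<lambda>\<eta>. g \<eta> + ?r \<eta>)" by (simp add: f self_phase_def g_def)
    have PiR: "exp_sum (coset 0) (\<lambda>\<eta>. of_real (Re (Pi_mi \<alpha> \<eta>)))"
      "exp_sum (coset 0) (\<lambda>\<eta>. of_real (Im (Pi_mi \<alpha> \<eta>)))" for \<alpha> :: "nat^'d"
      using exp_sum_coset_Re_Im[OF Pi_mi_exp_sum] by auto
    have es: "exp_sum (coset \<sigma>) (\<lambda>\<eta>. A \<alpha> \<eta> * of_real (Re (Pi_mi \<alpha> \<eta>)))"
      "exp_sum (coset \<sigma>) (\<lambda>\<eta>. B \<alpha> \<eta> * of_real (Im (Pi_mi \<alpha> \<eta>)))" if "mi_size \<alpha> = n" for \<alpha>
      using that AB exp_sum_coset_mult[OF _ PiR(1), of \<sigma> "A \<alpha>" \<alpha>] exp_sum_coset_mult[OF _ PiR(2), of \<sigma> "B \<alpha>" \<alpha>]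
      by auto
    have fl: "flat n (\<lambda>\<eta>. A \<alpha> \<eta> * of_real (Re (Pi_mi \<alpha> \<eta>)))"
      "flat n (\<lambda>\<eta>. B \<alpha> \<eta> * of_real (Im (Pi_mi \<alpha> \<eta>)))" if "mi_size \<alpha> = n" for \<alpha>
    proof -
      have "flat n (Pi_mi \<alpha>)" using Pi_mi_flat[of \<alpha>] that by simp
      note F = flat_Re_Im[OF Pi_mi_exp_sum this]
      show "flat n (\<lambda>\<eta>. A \<alpha> \<eta> * of_real (Re (Pi_mi \<alpha> \<eta>)))"
        using AB that by (intro flat_mult_right[OF _ PiR(1) F(1)]) auto
      show "flat n (\<lambda>\<eta>. B \<alpha> \<eta> * of_real (Im (Pi_mi \<alpha> \<eta>)))"
        using AB that by (intro flat_mult_right[OF _ PiR(2) F(2)]) auto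
    qed
    have r: "exp_sum (coset \<sigma>) ?r" using es by (intro exp_sum_sum exp_sum_add) auto
    have rf: "flat n ?r"
      using flat_add[OF es fl] exp_sum_add[OF es] by (intro flat_sum[of _ "coset \<sigma>"]) auto
    have ef: "exp_sum (coset \<sigma>) f" unfolding fr by (rule exp_sum_add[OF g r])
    moreover have "f \<eta> \<in> \<real>" for \<eta>
      unfolding fr using AB g_real by (intro Reals_add sum_in_Reals Reals_mult) auto
    moreover have "flat n (\<lambda>\<eta>. f \<eta> - g \<eta>)" using rf by (simp add: fr)
    then have "has_jet n (\<lambda>\<beta>. z * l \<beta>) f" using flat_diff_has_jet[OF ef g gj] by blast
    ultimately show "exp_sum (coset \<sigma>) f \<and> (\<forall>\<eta>. f \<eta> \<in> \<real>) \<and> has_jet n (\<lambda>\<beta>. z * l \<beta>) f" by blast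
  qed
qed

section \<open>Partners of digits\<close>

lemma half_int_lattice_double: "c \<in> half_int_lattice \<Longrightarrow> \<exists>w. 2 *\<^sub>R c = of_int_vec w"
  by (rule exI[of _ "\<chi> j. \<lfloor>2 * c $ j\<rfloor>"]) (auto simp: half_int_lattice_def of_int_vec_def vec_eq_iff)

lemma partner_unique:
  fixes M :: "int^'d^'d"
  assumes inv: "invertible (of_int_mat M :: real^'d^'d)" and c: "c \<in> half_int_lattice"
    and s: "inj_on s {..<num_digits M}" "digit_set M (s ` {..<num_digits M})"
  shows "\<exists>!l. l < num_digits M \<and> inv_act M (2 *\<^sub>R c - of_int_vec (s k) - of_int_vec (s l)) \<in> range of_int_vec"
proof -
  obtain w where w: "2 *\<^sub>R c = of_int_vec w" using half_int_lattice_double[OF c] by blast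
  have R: "inv_act M (2 *\<^sub>R c - of_int_vec (s k) - of_int_vec (s l)) \<in> range of_int_vec \<longleftrightarrow>
      (\<exists>u. (w - s k) - s l = M *v u)" for l
    by (simp add: w inv_act_integer_iff[OF inv] flip: of_int_vec_diff)
  obtain l where l: "l < num_digits M" "\<exists>u. (w - s k) - s l = M *v u"
    using digit_setE[OF s(2), of "w - s k"] by blast
  show ?thesis unfolding R
  proof (rule ex1I[of _ l])
    fix l' assume l': "l' < num_digits M \<and> (\<exists>u. (w - s k) - s l' = M *v u)"
    then have "\<exists>u. ((w - s k) - s l') - ((w - s k) - s l) = M *v u"
      using l(2) by (blast intro: lattice_diff)
    then have "\<exists>u. s l - s l' = M *v u" by (simp add: algebra_simps)
    then have "s l = s l'" using l l' by (intro digit_set_unique[OF s(2)]) auto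
    then show "l' = l" using l l' inj_onD[OF s(1), of l l'] by auto
  qed (use l in blast)
qed

lemma partner_props:
  fixes M :: "int^'d^'d"
  assumes inv: "invertible (of_int_mat M :: real^'d^'d)" and c: "c \<in> half_int_lattice"
    and s: "inj_on s {..<num_digits M}" "digit_set M (s ` {..<num_digits M})"
  shows "partner M c s k < num_digits M"
    and partner_lattice: "inv_act M (2 *\<^sub>R c - of_int_vec (s k) - of_int_vec (s (partner M c s k))) \<in> range of_int_vec"
    and "k < num_digits M \<Longrightarrow> partner M c s (partner M c s k) = k"
proof -
  note ex1 = partner_unique[OF inv c s]
  show 1: "partner M c s k < num_digits M" for k
    using theI'[OF ex1[of k]] by (simp add: partner_def)
  show 2: "inv_act M (2 *\<^sub>R c - of_int_vec (s k) - of_int_vec (s (partner M c s k))) \<in> range of_int_vec" for k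
    using theI'[OF ex1[of k]] by (simp add: partner_def)
  assume "k < num_digits M"
  moreover have "inv_act M (2 *\<^sub>R c - of_int_vec (s (partner M c s k)) - of_int_vec (s k)) \<in> range of_int_vec"
    using 2[of k] by (simp add: algebra_simps)
  ultimately show "partner M c s (partner M c s k) = k"
    using ex1[of "partner M c s k"] 1 2 by blast
qed

text \<open>
  The frequencies of the component of the partner of \<open>k\<close> are the negatives of those of the
  component of \<open>k\<close>: conjugation exchanges the two components.
\<close>

lemma coset_partner:
  fixes M :: "int^'d^'d"
  assumes inv: "invertible (of_int_mat M :: real^'d^'d)" and c: "c \<in> half_int_lattice"
    and s: "inj_on s {..<num_digits M}" "digit_set M (s ` {..<num_digits M})"
  shows "coset (inv_act M (of_int_vec (s (partner M c s k))) - inv_act M c) =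
    coset (- (inv_act M (of_int_vec (s k)) - inv_act M c))"
proof -
  let ?l = "partner M c s k"
  obtain v where v: "inv_act M (2 *\<^sub>R c - of_int_vec (s k) - of_int_vec (s ?l)) = of_int_vec v"
    using partner_lattice[OF inv c s, of k] by auto
  have "(inv_act M (of_int_vec (s ?l)) - inv_act M c) - - (inv_act M (of_int_vec (s k)) - inv_act M c) =
      - inv_act M (2 *\<^sub>R c - of_int_vec (s k) - of_int_vec (s ?l))"
    unfolding scaleR_2 inv_act_diff inv_act_add by (simp add: algebra_simps)
  also have "\<dots> = of_int_vec (- v)" by (simp only: v of_int_vec_minus)
  finally show ?thesis by (intro coset_eqI) simp
qed

text \<open>
  For a digit that is its own partner, twice \<open>M\<^sup>-\<^sup>1(c - s\<^sub>j)\<close> is an integer vector, so each fractional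
  part is \<open>0\<close> or \<open>1/2\<close>.  Hence \<open>\<sigma>\<close> is an admissible shift and congruent to \<open>-\<sigma>\<close>.
\<close>

lemma digit_sigma_props:
  fixes M :: "int^'d^'d"
  assumes inv: "invertible (of_int_mat M :: real^'d^'d)" and c: "c \<in> half_int_lattice"
    and s: "inj_on s {..<num_digits M}" "digit_set M (s ` {..<num_digits M})"
    and j: "j \<in> J_set M c s"
  shows "semi_trig_poly (digit_sigma M c s j) t \<longleftrightarrow> exp_sum (coset (digit_sigma M c s j)) t"
    and "coset (- digit_sigma M c s j) = coset (digit_sigma M c s j)"
    and "coset (inv_act M (of_int_vec (s j)) - inv_act M c) = coset (digit_sigma M c s j)"
proof -
  define x where "x = inv_act M (c - of_int_vec (s j))"
  define \<sigma> where "\<sigma> = digit_sigma M c s j"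
  have \<sigma>: "\<sigma> = x - of_int_vec (floor_vec x)" by (simp add: \<sigma>_def x_def digit_sigma_def)
  have "2 *\<^sub>R x = inv_act M (2 *\<^sub>R c - of_int_vec (s j) - of_int_vec (s j))"
    unfolding x_def scaleR_2 inv_act_diff inv_act_add by (simp add: algebra_simps)
  also have "\<dots> \<in> range of_int_vec"
    using partner_lattice[OF inv c s, of j] j by (simp add: J_set_def)
  finally obtain v where v: "2 *\<^sub>R x = of_int_vec v" by auto
  have \<sigma>2: "2 *\<^sub>R \<sigma> = of_int_vec (v - (floor_vec x + floor_vec x))"
    by (simp only: \<sigma> scaleR_diff_right v of_int_vec_diff of_int_vec_add scaleR_2[of "of_int_vec (floor_vec x)"])
  have "2 * \<sigma> $ i \<in> \<int> \<and> 0 \<le> \<sigma> $ i \<and> \<sigma> $ i \<le> 1/2" for i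
  proof -
    (* A fractional part below 1 whose double is an integer is at most 1/2. *)
    have fr: "\<sigma> $ i = frac (x $ i)" by (simp add: \<sigma> floor_vec_def of_int_vec_def frac_def)
    have "2 * \<sigma> $ i = of_int ((v - (floor_vec x + floor_vec x)) $ i)"
      using arg_cong[OF \<sigma>2, of "\<lambda>y. y $ i"] by (simp add: of_int_vec_def)
    then obtain k :: int where k: "2 * \<sigma> $ i = of_int k" by blast
    have "\<sigma> $ i < 1" "0 \<le> \<sigma> $ i" by (simp_all add: fr frac_lt_1)
    moreover from this k have "k < 2" by linarith
    then have "real_of_int k \<le> 1" by simp
    ultimately show ?thesis using k by auto
  qed
  then show "semi_trig_poly (digit_sigma M c s j) t \<longleftrightarrow> exp_sum (coset (digit_sigma M c s j)) t"
    by (simp add: semi_trig_poly_iff \<sigma>_def half_int_lattice_def)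
  have "\<sigma> - - \<sigma> \<in> range of_int_vec" using \<sigma>2 by (simp add: scaleR_2)
  from coset_eqI[OF this] show neg: "coset (- digit_sigma M c s j) = coset (digit_sigma M c s j)"
    by (simp add: \<sigma>_def)
  have "(inv_act M (of_int_vec (s j)) - inv_act M c) - (- \<sigma>) = of_int_vec (- floor_vec x)"
    by (simp add: \<sigma> x_def inv_act_diff of_int_vec_minus)
  then have "(inv_act M (of_int_vec (s j)) - inv_act M c) - (- \<sigma>) \<in> range of_int_vec" by simp
  from coset_eqI[OF this] show "coset (inv_act M (of_int_vec (s j)) - inv_act M c) = coset (digit_sigma M c s j)"
    using neg by (simp add: \<sigma>_def)
qed

section \<open>Symmetric masks with sum rule in terms of their components\<close>

lemma exp_sum_polyphase_term:
  fixes M :: "int^'d^'d"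
  assumes inv: "invertible (of_int_mat M :: real^'d^'d)"
    and f: "exp_sum (coset (inv_act M (of_int_vec v) - inv_act M c)) f"
  shows "exp_sum (coset 0) (\<lambda>\<xi>. expi c \<xi> * f (star_act M \<xi>))"
proof -
  obtain X h where X: "finite X" "X \<subseteq> coset (inv_act M (of_int_vec v) - inv_act M c)"
    "f = (\<lambda>\<xi>. \<Sum>a\<in>X. h a * expi a \<xi>)"
    using exp_sumE[OF f] .
  have "expi c \<xi> * expi a (star_act M \<xi>) = expi (c + of_int_mat M *v a) \<xi>" for a \<xi>
    by (simp add: expi_add) (simp add: expi_def inner_star_act)
  then have "(\<lambda>\<xi>. expi c \<xi> * f (star_act M \<xi>)) = (\<lambda>\<xi>. \<Sum>a\<in>X. h a * expi (c + of_int_mat M *v a) \<xi>)"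
    by (simp add: X(3) sum_distrib_left mult.left_commute)
  moreover have "exp_sum (coset 0) (\<lambda>\<xi>. \<Sum>a\<in>X. h a * expi (c + of_int_mat M *v a) \<xi>)"
  proof (rule exp_sum_finite_index[OF X(1)])
    fix a assume "a \<in> X"
    then obtain k where "a = of_int_vec k + (inv_act M (of_int_vec v) - inv_act M c)"
      using X(2) by (auto simp: coset_def)
    then have "c + of_int_mat M *v a = of_int_vec (M *v k + v)"
      by (simp add: matrix_vector_right_distrib matrix_vector_mult_diff_distrib act_inv_act[OF inv]
          of_int_vec_mult of_int_vec_add)
    then show "c + of_int_mat M *v a \<in> coset 0" by (auto simp: coset_def)
  qed
  ultimately show ?thesis by simp
qed

text \<open>
  The heart of the argument: the conditions on \<open>m\<^sub>0\<close> decouple into conditions on the components.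
  Symmetry says that \<open>\<Sum> H\<^sub>k\<close> is real, which by uniqueness of the components means that conjugation
  exchanges partners.  The sum rule says that the components share their jet, and since conjugation
  maps the family \<open>(H\<^sub>k)\<close> to itself, the common derivatives are real; this is the parity condition on \<open>lam\<close>.
  The \<open>m\<close> components have equal values at \<open>0\<close> with sum \<open>m\<^sub>0(0)\<close>, whence the factor \<open>1/m\<close> and
  \<open>lam 0 = 1\<close>.
\<close>

lemma symmetric_sum_rule_mask_iff:
  fixes M :: "int^'d^'d" and m0 :: "real^'d \<Rightarrow> complex"
  assumes inv: "invertible (of_int_mat M :: real^'d^'d)" and c: "c \<in> half_int_lattice" and n: "n \<ge> 1"
    and s: "inj_on s {..<num_digits M}" "digit_set M (s ` {..<num_digits M})"
    and E: "digit_set (transpose M) E" "0 \<in> E"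
  shows "is_mask m0 \<and> symmetric_wrt c m0 \<and> sum_rule M E n m0 \<longleftrightarrow>
    (\<exists>lam H. lam 0 = 1 \<and> (\<forall>\<beta>\<in>Delta n. cnj (lam \<beta>) = (-1) ^ mi_size \<beta> * lam \<beta>) \<and>
       (\<forall>k<num_digits M. exp_sum (coset (inv_act M (of_int_vec (s k)) - inv_act M c)) (H k) \<and>
          H (partner M c s k) = (\<lambda>\<eta>. cnj (H k \<eta>)) \<and>
          has_jet n (\<lambda>\<beta>. 1 / of_nat (num_digits M) * lam \<beta>) (H k)) \<and>
       (\<forall>\<xi>. m0 \<xi> = expi c \<xi> * (\<Sum>k<num_digits M. H k (star_act M \<xi>))))"
    (is "?L \<longleftrightarrow> (\<exists>lam H. ?R lam H)")
proof -
  let ?m = "num_digits M"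
  let ?w = "2 * of_real pi * \<i> :: complex"
  define a where "a k = inv_act M (of_int_vec (s k)) - inv_act M c" for k
  define p where "p = partner M c s"
  have p_less: "p k < ?m" and p_p: "k < ?m \<Longrightarrow> p (p k) = k" for k
    using partner_props[OF inv c s] by (auto simp: p_def)
  have p_bij: "bij_betw p {..<?m} {..<?m}"
    by (rule bij_betw_byWitness[of _ p]) (auto simp: p_less p_p)
  have coset_p: "coset (a (p k)) = coset (- a k)" for k
    unfolding a_def p_def by (rule coset_partner[OF inv c s])
  have fin: "finite {..<?m}" by simp
  obtain k0 where k0: "k0 < ?m" using digit_setE[OF s(2)] by blast
  have m_nz: "of_nat ?m \<noteq> (0 :: complex)" using k0 by (simp only: of_nat_eq_0_iff)
  have star0: "star_act M 0 = 0" by (simp add: star_act_def)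
  show ?thesis
  proof
    assume ?L
    then have mask: "exp_sum (coset 0) m0" "m0 0 = 1" and sym: "symmetric_wrt c m0"
      and rule: "sum_rule M E n m0" by (auto simp: is_mask_def trig_poly_iff)
    obtain H where "\<forall>k\<in>{..<?m}. exp_sum (coset (inv_act M (of_int_vec (s k)) - inv_act M c)) (H k)"
      and m0: "\<forall>\<xi>. m0 \<xi> = expi (inv_act M c) (star_act M \<xi>) * (\<Sum>k\<in>{..<?m}. H k (star_act M \<xi>))"
      using polyphase_exists[OF inv fin s mask(1), where b = "inv_act M c"] by blast
    then have H: "exp_sum (coset (a k)) (H k)" if "k \<in> {..<?m}" for k using that by (simp add: a_def)
    have m0_c: "m0 \<xi> = expi c \<xi> * (\<Sum>k<?m. H k (star_act M \<xi>))" for \<xi>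
      using m0 by (simp add: expi_inv_act_star_act[OF inv])
    have flat: "flat n (\<lambda>\<eta>. H k \<eta> - H l \<eta>)" if "k < ?m" "l < ?m" for k l
      using sum_rule_iff[OF inv fin s E, of "inv_act M c" H m0 n] H m0 rule that by (simp add: a_def)
    have real: "(\<Sum>k<?m. H k \<eta>) = cnj (\<Sum>k<?m. H k \<eta>)" for \<eta>
    proof -
      define \<xi> where "\<xi> = inv_star_act M \<eta>"
      have st: "star_act M \<xi> = \<eta>" by (simp add: \<xi>_def star_act_inv_star_act[OF inv])
      let ?g = "\<Sum>k<?m. H k \<eta>"
      have "expi c \<xi> * ?g = expi (2 *\<^sub>R c) \<xi> * cnj (expi c \<xi> * ?g)"
        using sym[unfolded symmetric_wrt_def, rule_format, of \<xi>] unfolding m0_c st .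
      also have "\<dots> = (expi c \<xi> * (expi c \<xi> * expi (- c) \<xi>)) * cnj ?g"
        by (simp only: scaleR_2 expi_add complex_cnj_mult cnj_expi mult_ac)
      also have "\<dots> = expi c \<xi> * cnj ?g" by simp
      finally have "expi (- c) \<xi> * (expi c \<xi> * ?g) = expi (- c) \<xi> * (expi c \<xi> * cnj ?g)" by simp
      then show ?thesis by (simp flip: mult.assoc)
    qed
    have pH: "H (p k) = (\<lambda>\<eta>. cnj (H k \<eta>))" if k: "k < ?m" for k
    proof -
      have c1: "exp_sum (coset (a l)) (\<lambda>\<eta>. cnj (H (p l) \<eta>))" if "l \<in> {..<?m}" for l
        using exp_sum_coset_cnj[OF H[of "p l"]] coset_p[of "p l"] p_p[of l] that p_less by simp
      have "(\<Sum>l<?m. H l \<eta>) = (\<Sum>l<?m. cnj (H (p l) \<eta>))" for \<eta>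
        using real[of \<eta>] sum.reindex_bij_betw[OF p_bij, of "\<lambda>l. cnj (H l \<eta>)"] by simp
      then have "H (p k) = (\<lambda>\<eta>. cnj (H (p (p k)) \<eta>))"
        using polyphase_unique[OF inv fin s E(1), of "inv_act M c" H "\<lambda>l \<eta>. cnj (H (p l) \<eta>)" "p k"]
          H c1 p_less by (simp add: a_def)
      then show ?thesis by (simp add: p_p k)
    qed
    have jets: "mi_deriv \<beta> (H k) 0 = mi_deriv \<beta> (H k0) 0" if "k < ?m" "\<beta> \<in> Delta n" for k \<beta>
      using flat[OF that(1) k0] flat_diff_iff[OF H H, of k k0 n] that k0 by simp
    (* All components have the same jet, so any fixed one defines lam. *)
    define lam where "lam \<beta> = of_nat ?m * mi_deriv \<beta> (H k0) 0 / ?w ^ mi_size \<beta>" for \<beta>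
    have zero: "0 \<in> (Delta n :: (nat^'d) set)" using n by (simp add: Delta_def)
    have "1 = (\<Sum>k<?m. H k 0)" using m0_c[of 0] mask(2) by (simp add: star0)
    also have "\<dots> = (\<Sum>k<?m. H k0 0)"
      using jets[OF _ zero] by (intro sum.cong refl) (simp add: mi_deriv_0)
    finally have "lam 0 = 1" by (simp add: lam_def mi_deriv_0)
    moreover have "cnj (lam \<beta>) = (-1) ^ mi_size \<beta> * lam \<beta>" if b: "\<beta> \<in> Delta n" for \<beta>
    proof -
      have "cnj (mi_deriv \<beta> (H k0) 0) = mi_deriv \<beta> (H (p k0)) 0"
        using k0 by (simp add: pH mi_deriv_cnj[OF H])
      also have "\<dots> = mi_deriv \<beta> (H k0) 0" by (rule jets[OF p_less b])
      finally have "cnj (mi_deriv \<beta> (H k0) 0) = mi_deriv \<beta> (H k0) 0" .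
      then have "cnj (lam \<beta>) = of_nat ?m * mi_deriv \<beta> (H k0) 0 / (?w ^ mi_size \<beta> * (-1) ^ mi_size \<beta>)"
        by (simp only: lam_def complex_cnj_mult complex_cnj_divide complex_cnj_of_nat cnj_two_pi_i_power)
      also have "\<dots> = (-1) ^ mi_size \<beta> * lam \<beta>"
        by (cases "even (mi_size \<beta>)") (simp_all add: lam_def)
      finally show ?thesis .
    qed
    moreover have "has_jet n (\<lambda>\<beta>. 1 / of_nat ?m * lam \<beta>) (H k)" if "k < ?m" for k
      unfolding has_jet_def
    proof
      fix \<beta> :: "nat^'d" assume "\<beta> \<in> Delta n"
      then show "mi_deriv \<beta> (H k) 0 = ?w ^ mi_size \<beta> * (1 / of_nat ?m * lam \<beta>)"
        using m_nz unfolding jets[OF that \<open>\<beta> \<in> Delta n\<close>] lam_def by (simp del: of_nat_nat)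
    qed
    ultimately have "?R lam H" using H pH m0_c by (auto simp: a_def p_def)
    then show "\<exists>lam H. ?R lam H" by blast
  next
    assume "\<exists>lam H. ?R lam H"
    then obtain lam H where lam: "lam 0 = 1"
      and H: "\<And>k. k < ?m \<Longrightarrow> exp_sum (coset (a k)) (H k)" and pH: "\<And>k. k < ?m \<Longrightarrow> H (p k) = (\<lambda>\<eta>. cnj (H k \<eta>))"
      and jet: "\<And>k. k < ?m \<Longrightarrow> has_jet n (\<lambda>\<beta>. 1 / of_nat ?m * lam \<beta>) (H k)"
      and m0: "\<And>\<xi>. m0 \<xi> = expi c \<xi> * (\<Sum>k<?m. H k (star_act M \<xi>))"
      unfolding a_def p_def by blast
    have zero: "0 \<in> (Delta n :: (nat^'d) set)" using n by (simp add: Delta_def)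
    have "exp_sum (coset 0) m0"
    proof -
      have "exp_sum (coset 0) (\<lambda>\<xi>. \<Sum>k<?m. expi c \<xi> * H k (star_act M \<xi>))"
        using H by (intro exp_sum_sum exp_sum_polyphase_term[OF inv]) (auto simp: a_def)
      then show ?thesis by (simp add: m0[abs_def] sum_distrib_left)
    qed
    moreover have "m0 0 = 1"
    proof -
      have "H k 0 = 1 / of_nat ?m" if "k < ?m" for k
        using jet[OF that] zero lam unfolding has_jet_def by (force simp: mi_deriv_0)
      then have "m0 0 = (\<Sum>k<?m. 1 / of_nat ?m)" by (simp add: m0 star0)
      also have "\<dots> = 1" using m_nz by (simp only: sum_constant card_lessThan) simp
      finally show ?thesis .
    qed
    moreover have "symmetric_wrt c m0"
      unfolding symmetric_wrt_def
    proof
      fix \<xi>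
      let ?g = "\<Sum>k<?m. H k (star_act M \<xi>)"
      have "cnj ?g = (\<Sum>k<?m. H (p k) (star_act M \<xi>))" by (simp add: pH)
      also have "\<dots> = ?g" by (rule sum.reindex_bij_betw[OF p_bij])
      finally have g: "cnj ?g = ?g" .
      have "expi (2 *\<^sub>R c) \<xi> * cnj (m0 \<xi>) = (expi c \<xi> * (expi c \<xi> * expi (- c) \<xi>)) * cnj ?g"
        unfolding m0 by (simp only: scaleR_2 expi_add complex_cnj_mult cnj_expi mult_ac)
      also have "\<dots> = m0 \<xi>" unfolding g by (simp add: m0)
      finally show "m0 \<xi> = expi (2 *\<^sub>R c) \<xi> * cnj (m0 \<xi>)" ..
    qed
    moreover have "flat n (\<lambda>\<eta>. H k \<eta> - H l \<eta>)" if "k < ?m" "l < ?m" for k l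
      using jet[OF that(1)] flat_diff_has_jet[OF H[OF that(1)] H[OF that(2)] jet[OF that(2)]] by blast
    then have "sum_rule M E n m0"
      using sum_rule_iff[OF inv fin s E, of "inv_act M c" H m0 n] H m0
      by (simp add: a_def expi_inv_act_star_act[OF inv])
    ultimately show ?L by (simp add: is_mask_def trig_poly_iff)
  qed
qed

section \<open>The general form\<close>

lemma cnj_taylor_shift: "cnj (taylor_shift l y \<beta>) = taylor_shift (\<lambda>\<gamma>. cnj (l \<gamma>)) y \<beta>"
  by (simp add: taylor_shift_def)

text \<open>
  Factoring \<open>expi c\<close> out of the general form leaves one component per digit: the summands with
  \<open>expi (s\<^sub>i)\<close> form a component \<open>Z\<close> and those with \<open>expi (2c - s\<^sub>i)\<close> its conjugate, because
  \<open>expi (2c - s\<^sub>i) = expi c \<cdot> cnj (expi (s\<^sub>i - c))\<close>.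
\<close>

lemma general_form_eq:
  fixes M :: "int^'d^'d" and c :: "real^'d"
  assumes inv: "invertible (of_int_mat M :: real^'d^'d)"
  shows "m0_star M c n s I1 G GB lam \<xi>
        + expi c \<xi> * (\<Sum>j\<in>J_set M c s. \<Sum>\<alpha>\<in>{\<alpha>. mi_size \<alpha> = n}.
            A \<alpha> j (star_act M \<xi>) * of_real (Re (Pi_mi \<alpha> (star_act M \<xi>)))
          + B \<alpha> j (star_act M \<xi>) * of_real (Im (Pi_mi \<alpha> (star_act M \<xi>))))
        + (\<Sum>i\<in>I1. \<Sum>\<alpha>\<in>{\<alpha>. mi_size \<alpha> = n}.
            T \<alpha> i (star_act M \<xi>) * Pi_mi \<alpha> (star_act M \<xi>) * expi (of_int_vec (s i)) \<xi>
          + cnj (T \<alpha> i (star_act M \<xi>) * Pi_mi \<alpha> (star_act M \<xi>))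
              * expi (2 *\<^sub>R c - of_int_vec (s i)) \<xi>) =
    expi c \<xi> *
      ((\<Sum>j\<in>J_set M c s. self_phase n (1 / of_nat (num_digits M)) lam
          (\<lambda>\<beta>. GB \<beta> j) (\<lambda>\<alpha>. A \<alpha> j) (\<lambda>\<alpha>. B \<alpha> j) (star_act M \<xi>)) +
       (\<Sum>i\<in>I1. let Z = free_phase n (1 / of_nat (num_digits M))
            (taylor_shift lam (inv_act M c - inv_act M (of_int_vec (s i)))) (\<lambda>\<beta>. G \<beta> i) (\<lambda>\<alpha>. T \<alpha> i) (star_act M \<xi>) *
            expi (inv_act M (of_int_vec (s i)) - inv_act M c) (star_act M \<xi>)
          in Z + cnj Z))"
proof -
  define \<eta> where "\<eta> = star_act M \<xi>"
  define C where "C = expi c \<xi>"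
  define z :: complex where "z = 1 / of_nat (num_digits M)"
  have cnj_z: "cnj z = z" by (simp add: z_def)
  define e where "e i = expi (inv_act M (of_int_vec (s i)) - inv_act M c) \<eta>" for i
  have e: "e i = expi (of_int_vec (s i) - c) \<xi>" for i
    unfolding e_def \<eta>_def by (simp only: expi_inv_act_star_act[OF inv] flip: inv_act_diff)
  have E1: "expi (of_int_vec (s i)) \<xi> = C * e i" for i
    unfolding C_def e expi_add[symmetric] by simp
  have E2: "expi (2 *\<^sub>R c - of_int_vec (s i)) \<xi> = C * cnj (e i)" for i
    unfolding C_def e cnj_expi expi_add[symmetric] by (simp only: scaleR_2) (simp add: algebra_simps)
  define k where "k i = taylor_shift lam (inv_act M c - inv_act M (of_int_vec (s i)))" for i
  have J: "z * (\<Sum>j\<in>J_set M c s. \<Sum>\<beta>\<in>Delta n. lam \<beta> * GB \<beta> j \<eta> * C) +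
      C * (\<Sum>j\<in>J_set M c s. \<Sum>\<alpha>\<in>{\<alpha>. mi_size \<alpha> = n}. A \<alpha> j \<eta> * of_real (Re (Pi_mi \<alpha> \<eta>)) + B \<alpha> j \<eta> * of_real (Im (Pi_mi \<alpha> \<eta>))) =
      C * (\<Sum>j\<in>J_set M c s. self_phase n z lam (\<lambda>\<beta>. GB \<beta> j) (\<lambda>\<alpha>. A \<alpha> j) (\<lambda>\<alpha>. B \<alpha> j) \<eta>)"
    unfolding self_phase_def sum.distrib[of _ _ "J_set M c s"]
    by (simp only: sum_distrib_right[symmetric] sum_distrib_left[symmetric] distrib_left mult_ac)
  have I: "z * ((\<Sum>\<beta>\<in>Delta n. k i \<beta> * G \<beta> i \<eta> * (C * e i)) +
         (\<Sum>\<beta>\<in>Delta n. cnj (k i \<beta>) * cnj (G \<beta> i \<eta>) * (C * cnj (e i)))) +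
      (\<Sum>\<alpha>\<in>{\<alpha>. mi_size \<alpha> = n}. T \<alpha> i \<eta> * Pi_mi \<alpha> \<eta> * (C * e i) +
         cnj (T \<alpha> i \<eta> * Pi_mi \<alpha> \<eta>) * (C * cnj (e i))) =
      C * (let Z = free_phase n z (k i) (\<lambda>\<beta>. G \<beta> i) (\<lambda>\<alpha>. T \<alpha> i) \<eta> * e i in Z + cnj Z)" for i
  proof -
    define S where "S = (\<Sum>\<beta>\<in>Delta n. k i \<beta> * G \<beta> i \<eta>)"
    define P where "P = (\<Sum>\<alpha>\<in>{\<alpha>. mi_size \<alpha> = n}. T \<alpha> i \<eta> * Pi_mi \<alpha> \<eta>)"
    have "(\<Sum>\<beta>\<in>Delta n. k i \<beta> * G \<beta> i \<eta> * (C * e i)) = S * (C * e i)"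
      "(\<Sum>\<beta>\<in>Delta n. cnj (k i \<beta>) * cnj (G \<beta> i \<eta>) * (C * cnj (e i))) = cnj S * (C * cnj (e i))"
      by (simp_all add: S_def sum_distrib_right)
    moreover have "(\<Sum>\<alpha>\<in>{\<alpha>. mi_size \<alpha> = n}. T \<alpha> i \<eta> * Pi_mi \<alpha> \<eta> * (C * e i) +
         cnj (T \<alpha> i \<eta> * Pi_mi \<alpha> \<eta>) * (C * cnj (e i))) = P * (C * e i) + cnj P * (C * cnj (e i))"
      by (simp add: P_def sum_distrib_right sum.distrib)
    moreover have "free_phase n z (k i) (\<lambda>\<beta>. G \<beta> i) (\<lambda>\<alpha>. T \<alpha> i) \<eta> = z * S + P"
      by (simp add: free_phase_def S_def P_def)
    ultimately show ?thesis by (simp only: Let_def) (simp add: cnj_z algebra_simps)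
  qed
  have star: "m0_star M c n s I1 G GB lam \<xi> =
      z * (\<Sum>j\<in>J_set M c s. \<Sum>\<beta>\<in>Delta n. lam \<beta> * GB \<beta> j \<eta> * C) +
      z * (\<Sum>i\<in>I1. (\<Sum>\<beta>\<in>Delta n. k i \<beta> * G \<beta> i \<eta> * (C * e i)) +
         (\<Sum>\<beta>\<in>Delta n. cnj (k i \<beta>) * cnj (G \<beta> i \<eta>) * (C * cnj (e i))))"
    unfolding m0_star_def k_def cnj_taylor_shift
    unfolding taylor_shift_def z_def E1 E2 \<eta>_def C_def[symmetric] ..
  have I': "z * (\<Sum>i\<in>I1. (\<Sum>\<beta>\<in>Delta n. k i \<beta> * G \<beta> i \<eta> * (C * e i)) +
         (\<Sum>\<beta>\<in>Delta n. cnj (k i \<beta>) * cnj (G \<beta> i \<eta>) * (C * cnj (e i)))) +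
      (\<Sum>i\<in>I1. \<Sum>\<alpha>\<in>{\<alpha>. mi_size \<alpha> = n}. T \<alpha> i \<eta> * Pi_mi \<alpha> \<eta> * (C * e i) +
         cnj (T \<alpha> i \<eta> * Pi_mi \<alpha> \<eta>) * (C * cnj (e i))) =
      C * (\<Sum>i\<in>I1. let Z = free_phase n z (k i) (\<lambda>\<beta>. G \<beta> i) (\<lambda>\<alpha>. T \<alpha> i) \<eta> * e i in Z + cnj Z)"
    unfolding sum_distrib_left[of z] sum_distrib_left[of C] sum.distrib[where A = I1, symmetric]
    by (intro sum.cong refl I)
  show ?thesis
    unfolding star E1 E2 \<eta>_def[symmetric] C_def[symmetric] z_def[symmetric] e_def[symmetric] k_def[symmetric]
      distrib_left[of C] J[symmetric] I'[symmetric]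
    by (simp only: add_ac)
qed

theorem theorem17:
  fixes M :: "int^'d^'d" and c :: "real^'d" and n :: nat
    and s :: "nat \<Rightarrow> int^'d" and Dstar :: "(int^'d) set"
    and I1 I2 :: "nat set"
    and G GB :: "nat^'d \<Rightarrow> nat \<Rightarrow> real^'d \<Rightarrow> complex"
    and m0 :: "real^'d \<Rightarrow> complex"
  assumes "matrix_dilation M"
    and "c \<in> half_int_lattice"
    and "n \<ge> 1"
    and "inj_on s {..<num_digits M}" and "digit_set M (s ` {..<num_digits M})"
    and "\<forall>i\<in>I_set M c s. of_int_vec (s i) + of_int_vec (s (partner M c s i)) = 2 *\<^sub>R c"
    and "digit_set (transpose M) Dstar" and "0 \<in> Dstar"
    and "I1 \<union> I2 = I_set M c s" and "I1 \<inter> I2 = {}"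
    and "\<forall>i\<in>I_set M c s. i \<in> I1 \<longleftrightarrow> partner M c s i \<in> I2"
    and "\<forall>\<beta>\<in>Delta n. \<forall>i\<in>I1. trig_poly (G \<beta> i) \<and> G \<beta> i \<in> Theta \<beta> n"
    and "\<forall>\<beta>\<in>Delta n. \<forall>j\<in>J_set M c s.
           semi_trig_poly (digit_sigma M c s j) (GB \<beta> j) \<and> GB \<beta> j \<in> ThetaB \<beta> n"
  shows "(is_mask m0 \<and> symmetric_wrt c m0 \<and> sum_rule M Dstar n m0) \<longleftrightarrow>
    (\<exists>(lam :: nat^'d \<Rightarrow> complex)
      (A :: nat^'d \<Rightarrow> nat \<Rightarrow> real^'d \<Rightarrow> complex)
      (B :: nat^'d \<Rightarrow> nat \<Rightarrow> real^'d \<Rightarrow> complex)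
      (T :: nat^'d \<Rightarrow> nat \<Rightarrow> real^'d \<Rightarrow> complex).
       lam 0 = 1 \<and>
       (\<forall>\<alpha>\<in>Delta n. (odd (mi_size \<alpha>) \<longrightarrow> Re (lam \<alpha>) = 0) \<and>
                    (even (mi_size \<alpha>) \<longrightarrow> Im (lam \<alpha>) = 0)) \<and>
       (\<forall>\<alpha>. mi_size \<alpha> = n \<longrightarrow> (\<forall>j\<in>J_set M c s.
          semi_trig_poly (digit_sigma M c s j) (A \<alpha> j) \<and> (\<forall>\<xi>. A \<alpha> j \<xi> \<in> \<real>) \<and>
          semi_trig_poly (digit_sigma M c s j) (B \<alpha> j) \<and> (\<forall>\<xi>. B \<alpha> j \<xi> \<in> \<real>))) \<and>
       (\<forall>\<alpha>. mi_size \<alpha> = n \<longrightarrow> (\<forall>i\<in>I1. trig_poly (T \<alpha> i))) \<and>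
       (\<forall>\<xi>. m0 \<xi> =
          m0_star M c n s I1 G GB lam \<xi>
        + expi c \<xi> * (\<Sum>j\<in>J_set M c s. \<Sum>\<alpha>\<in>{\<alpha>. mi_size \<alpha> = n}.
            A \<alpha> j (star_act M \<xi>) * of_real (Re (Pi_mi \<alpha> (star_act M \<xi>)))
          + B \<alpha> j (star_act M \<xi>) * of_real (Im (Pi_mi \<alpha> (star_act M \<xi>))))
        + (\<Sum>i\<in>I1. \<Sum>\<alpha>\<in>{\<alpha>. mi_size \<alpha> = n}.
            T \<alpha> i (star_act M \<xi>) * Pi_mi \<alpha> (star_act M \<xi>) * expi (of_int_vec (s i)) \<xi>
          + cnj (T \<alpha> i (star_act M \<xi>) * Pi_mi \<alpha> (star_act M \<xi>))
              * expi (2 *\<^sub>R c - of_int_vec (s i)) \<xi>)))"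
proof -
  let ?m = "num_digits M"
  let ?z = "1 / of_nat (num_digits M) :: complex"
  let ?J = "J_set M c s" and ?I = "I_set M c s"
  have inv: "invertible (of_int_mat M :: real^'d^'d)" using assms(1) by (rule matrix_dilation_invertible)
  note c = assms(2) and s = assms(4,5)
  define p where "p = partner M c s"
  define a where "a k = inv_act M (of_int_vec (s k)) - inv_act M c" for k
  define y where "y k = inv_act M c - inv_act M (of_int_vec (s k))" for k
  have a_y: "a k + y k = 0" "y k + a k = 0" for k by (simp_all add: a_def y_def)
  have p_less: "p k < ?m" and p_p: "k < ?m \<Longrightarrow> p (p k) = k" for k
    using partner_props[OF inv c s] by (auto simp: p_def)
  have coset_p: "coset (a (p k)) = coset (- a k)" for k
    unfolding a_def p_def by (rule coset_partner[OF inv c s])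
  have J_iff: "k \<in> ?J \<longleftrightarrow> k < ?m \<and> p k = k" and I_iff: "k \<in> ?I \<longleftrightarrow> k < ?m \<and> p k \<noteq> k" for k
    by (auto simp: J_set_def I_set_def p_def)
  have I1: "I1 \<subseteq> ?I" and I12: "k \<in> ?I \<Longrightarrow> k \<in> I2 \<longleftrightarrow> k \<notin> I1" for k
    using assms(9,10) by auto
  have p_I: "p k \<in> ?I" if "k \<in> ?I" for k using that p_less p_p[of k] by (auto simp: I_iff)
  have p_I1: "p k \<in> I1 \<longleftrightarrow> k \<notin> I1" if "k \<in> ?I" for k
    using assms(11) that p_I[OF that] I12[of "p k"] by (auto simp: p_def)
  (* Each pair of partners is represented once in I1. *)
  have sum_split: "(\<Sum>k<?m. F k) = (\<Sum>j\<in>?J. F j) + (\<Sum>i\<in>I1. F i + F (p i))" for F :: "nat \<Rightarrow> complex"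
  proof -
    have fin: "finite ?J" "finite ?I" "finite I1"
      using finite_subset[OF I1] by (auto simp: J_set_def I_set_def)
    have "{..<?m} = ?J \<union> ?I" "?J \<inter> ?I = {}" by (auto simp: J_iff I_iff)
    then have "(\<Sum>k<?m. F k) = sum F ?J + sum F ?I" using fin by (simp add: sum.union_disjoint)
    also have "sum F ?I = sum F I1 + sum F (?I - I1)"
      using sum.subset_diff[OF I1 fin(2), of F] by simp
    also have "sum F (?I - I1) = (\<Sum>i\<in>I1. F (p i))"
    proof (rule sum.reindex_bij_witness[of _ p p])
      fix k assume "k \<in> ?I - I1"
      then show "p (p k) = k" "p k \<in> I1" "F (p (p k)) = F k" using p_p[of k] p_I1[of k] by (auto simp: I_iff)
    next
      fix k assume "k \<in> I1"
      then show "p (p k) = k" "p k \<in> ?I - I1" using I1 p_p[of k] p_I1[of k] p_I[of k] by (auto simp: I_iff)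
    qed
    finally show ?thesis by (simp add: sum.distrib)
  qed
  have z_real: "?z \<in> \<real>" by simp
  have G: "exp_sum (coset 0) (G \<beta> i)" "G \<beta> i \<in> Theta \<beta> n" if "i \<in> I1" "\<beta> \<in> Delta n" for \<beta> i
    using assms(12) that by (auto simp: trig_poly_iff)
  have GB: "exp_sum (coset (digit_sigma M c s j)) (GB \<beta> j)" "GB \<beta> j \<in> ThetaB \<beta> n" if "j \<in> ?J" "\<beta> \<in> Delta n" for \<beta> j
    using assms(13) that digit_sigma_props(1)[OF inv c s] by blast+
  have coset_J: "coset (a j) = coset (digit_sigma M c s j)" if "j \<in> ?J" for j
    unfolding a_def by (rule digit_sigma_props(3)[OF inv c s that])
  note semi = digit_sigma_props(1)[OF inv c s]
  define SP where "SP lam A B j = self_phase n ?z lam (\<lambda>\<beta>. GB \<beta> j) (\<lambda>\<alpha>. A \<alpha> j) (\<lambda>\<alpha>. B \<alpha> j)"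
    for lam :: "nat^'d \<Rightarrow> complex" and A B :: "nat^'d \<Rightarrow> nat \<Rightarrow> real^'d \<Rightarrow> complex" and j
  define FP where "FP lam T i = free_phase n ?z (taylor_shift lam (y i)) (\<lambda>\<beta>. G \<beta> i) (\<lambda>\<alpha>. T \<alpha> i)"
    for lam :: "nat^'d \<Rightarrow> complex" and T :: "nat^'d \<Rightarrow> nat \<Rightarrow> real^'d \<Rightarrow> complex" and i
  define ZP where "ZP lam T i = (\<lambda>\<eta>. FP lam T i \<eta> * expi (a i) \<eta>)"
    for lam :: "nat^'d \<Rightarrow> complex" and T :: "nat^'d \<Rightarrow> nat \<Rightarrow> real^'d \<Rightarrow> complex" and i
  have parity: "((odd (mi_size \<alpha>) \<longrightarrow> Re (lam \<alpha>) = 0) \<and> (even (mi_size \<alpha>) \<longrightarrow> Im (lam \<alpha>) = 0)) \<longleftrightarrow>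
      cnj (lam \<alpha>) = (-1) ^ mi_size \<alpha> * lam \<alpha>" for lam and \<alpha> :: "nat^'d"
    by (simp only: cnj_eq_sign_iff)
  have form: "(m0_star M c n s I1 G GB lam \<xi>
        + expi c \<xi> * (\<Sum>j\<in>J_set M c s. \<Sum>\<alpha>\<in>{\<alpha>. mi_size \<alpha> = n}.
            A \<alpha> j (star_act M \<xi>) * of_real (Re (Pi_mi \<alpha> (star_act M \<xi>)))
          + B \<alpha> j (star_act M \<xi>) * of_real (Im (Pi_mi \<alpha> (star_act M \<xi>))))
        + (\<Sum>i\<in>I1. \<Sum>\<alpha>\<in>{\<alpha>. mi_size \<alpha> = n}.
            T \<alpha> i (star_act M \<xi>) * Pi_mi \<alpha> (star_act M \<xi>) * expi (of_int_vec (s i)) \<xi>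
          + cnj (T \<alpha> i (star_act M \<xi>) * Pi_mi \<alpha> (star_act M \<xi>))
              * expi (2 *\<^sub>R c - of_int_vec (s i)) \<xi>)) =
      expi c \<xi> * ((\<Sum>j\<in>?J. SP lam A B j (star_act M \<xi>)) +
        (\<Sum>i\<in>I1. ZP lam T i (star_act M \<xi>) + cnj (ZP lam T i (star_act M \<xi>))))" for lam A B T \<xi>
    unfolding general_form_eq[OF inv] SP_def ZP_def FP_def a_def y_def Let_def ..
  show ?thesis
    unfolding symmetric_sum_rule_mask_iff[OF inv c assms(3) s assms(7,8)] form parity
      p_def[symmetric] a_def[symmetric]
  proof (intro iffI; elim exE conjE)
    fix lam :: "nat^'d \<Rightarrow> complex" and H :: "nat \<Rightarrow> real^'d \<Rightarrow> complex"
    assume lam: "lam 0 = 1" "\<forall>\<beta>\<in>Delta n. cnj (lam \<beta>) = (-1) ^ mi_size \<beta> * lam \<beta>"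
      and H: "\<forall>k<?m. exp_sum (coset (a k)) (H k) \<and> H (p k) = (\<lambda>\<eta>. cnj (H k \<eta>)) \<and>
          has_jet n (\<lambda>\<beta>. ?z * lam \<beta>) (H k)"
      and m0: "\<forall>\<xi>. m0 \<xi> = expi c \<xi> * (\<Sum>k<?m. H k (star_act M \<xi>))"
    have "\<exists>A B. (\<forall>\<alpha>. mi_size \<alpha> = n \<longrightarrow> exp_sum (coset (digit_sigma M c s j)) (A \<alpha>) \<and> (\<forall>\<eta>. A \<alpha> \<eta> \<in> \<real>) \<and>
       exp_sum (coset (digit_sigma M c s j)) (B \<alpha>) \<and> (\<forall>\<eta>. B \<alpha> \<eta> \<in> \<real>)) \<and>
       H j = self_phase n ?z lam (\<lambda>\<beta>. GB \<beta> j) A B" if j: "j \<in> ?J" for j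
    proof -
      have "H j = (\<lambda>\<eta>. cnj (H j \<eta>))" "j < ?m" using H j by (auto simp: J_iff)
      then have "\<forall>\<eta>. H j \<eta> \<in> \<real>" by (metis Reals_cnj_iff)
      moreover have "exp_sum (coset (digit_sigma M c s j)) (H j)" "has_jet n (\<lambda>\<beta>. ?z * lam \<beta>) (H j)"
        using H \<open>j < ?m\<close> coset_J[OF j] by auto
      ultimately show ?thesis
        using self_phase_iff[of n "digit_sigma M c s j" "\<lambda>\<beta>. GB \<beta> j" lam ?z "H j"]
          GB[OF j] lam(2) z_real digit_sigma_props(2)[OF inv c s j] by blast
    qed
    then obtain A B where AB: "\<And>j. j \<in> ?J \<Longrightarrow> (\<forall>\<alpha>. mi_size \<alpha> = n \<longrightarrow>
        exp_sum (coset (digit_sigma M c s j)) (A j \<alpha>) \<and> (\<forall>\<eta>. A j \<alpha> \<eta> \<in> \<real>) \<and>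
        exp_sum (coset (digit_sigma M c s j)) (B j \<alpha>) \<and> (\<forall>\<eta>. B j \<alpha> \<eta> \<in> \<real>)) \<and>
        H j = self_phase n ?z lam (\<lambda>\<beta>. GB \<beta> j) (A j) (B j)"
      by metis
    have "\<exists>T. (\<forall>\<alpha>. mi_size \<alpha> = n \<longrightarrow> exp_sum (coset 0) (T \<alpha>)) \<and>
       (\<lambda>\<eta>. H i \<eta> * expi (y i) \<eta>) = free_phase n ?z (taylor_shift lam (y i)) (\<lambda>\<beta>. G \<beta> i) T" if i: "i \<in> I1" for i
    proof -
      have Hi: "exp_sum (coset (a i)) (H i)" "has_jet n (\<lambda>\<beta>. ?z * lam \<beta>) (H i)"
        using H i I1 by (auto simp: I_iff)
      have "exp_sum (coset 0) (\<lambda>\<eta>. H i \<eta> * expi (y i) \<eta>)"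
        using exp_sum_coset_mult[OF Hi(1) exp_sum_coset_expi[of "y i"]] by (simp add: a_y)
      moreover have "has_jet n (\<lambda>\<beta>. ?z * taylor_shift lam (y i) \<beta>) (\<lambda>\<eta>. H i \<eta> * expi (y i) \<eta>)"
        using has_jet_expi_mult[OF Hi, of "y i"] by (simp only: taylor_shift_cmult has_jet_def)
      ultimately show ?thesis
        using free_phase_iff[of n "\<lambda>\<beta>. G \<beta> i" "\<lambda>\<eta>. H i \<eta> * expi (y i) \<eta>" ?z "taylor_shift lam (y i)"] G[OF i]
        by blast
    qed
    then obtain T where T: "\<And>i. i \<in> I1 \<Longrightarrow> (\<forall>\<alpha>. mi_size \<alpha> = n \<longrightarrow> exp_sum (coset 0) (T i \<alpha>)) \<and>
       (\<lambda>\<eta>. H i \<eta> * expi (y i) \<eta>) = free_phase n ?z (taylor_shift lam (y i)) (\<lambda>\<beta>. G \<beta> i) (T i)"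
      by metis
    have ZP: "H i = ZP lam (\<lambda>\<alpha> i. T i \<alpha>) i" if "i \<in> I1" for i
    proof -
      have "FP lam (\<lambda>\<alpha> i. T i \<alpha>) i = (\<lambda>\<eta>. H i \<eta> * expi (y i) \<eta>)"
        using T[OF that] by (simp add: FP_def)
      then show ?thesis by (simp add: ZP_def mult.assoc a_y flip: expi_add)
    qed
    have "m0 \<xi> = expi c \<xi> * ((\<Sum>j\<in>?J. SP lam (\<lambda>\<alpha> j. A j \<alpha>) (\<lambda>\<alpha> j. B j \<alpha>) j (star_act M \<xi>)) +
        (\<Sum>i\<in>I1. ZP lam (\<lambda>\<alpha> i. T i \<alpha>) i (star_act M \<xi>) + cnj (ZP lam (\<lambda>\<alpha> i. T i \<alpha>) i (star_act M \<xi>))))" for \<xi>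
    proof -
      have "(\<Sum>j\<in>?J. H j (star_act M \<xi>)) = (\<Sum>j\<in>?J. SP lam (\<lambda>\<alpha> j. A j \<alpha>) (\<lambda>\<alpha> j. B j \<alpha>) j (star_act M \<xi>))"
      proof (intro sum.cong refl)
        fix j assume "j \<in> ?J"
        from AB[OF this] have "H j = self_phase n ?z lam (\<lambda>\<beta>. GB \<beta> j) (A j) (B j)" by blast
        then show "H j (star_act M \<xi>) = SP lam (\<lambda>\<alpha> j. A j \<alpha>) (\<lambda>\<alpha> j. B j \<alpha>) j (star_act M \<xi>)"
          by (simp only: SP_def)
      qed
      moreover have "(\<Sum>i\<in>I1. H i (star_act M \<xi>) + H (p i) (star_act M \<xi>)) =
         (\<Sum>i\<in>I1. ZP lam (\<lambda>\<alpha> i. T i \<alpha>) i (star_act M \<xi>) + cnj (ZP lam (\<lambda>\<alpha> i. T i \<alpha>) i (star_act M \<xi>)))"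
      proof (intro sum.cong refl)
        fix i assume i: "i \<in> I1"
        then have "H (p i) = (\<lambda>\<eta>. cnj (H i \<eta>))" using H I1 by (auto simp: I_iff)
        then show "H i (star_act M \<xi>) + H (p i) (star_act M \<xi>) =
          ZP lam (\<lambda>\<alpha> i. T i \<alpha>) i (star_act M \<xi>) + cnj (ZP lam (\<lambda>\<alpha> i. T i \<alpha>) i (star_act M \<xi>))"
          by (simp only: ZP[OF i])
      qed
      ultimately show ?thesis
        using m0 sum_split[of "\<lambda>k. H k (star_act M \<xi>)"] by simp
    qed
    then show "\<exists>lam A B T. lam 0 = 1 \<and> (\<forall>\<alpha>\<in>Delta n. cnj (lam \<alpha>) = (-1) ^ mi_size \<alpha> * lam \<alpha>) \<and>
       (\<forall>\<alpha>. mi_size \<alpha> = n \<longrightarrow> (\<forall>j\<in>?J.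
          semi_trig_poly (digit_sigma M c s j) (A \<alpha> j) \<and> (\<forall>\<xi>. A \<alpha> j \<xi> \<in> \<real>) \<and>
          semi_trig_poly (digit_sigma M c s j) (B \<alpha> j) \<and> (\<forall>\<xi>. B \<alpha> j \<xi> \<in> \<real>))) \<and>
       (\<forall>\<alpha>. mi_size \<alpha> = n \<longrightarrow> (\<forall>i\<in>I1. trig_poly (T \<alpha> i))) \<and>
       (\<forall>\<xi>. m0 \<xi> = expi c \<xi> * ((\<Sum>j\<in>?J. SP lam A B j (star_act M \<xi>)) +
        (\<Sum>i\<in>I1. ZP lam T i (star_act M \<xi>) + cnj (ZP lam T i (star_act M \<xi>)))))"
      using lam AB T
      by (intro exI[of _ lam] exI[of _ "\<lambda>\<alpha> j. A j \<alpha>"] exI[of _ "\<lambda>\<alpha> j. B j \<alpha>"] exI[of _ "\<lambda>\<alpha> i. T i \<alpha>"])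
         (simp add: semi trig_poly_iff)
  next
    fix lam :: "nat^'d \<Rightarrow> complex" and A B T :: "nat^'d \<Rightarrow> nat \<Rightarrow> real^'d \<Rightarrow> complex"
    assume lam: "lam 0 = 1" "\<forall>\<beta>\<in>Delta n. cnj (lam \<beta>) = (-1) ^ mi_size \<beta> * lam \<beta>"
      and AB: "\<forall>\<alpha>. mi_size \<alpha> = n \<longrightarrow> (\<forall>j\<in>?J.
          semi_trig_poly (digit_sigma M c s j) (A \<alpha> j) \<and> (\<forall>\<xi>. A \<alpha> j \<xi> \<in> \<real>) \<and>
          semi_trig_poly (digit_sigma M c s j) (B \<alpha> j) \<and> (\<forall>\<xi>. B \<alpha> j \<xi> \<in> \<real>))"
      and T: "\<forall>\<alpha>. mi_size \<alpha> = n \<longrightarrow> (\<forall>i\<in>I1. trig_poly (T \<alpha> i))"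
      and m0: "\<forall>\<xi>. m0 \<xi> = expi c \<xi> * ((\<Sum>j\<in>?J. SP lam A B j (star_act M \<xi>)) +
        (\<Sum>i\<in>I1. ZP lam T i (star_act M \<xi>) + cnj (ZP lam T i (star_act M \<xi>))))"
    have SP: "exp_sum (coset (a j)) (SP lam A B j)" "\<forall>\<eta>. SP lam A B j \<eta> \<in> \<real>"
      "has_jet n (\<lambda>\<beta>. ?z * lam \<beta>) (SP lam A B j)" if j: "j \<in> ?J" for j
    proof -
      have "\<forall>\<alpha>. mi_size \<alpha> = n \<longrightarrow> exp_sum (coset (digit_sigma M c s j)) (A \<alpha> j) \<and> (\<forall>\<eta>. A \<alpha> j \<eta> \<in> \<real>) \<and>
       exp_sum (coset (digit_sigma M c s j)) (B \<alpha> j) \<and> (\<forall>\<eta>. B \<alpha> j \<eta> \<in> \<real>)"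
        using AB j semi[OF j] by blast
      then have "\<exists>A' B'. (\<forall>\<alpha>. mi_size \<alpha> = n \<longrightarrow> exp_sum (coset (digit_sigma M c s j)) (A' \<alpha>) \<and> (\<forall>\<eta>. A' \<alpha> \<eta> \<in> \<real>) \<and>
       exp_sum (coset (digit_sigma M c s j)) (B' \<alpha>) \<and> (\<forall>\<eta>. B' \<alpha> \<eta> \<in> \<real>)) \<and>
       SP lam A B j = self_phase n ?z lam (\<lambda>\<beta>. GB \<beta> j) A' B'"
        unfolding SP_def by (intro exI[of _ "\<lambda>\<alpha>. A \<alpha> j"] exI[of _ "\<lambda>\<alpha>. B \<alpha> j"] conjI refl)
      then have "exp_sum (coset (digit_sigma M c s j)) (SP lam A B j) \<and> (\<forall>\<eta>. SP lam A B j \<eta> \<in> \<real>) \<and>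
         has_jet n (\<lambda>\<beta>. ?z * lam \<beta>) (SP lam A B j)"
        using self_phase_iff[of n "digit_sigma M c s j" "\<lambda>\<beta>. GB \<beta> j" lam ?z "SP lam A B j"]
          GB[OF j] lam(2) z_real digit_sigma_props(2)[OF inv c s j] by blast
      then show "exp_sum (coset (a j)) (SP lam A B j)" "\<forall>\<eta>. SP lam A B j \<eta> \<in> \<real>"
        "has_jet n (\<lambda>\<beta>. ?z * lam \<beta>) (SP lam A B j)"
        unfolding coset_J[OF j] by blast+
    qed
    have ZP: "exp_sum (coset (a i)) (ZP lam T i)" "has_jet n (\<lambda>\<beta>. ?z * lam \<beta>) (ZP lam T i)" if i: "i \<in> I1" for i
    proof -
      have "\<exists>T'. (\<forall>\<alpha>. mi_size \<alpha> = n \<longrightarrow> exp_sum (coset 0) (T' \<alpha>)) \<and>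
          FP lam T i = free_phase n ?z (taylor_shift lam (y i)) (\<lambda>\<beta>. G \<beta> i) T'"
        using T i unfolding FP_def by (intro exI[of _ "\<lambda>\<alpha>. T \<alpha> i"]) (auto simp: trig_poly_iff)
      then have FP: "exp_sum (coset 0) (FP lam T i)" "has_jet n (\<lambda>\<beta>. ?z * taylor_shift lam (y i) \<beta>) (FP lam T i)"
        using free_phase_iff[of n "\<lambda>\<beta>. G \<beta> i" "FP lam T i" ?z "taylor_shift lam (y i)"] G[OF i]
        by blast+
      show es: "exp_sum (coset (a i)) (ZP lam T i)"
        using exp_sum_coset_mult[OF FP(1) exp_sum_coset_expi[of "a i"]] by (simp add: ZP_def)
      (* The Taylor shift by y i must be undone by the one by a i = - y i.  Instead of inverting the
         binomial sums, compare with the combination W that has the jet to be obtained: the shift of its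
         jet is the jet of FP, so FP and W times expi (y i) differ by a flat function. *)
      define W where "W = (\<lambda>\<eta>. ?z * (\<Sum>\<beta>\<in>Delta n. lam \<beta> * G \<beta> i \<eta>))"
      have W: "exp_sum (coset 0) W" unfolding W_def using G[OF i] by (intro exp_sum_cmult exp_sum_sum) auto
      have Wj: "has_jet n (\<lambda>\<beta>. ?z * lam \<beta>) W" unfolding W_def by (rule has_jet_combination) (use G[OF i] in auto)
      have Wy: "exp_sum (coset (y i)) (\<lambda>\<eta>. W \<eta> * expi (y i) \<eta>)"
        using exp_sum_coset_mult[OF W exp_sum_coset_expi[of "y i"]] by simp
      have "has_jet n (\<lambda>\<beta>. ?z * taylor_shift lam (y i) \<beta>) (\<lambda>\<eta>. W \<eta> * expi (y i) \<eta>)"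
        using has_jet_expi_mult[OF W Wj, of "y i"] by (simp only: taylor_shift_cmult has_jet_def)
      then have "flat n (\<lambda>\<eta>. FP lam T i \<eta> - W \<eta> * expi (y i) \<eta>)"
        using flat_diff_has_jet[OF FP(1) Wy] FP(2) by blast
      then have "flat n (\<lambda>\<eta>. expi (a i) \<eta> * (FP lam T i \<eta> - W \<eta> * expi (y i) \<eta>))"
        by (rule flat_mult_right[OF exp_sum_coset_expi exp_sum_diff[OF exp_sum_UNIV[OF FP(1)] exp_sum_UNIV[OF Wy]]])
      moreover have "expi (a i) \<eta> * (FP lam T i \<eta> - W \<eta> * expi (y i) \<eta>) = ZP lam T i \<eta> - W \<eta>" for \<eta>
      proof -
        have "expi (a i) \<eta> * expi (y i) \<eta> = 1" by (simp add: a_y flip: expi_add)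
        then show ?thesis by (simp add: ZP_def right_diff_distrib mult.left_commute mult.commute)
      qed
      ultimately have "flat n (\<lambda>\<eta>. ZP lam T i \<eta> - W \<eta>)" by simp
      then show "has_jet n (\<lambda>\<beta>. ?z * lam \<beta>) (ZP lam T i)"
        using flat_diff_has_jet[OF es W Wj] by blast
    qed
    (* On I2 the components are dictated by symmetry. *)
    define H where "H k = (if k \<in> ?J then SP lam A B k else if k \<in> I1 then ZP lam T k
       else (\<lambda>\<eta>. cnj (ZP lam T (p k) \<eta>)))" for k
    have HJ: "H j = SP lam A B j" if "j \<in> ?J" for j using that by (simp add: H_def)
    have HI1: "H i = ZP lam T i" "H (p i) = (\<lambda>\<eta>. cnj (ZP lam T i \<eta>))" if i: "i \<in> I1" for i
    proof -
      have I: "i \<in> ?I" "p i \<in> ?I" "p i \<notin> I1" using i I1 p_I[of i] p_I1[of i] by auto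
      then have "i \<notin> ?J" "p i \<notin> ?J" "p (p i) = i" using p_p[of i] by (auto simp: I_iff J_iff)
      then show "H i = ZP lam T i" "H (p i) = (\<lambda>\<eta>. cnj (ZP lam T i \<eta>))"
        using i I by (simp_all add: H_def)
    qed
    have H: "exp_sum (coset (a k)) (H k) \<and> H (p k) = (\<lambda>\<eta>. cnj (H k \<eta>)) \<and>
        has_jet n (\<lambda>\<beta>. ?z * lam \<beta>) (H k)" if k: "k < ?m" for k
    proof -
      consider "k \<in> ?J" | "k \<in> I1" | "k \<in> ?I" "p k \<in> I1" using k p_I1[of k] by (auto simp: J_iff I_iff)
      then show ?thesis
      proof cases
        case 1
        then have "p k = k" by (simp add: J_iff)
        moreover have "cnj (SP lam A B k \<eta>) = SP lam A B k \<eta>" for \<eta>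
          using SP(2)[OF 1] by (simp add: Reals_cnj_iff)
        ultimately show ?thesis using SP(1,3)[OF 1] by (simp add: HJ[OF 1])
      next
        case 2
        then show ?thesis using ZP by (simp add: HI1)
      next
        case 3
        have pk: "p (p k) = k" using k by (rule p_p)
        have Hk: "H k = (\<lambda>\<eta>. cnj (ZP lam T (p k) \<eta>))" "H (p k) = ZP lam T (p k)"
          using HI1[OF 3(2)] by (simp_all add: pk)
        have "exp_sum (coset (a k)) (H k)"
          using exp_sum_coset_cnj[OF ZP(1)[OF 3(2)]] coset_p[of "p k"] by (simp add: Hk pk)
        moreover have "has_jet n (\<lambda>\<beta>. ?z * lam \<beta>) (H k)"
        proof -
          have "(-1) ^ mi_size \<beta> * cnj (?z * lam \<beta>) = ?z * lam \<beta>" if "\<beta> \<in> Delta n" for \<beta>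
          proof -
            have "(-1) ^ mi_size \<beta> * cnj (?z * lam \<beta>) =
                ((-1) ^ mi_size \<beta> * (-1) ^ mi_size \<beta>) * (?z * lam \<beta>)"
              using lam(2) that by simp
            then show ?thesis by (simp flip: power_mult_distrib)
          qed
          moreover have "has_jet n (\<lambda>\<beta>. (-1) ^ mi_size \<beta> * cnj (?z * lam \<beta>)) (H k)"
            unfolding Hk by (rule has_jet_cnj[OF ZP[OF 3(2)]])
          ultimately show ?thesis unfolding has_jet_def by metis
        qed
        ultimately show ?thesis by (simp add: Hk)
      qed
    qed
    have "m0 \<xi> = expi c \<xi> * (\<Sum>k<?m. H k (star_act M \<xi>))" for \<xi>
      unfolding sum_split m0[rule_format] by (simp add: HJ HI1)
    then show "\<exists>lam H. lam 0 = 1 \<and> (\<forall>\<beta>\<in>Delta n. cnj (lam \<beta>) = (-1) ^ mi_size \<beta> * lam \<beta>) \<and>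
       (\<forall>k<?m. exp_sum (coset (a k)) (H k) \<and> H (p k) = (\<lambda>\<eta>. cnj (H k \<eta>)) \<and>
          has_jet n (\<lambda>\<beta>. ?z * lam \<beta>) (H k)) \<and>
       (\<forall>\<xi>. m0 \<xi> = expi c \<xi> * (\<Sum>k<?m. H k (star_act M \<xi>)))"
      using lam H by blast
  qed
qed

end
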